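(* Let $\alpha\in(0,1]$, let $f=\mathbb{E}_{\xi}[f_\xi]\in\mathbb{E}\mathcal{L}_{\mathrm{sym}}^*(\alpha)$ with constants $L_0,L_1>0$, and suppose that the stochastic gradients are unbiased, $\mathbb{E}_{\xi\sim\mathbb{P}}[\nabla f_\xi(w)]=\nabla f(w)$, and satisfy $\mathbb{E}_{\xi\sim\mathbb{P}}\|\nabla f_\xi(w)-\nabla f(w)\|^2\le\Gamma^2\|\nabla f(w)\|^2+\Lambda^2$ for all $w$, for some $\Gamma,\Lambda>0$. Let $\epsilon\in(0,1)$ be the target accuracy. Run the SPIDER algorithm with epoch size $q$, batchsizes $|S_t|=B$ when $t\bmod q=0$ and $|S_t|=B'$ otherwise, where $$B\ge\Omega\big(\max\{\Lambda^2\epsilon^{-2},\Gamma^2q^2\}\big),\qquad B'\ge\Omega\big(\max\{q,q^2\epsilon^2\}\big),$$ and learning rate $$\gamma=\frac{\epsilon}{2\overline{K}_0+4\overline{K}_2+2\overline{K}_1(\Lambda^{\alpha}+\Gamma^{\alpha}+1)+1}\ \text{ if }\alpha\in(0,1),\qquad \gamma=\frac{\epsilon}{5L_1\sqrt{\Gamma^2+1}+8\sqrt{L_0^2+2L_1^2\Lambda^2}}\ \text{ if }\alpha=1.$$ Then for $T=qK$ iterations, where $K\in\mathbb{N}^+$, $$\mathbb{E}\|\nabla f(w_{\widetilde T})\|\le\frac{16}{5T\gamma}\big(\mathbb{E}f(w_0)-f^*\big)+\frac{4\epsilon}{5}.$$ In particular, to achieve $\mathbb{E}\|\nabla f(w_{\widetilde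 T})\|\le\epsilon$, one can choose $B=\mathcal{O}(\epsilon^{-2})$, $B'=q=\mathcal{O}(\epsilon^{-1})$, $\gamma=\mathcal{O}(\epsilon)$ (namely $\gamma=\frac{\epsilon}{2\overline{K}_0+4\overline{K}_2+2\overline{K}_1(\Lambda^{\alpha}+\Gamma^{\alpha}+1)+1}$ if $\alpha\in(0,1)$ and $\gamma=\frac{\epsilon}{5L_1\sqrt{\Gamma^2+1}+8\sqrt{L_0^2+2L_1^2\Lambda^2}}$ if $\alpha=1$) and $T=\mathcal{O}(\epsilon^{-2})$ so that the conditions $B\ge\Omega\big(\max\{\Lambda^2\epsilon^{-2},\Gamma^2q^2\}\big)$, $B'\ge\Omega\big(\max\{q,q^2\epsilon^2\}\big)$ and $T=qK$ with $K\in\mathbb{N}^+$ are satisfied. Consequently, the overall sample complexity $\sum_{t=0}^{T-1}|S_t|$ is $\mathcal{O}(\epsilon^{-3})$.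
   Context: For $\alpha\in[0,1]$, $\mathbb{E}\mathcal{L}_{\mathrm{sym}}^*(\alpha)$ is the class of differentiable stochastic functions $f=\mathbb{E}_{\xi\sim\mathbb{P}}[f_\xi]$ on $\mathbb{R}^d$ for which there are constants $L_0,L_1>0$ with $$\mathbb{E}_{\xi\sim\mathbb{P}}\|\nabla f_\xi(w')-\nabla f_\xi(w)\|^2\le\|w'-w\|^2\,\mathbb{E}_{\xi\sim\mathbb{P}}\Big(L_0+L_1\max_{\theta\in[0,1]}\|\nabla f_\xi(\theta w'+(1-\theta)w)\|^{\alpha}\Big)^2\quad\text{for all }w,w'\in\mathbb{R}^d.$$ For $\alpha\in(0,1)$: $\overline{K}_0=2^{\frac{2-\alpha}{1-\alpha}}L_0$, $\overline{K}_1=2^{\frac{2-\alpha}{1-\alpha}}L_1$, $\overline{K}_2=(5L_1)^{\frac{1}{1-\alpha}}$. SPIDER algorithm: for $t=0,1,\dots,T-1$, draw a minibatch $S_t$ of i.i.d. samples from $\mathbb{P}$, independent of the past; with $\nabla f_S(w):=\frac1{|S|}\sum_{\xi\in S}\nabla f_\xi(w)$, set $v_t=\nabla f_{S_t}(w_t)$ if $t\bmod q=0$ and $v_t=v_{t-1}+\nabla f_{S_t}(w_t)-\nabla f_{S_t}(w_{t-1})$ otherwise; then $w_{t+1}=w_t-\gamma\frac{v_t}{\|v_t\|}$ (with $w_{t+1}=w_t$ if $v_t=0$). Output $w_{\widetilde T}$ with $\widetilde T$ uniform on $\{0,\dots,T-1\}$, independent of everything else. $f^*:=\min_{w\in\mathbb{R}^d}f(w)$,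 assumed to exist (finite). $B\ge\Omega(X)$ means $B\ge cX$ for a suitable universal numerical constant $c>0$. $\mathcal{O}(\cdot)$ is as $\epsilon\to0$ with all other quantities fixed. Norms are Euclidean. *)

theory Defs
  imports "HOL-Probability.Probability" "HOL-Library.Landau_Symbols"
begin

definition grad :: "('a::real_inner \<Rightarrow> real) \<Rightarrow> 'a \<Rightarrow> 'a" where
  "grad f w = (THE D. GDERIV f w :> D)"

definition risk :: "'s measure \<Rightarrow> ('s \<Rightarrow> 'a \<Rightarrow> real) \<Rightarrow> 'a \<Rightarrow> real" where
  "risk P F w = (\<integral>\<xi>. F \<xi> w \<partial>P)"

definition differentiable_stochastic ::
    "'s measure \<Rightarrow> ('s \<Rightarrow> 'a::euclidean_space \<Rightarrow> real) \<Rightarrow> bool" where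
  "differentiable_stochastic P F \<longleftrightarrow>
     prob_space P \<and>
     (\<forall>w. integrable P (\<lambda>\<xi>. F \<xi> w)) \<and>
     (\<forall>\<xi>\<in>space P. \<forall>w. F \<xi> differentiable (at w)) \<and>
     (\<forall>w. risk P F differentiable (at w))"

(* max over theta in [0,1] of the alpha-th power of the gradient norm on the segment from w to w'.
   The case distinction gives 0^0 = 1, whereas 0 powr 0 = 0. *)
definition segment_max :: "('a::real_inner \<Rightarrow> real) \<Rightarrow> real \<Rightarrow> 'a \<Rightarrow> 'a \<Rightarrow> real" where
  "segment_max g \<alpha> w w' =
     (SUP \<theta>\<in>{0..1}. if \<alpha> = 0 then 1
                     else norm (grad g (\<theta> *\<^sub>R w' + (1 - \<theta>) *\<^sub>R w)) powr \<alpha>)"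

(* The continuity clause makes the supremum in segment_max a maximum for almost every sample.
   The integrability clauses say that both expectations exist and are finite; without them the
   Bochner integrals would silently be 0. *)
definition EL_sym_star ::
    "'s measure \<Rightarrow> ('s \<Rightarrow> 'a::euclidean_space \<Rightarrow> real) \<Rightarrow> real \<Rightarrow> real \<Rightarrow> real \<Rightarrow> bool" where
  "EL_sym_star P F \<alpha> L0 L1 \<longleftrightarrow>
     differentiable_stochastic P F \<and> 0 \<le> \<alpha> \<and> \<alpha> \<le> 1 \<and> L0 > 0 \<and> L1 > 0 \<and>
     (\<forall>w w'.
        (AE \<xi> in P. continuous_on {0..1}
            (\<lambda>\<theta>. norm (grad (F \<xi>) (\<theta> *\<^sub>R w' + (1 - \<theta>) *\<^sub>R w)))) \<and>
        integrable P (\<lambda>\<xi>. (norm (grad (F \<xi>) w' - grad (F \<xi>) w))\<^sup>2) \<and>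
        integrable P (\<lambda>\<xi>. (L0 + L1 * segment_max (F \<xi>) \<alpha> w w')\<^sup>2) \<and>
        (\<integral>\<xi>. (norm (grad (F \<xi>) w' - grad (F \<xi>) w))\<^sup>2 \<partial>P)
          \<le> (norm (w' - w))\<^sup>2 * (\<integral>\<xi>. (L0 + L1 * segment_max (F \<xi>) \<alpha> w w')\<^sup>2 \<partial>P))"

definition unbiased_gradients ::
    "'s measure \<Rightarrow> ('s \<Rightarrow> 'a::euclidean_space \<Rightarrow> real) \<Rightarrow> bool" where
  "unbiased_gradients P F \<longleftrightarrow>
     (\<forall>w. integrable P (\<lambda>\<xi>. grad (F \<xi>) w) \<and>
          (\<integral>\<xi>. grad (F \<xi>) w \<partial>P) = grad (risk P F) w)"

definition gradient_variance_bound ::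
    "'s measure \<Rightarrow> ('s \<Rightarrow> 'a::euclidean_space \<Rightarrow> real) \<Rightarrow> real \<Rightarrow> real \<Rightarrow> bool" where
  "gradient_variance_bound P F \<Gamma> \<Lambda> \<longleftrightarrow>
     (\<forall>w. integrable P (\<lambda>\<xi>. (norm (grad (F \<xi>) w - grad (risk P F) w))\<^sup>2) \<and>
          (\<integral>\<xi>. (norm (grad (F \<xi>) w - grad (risk P F) w))\<^sup>2 \<partial>P)
            \<le> \<Gamma>\<^sup>2 * (norm (grad (risk P F) w))\<^sup>2 + \<Lambda>\<^sup>2)"

definition K0_bar :: "real \<Rightarrow> real \<Rightarrow> real" where
  "K0_bar \<alpha> L0 = 2 powr ((2 - \<alpha>) / (1 - \<alpha>)) * L0"

definition K1_bar :: "real \<Rightarrow> real \<Rightarrow> real" where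
  "K1_bar \<alpha> L1 = 2 powr ((2 - \<alpha>) / (1 - \<alpha>)) * L1"

definition K2_bar :: "real \<Rightarrow> real \<Rightarrow> real" where
  "K2_bar \<alpha> L1 = (5 * L1) powr (1 / (1 - \<alpha>))"

definition learning_rate ::
    "real \<Rightarrow> real \<Rightarrow> real \<Rightarrow> real \<Rightarrow> real \<Rightarrow> real \<Rightarrow> real" where
  "learning_rate \<alpha> L0 L1 \<Gamma> \<Lambda> \<epsilon> =
     (if \<alpha> < 1
      then \<epsilon> / (2 * K0_bar \<alpha> L0 + 4 * K2_bar \<alpha> L1
                + 2 * K1_bar \<alpha> L1 * (\<Lambda> powr \<alpha> + \<Gamma> powr \<alpha> + 1) + 1)
      else \<epsilon> / (5 * L1 * sqrt (\<Gamma>\<^sup>2 + 1) + 8 * sqrt (L0\<^sup>2 + 2 * L1\<^sup>2 * \<Lambda>\<^sup>2)))"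

(* The universal constants hidden in the two Omega-conditions. They are given as numerals because
   a constant existentially quantified inside a theorem could depend on the type variables, in
   particular on the dimension. The value 1 for the small batches is what allows B' = q. *)
definition large_batch :: "real \<Rightarrow> real \<Rightarrow> real \<Rightarrow> nat \<Rightarrow> nat \<Rightarrow> bool" where
  "large_batch \<Gamma> \<Lambda> \<epsilon> q B \<longleftrightarrow>
     real B \<ge> 10000 * max (\<Lambda>\<^sup>2 / \<epsilon>\<^sup>2) (\<Gamma>\<^sup>2 * (real q)\<^sup>2)"

definition small_batch :: "real \<Rightarrow> nat \<Rightarrow> nat \<Rightarrow> bool" where
  "small_batch \<epsilon> q B' \<longleftrightarrow> real B' \<ge> max (real q) ((real q)\<^sup>2 * \<epsilon>\<^sup>2)"

definition batch_size :: "nat \<Rightarrow> nat \<Rightarrow> nat \<Rightarrow> nat \<Rightarrow> nat" where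
  "batch_size q B B' t = (if t mod q = 0 then B else B')"

definition batch_grad ::
    "('s \<Rightarrow> 'a::euclidean_space \<Rightarrow> real) \<Rightarrow> nat \<Rightarrow> (nat \<Rightarrow> 's) \<Rightarrow> 'a \<Rightarrow> 'a" where
  "batch_grad F b x w = (1 / real b) *\<^sub>R (\<Sum>i<b. grad (F (x i)) w)"

(* spider ... t is the pair (w_t, v_t); x t i is the i-th sample of S_t, of which only those with
   i < |S_t| are used. sgn v is v / norm v, and sgn 0 = 0. *)
primrec spider ::
    "('s \<Rightarrow> 'a::euclidean_space \<Rightarrow> real) \<Rightarrow> real \<Rightarrow> nat \<Rightarrow> nat \<Rightarrow> nat \<Rightarrow> 'a \<Rightarrow> (nat \<Rightarrow> nat \<Rightarrow> 's)
       \<Rightarrow> nat \<Rightarrow> 'a \<times> 'a" where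
  "spider F \<gamma> q B B' w\<^sub>0 x 0 = (w\<^sub>0, batch_grad F (batch_size q B B' 0) (x 0) w\<^sub>0)"
| "spider F \<gamma> q B B' w\<^sub>0 x (Suc t) =
     (let (w, v) = spider F \<gamma> q B B' w\<^sub>0 x t;
          w' = w - \<gamma> *\<^sub>R sgn v;
          g = batch_grad F (batch_size q B B' (Suc t)) (x (Suc t))
      in (w', if Suc t mod q = 0 then g w' else v + g w' - g w))"

definition spider_iterate ::
    "('s \<Rightarrow> 'a::euclidean_space \<Rightarrow> real) \<Rightarrow> real \<Rightarrow> nat \<Rightarrow> nat \<Rightarrow> nat \<Rightarrow> 'a \<Rightarrow> (nat \<Rightarrow> nat \<Rightarrow> 's)
       \<Rightarrow> nat \<Rightarrow> 'a" where
  "spider_iterate F \<gamma> q B B' w\<^sub>0 x t = fst (spider F \<gamma> q B B' w\<^sub>0 x t)"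

(* prob_space.indep_var needs both variables to have the same value type; this is the same notion
   without that restriction. *)
definition indep_rv ::
    "'o measure \<Rightarrow> 'b measure \<Rightarrow> ('o \<Rightarrow> 'b) \<Rightarrow> 'c measure \<Rightarrow> ('o \<Rightarrow> 'c) \<Rightarrow> bool" where
  "indep_rv M N Y N' Y' \<longleftrightarrow>
     Y \<in> measurable M N \<and> Y' \<in> measurable M N' \<and>
     prob_space.indep_set M
       {Y -` A \<inter> space M | A. A \<in> sets N}
       {Y' -` A \<inter> space M | A. A \<in> sets N'}"

(* On the probability space M: the samples X t i are i.i.d. with law P and jointly independent of
   the (possibly random) starting point; the output index \<tau> is uniform on {0..<T} and independent
   of the starting point and all samples. *)
definition spider_randomness ::
    "'o measure \<Rightarrow> 's measure \<Rightarrow> ('o \<Rightarrow> 'a::euclidean_space) \<Rightarrow> ('o \<Rightarrow> nat \<Rightarrow> nat \<Rightarrow> 's)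
       \<Rightarrow> nat \<Rightarrow> ('o \<Rightarrow> nat) \<Rightarrow> bool" where
  "spider_randomness M P w\<^sub>0 X T \<tau> \<longleftrightarrow>
     prob_space M \<and>
     (\<forall>t i. distr M P (\<lambda>\<omega>. X \<omega> t i) = P) \<and>
     prob_space.indep_vars M (\<lambda>_. P) (\<lambda>(t, i) \<omega>. X \<omega> t i) UNIV \<and>
     indep_rv M borel w\<^sub>0 (Pi\<^sub>M UNIV (\<lambda>_. P)) (\<lambda>\<omega> (t, i). X \<omega> t i) \<and>
     distr M (count_space UNIV) \<tau> = measure_pmf (pmf_of_set {0..<T}) \<and>
     indep_rv M (count_space UNIV) \<tau>
       (borel \<Otimes>\<^sub>M Pi\<^sub>M UNIV (\<lambda>_. P)) (\<lambda>\<omega>. (w\<^sub>0 \<omega>, \<lambda>(t, i). X \<omega> t i))"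

end

theory Submission
  imports Defs
begin

text \<open>Write \<open>g\<close> for the norm of the gradient of the risk at the current iterate and \<open>e\<close> for the norm of
  the error of the SPIDER direction. A normalized step of length \<open>\<gamma>\<close> lowers the risk by
  at least \<open>\<gamma> * g - 2 * \<gamma> * e - \<gamma> * \<epsilon> * (\<beta> + \<kappa> * g) / 2\<close>. Summed over the run, this bounds the average of \<open>g\<close>,
  provided that the errors cost only a fraction of \<open>g\<close> plus a fraction of \<open>\<epsilon>\<close>.

  The smoothness assumption controls gradient differences only in mean square, and by a maximum over a
  segment that varies with the sample. Both defects vanish at once: cut the segment into \<open>n\<close> pieces, and
  let \<open>V\<close> be the length of the polygon of sample gradients. Applying the assumption to each piece bounds the
  mean square of \<open>V\<close> by the squared length of the segment times the very mean that contains the maximum, while the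
  maximum is, up to a vanishing error, at most the gradient norm at the start plus \<open>V\<close>. So this mean
  bounds itself (\<open>mean_square_grad_diff_le\<close>), and the inequality can be solved: for \<open>\<alpha> < 1\<close> because the power
  grows sublinearly, for \<open>\<alpha> = 1\<close> because the step is short. The learning rate is chosen so that a step changes the
  gradients by at most \<open>\<epsilon> * (\<beta> + \<kappa> * g)\<close> in root mean square, with \<open>6 * \<beta> + 4 * \<kappa> \<le> 1\<close>
  (\<open>mean_square_grad_diff_le_affine\<close>); all later estimates use only these two constants.

  The error of the direction is a martingale inside an epoch, and its conditional variance grows in each step
  by at most the square of \<open>\<epsilon> * (\<beta> + \<kappa> * g)\<close> divided by the batch size. Only first moments of \<open>g\<close> are
  under control, since the risk of the starting point is merely integrable; hence the second moment of the error
  may be infinite. The remedy is to divide the squared error by the square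
  root of a bound of its accumulated conditional variance, the budget, which is known one step in advance. Then the
  martingale property and a telescoping sum of square roots give a bound of \<open>e\<close> in mean by three halves of the
  mean square root of the budget (\<open>expected_err_le\<close>).

  It remains to compare the square root of a sum of squares of \<open>g\<close> over an epoch with the average of \<open>g\<close>.
  Bounding it by the plain sum loses too much for batches of size exactly \<open>q\<close>. But \<open>g\<close> shrinks by at most a
  quarter in a step, up to a small constant, so that no single term dominates the sum; this improves the
  bound by the factor \<open>16 / 25\<close> (\<open>sum_squares_le_of_slow_variation\<close>), and the constants then close
  (\<open>sum_mean_gn_le\<close>).\<close>

section \<open>Gradients\<close>

text \<open>Differentiability determines the gradient uniquely, so the definite description in the definition of the
  gradient denotes it.\<close>

lemma GDERIV_grad:
  fixes f :: "'a::euclidean_space \<Rightarrow> real"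
  assumes "f differentiable (at w)"
  shows "GDERIV f w :> grad f w"
proof -
  obtain f' where f': "(f has_derivative f') (at w)"
    using assms unfolding differentiable_def by blast
  interpret f': bounded_linear f' using f' by (rule has_derivative_bounded_linear)
  have rep: "f' h = h \<bullet> (\<Sum>b\<in>Basis. f' b *\<^sub>R b)" for h
  proof -
    have "f' h = f' (\<Sum>b\<in>Basis. (h \<bullet> b) *\<^sub>R b)" by (simp add: euclidean_representation)
    also have "\<dots> = (\<Sum>b\<in>Basis. (h \<bullet> b) * f' b)"
      by (simp add: f'.sum f'.scaleR)
    also have "\<dots> = h \<bullet> (\<Sum>b\<in>Basis. f' b *\<^sub>R b)"
      by (simp add: inner_sum_right mult.commute)
    finally show ?thesis .
  qed
  have "GDERIV f w :> (\<Sum>b\<in>Basis. f' b *\<^sub>R b)"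
    unfolding gderiv_def using f' rep by (simp flip: rep)
  moreover have "D = D'" if "GDERIV f w :> D" "GDERIV f w :> D'" for D D'
  proof -
    have "(\<lambda>h. h \<bullet> D) = (\<lambda>h. h \<bullet> D')"
      using that unfolding gderiv_def by (rule has_derivative_unique)
    then have "(D - D') \<bullet> D = (D - D') \<bullet> D'" by metis
    then have "(D - D') \<bullet> (D - D') = 0" by (simp only: inner_diff_right)
    then show ?thesis by simp
  qed
  ultimately have "\<exists>!D. GDERIV f w :> D" by blast
  then show ?thesis unfolding grad_def by (rule theI')
qed

lemma has_derivative_grad:
  fixes f :: "'a::euclidean_space \<Rightarrow> real"
  assumes "f differentiable (at w)"
  shows "(f has_derivative (\<lambda>h. h \<bullet> grad f w)) (at w)"
  using GDERIV_grad[OF assms] unfolding gderiv_def .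

lemma DERIV_along_line:
  fixes f :: "'a::euclidean_space \<Rightarrow> real"
  assumes "f differentiable (at (w + t *\<^sub>R h))"
  shows "((\<lambda>t. f (w + t *\<^sub>R h)) has_real_derivative (h \<bullet> grad f (w + t *\<^sub>R h))) (at t)"
proof -
  have "((\<lambda>t. w + t *\<^sub>R h) has_derivative (\<lambda>s. s *\<^sub>R h)) (at t)"
    by (auto intro!: derivative_eq_intros)
  from has_derivative_compose[OF this has_derivative_grad[OF assms]]
  show ?thesis
    by (simp add: has_field_derivative_def mult.commute[of "h \<bullet> _"] mult_commute_abs)
qed

text \<open>As a limit of difference quotients along a sequence, the gradient inherits measurability from the function.\<close>

lemma grad_component_limit:
  fixes f :: "'a::euclidean_space \<Rightarrow> real"
  assumes "f differentiable (at w)"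
  shows "(\<lambda>n. real (Suc n) * (f (w + (1 / real (Suc n)) *\<^sub>R b) - f w)) \<longlonglongrightarrow> grad f w \<bullet> b"
proof -
  have "((\<lambda>t. f (w + t *\<^sub>R b)) has_real_derivative (b \<bullet> grad f w)) (at 0)"
    using DERIV_along_line[of f w 0 b] assms by simp
  then have lim: "((\<lambda>h. (f (w + h *\<^sub>R b) - f w) / h) \<longlongrightarrow> b \<bullet> grad f w) (at 0)"
    unfolding DERIV_def by simp
  have "filterlim (\<lambda>n. 1 / real (Suc n)) (at 0) sequentially"
    unfolding filterlim_at using LIMSEQ_inverse_real_of_nat by (auto simp: inverse_eq_divide)
  from filterlim_compose[OF lim this] show ?thesis
    by (simp add: inner_commute mult.commute)
qed

text \<open>Caratheodory functions are jointly measurable: rounding the second argument to a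
  grid reduces the claim to countably many measurable sections.\<close>

lemma borel_measurable_Caratheodory:
  fixes F :: "'s \<Rightarrow> 'a::euclidean_space \<Rightarrow> real"
  assumes meas: "\<And>w. (\<lambda>\<xi>. F \<xi> w) \<in> borel_measurable P"
    and cont: "\<And>\<xi> w. \<xi> \<in> space P \<Longrightarrow> isCont (F \<xi>) w"
  shows "(\<lambda>(\<xi>, w). F \<xi> w) \<in> borel_measurable (P \<Otimes>\<^sub>M borel)"
proof -
  define r :: "nat \<Rightarrow> 'a \<Rightarrow> 'a" where
    "r n w = (\<Sum>b\<in>Basis. (of_int \<lfloor>real (Suc n) * (w \<bullet> b)\<rfloor> / real (Suc n)) *\<^sub>R b)" for n w
  have r_borel: "r n \<in> borel_measurable borel" for n
    unfolding r_def by measurable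
  have r_countable: "countable (range (r n))" for n
  proof -
    have "range (r n) \<subseteq> (\<lambda>k. \<Sum>b\<in>Basis. (of_int (k b) / real (Suc n)) *\<^sub>R b) ` (PiE Basis (\<lambda>_. UNIV))"
    proof safe
      fix w
      show "r n w \<in> (\<lambda>k. \<Sum>b\<in>Basis. (of_int (k b) / real (Suc n)) *\<^sub>R b) ` (PiE Basis (\<lambda>_. UNIV))"
        by (rule image_eqI[of _ _ "\<lambda>b\<in>Basis. \<lfloor>real (Suc n) * (w \<bullet> b)\<rfloor>"]) (auto simp: r_def)
    qed
    moreover have "countable (PiE (Basis::'a set) (\<lambda>_. UNIV :: int set))"
      by (intro countable_PiE) auto
    ultimately show ?thesis by (meson countable_image countable_subset)
  qed
  have r_lim: "(\<lambda>n. r n w) \<longlonglongrightarrow> w" for w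
  proof -
    have "(\<lambda>n. of_int \<lfloor>real (Suc n) * x\<rfloor> / real (Suc n)) \<longlonglongrightarrow> x" for x :: real
    proof (rule tendsto_sandwich[of "\<lambda>n. x - 1 / real (Suc n)" _ _ "\<lambda>n. x"])
      show "\<forall>\<^sub>F n in sequentially. x - 1 / real (Suc n) \<le> of_int \<lfloor>real (Suc n) * x\<rfloor> / real (Suc n)"
      proof (intro always_eventually allI)
        fix n
        have "real (Suc n) * x - 1 \<le> of_int \<lfloor>real (Suc n) * x\<rfloor>" by linarith
        then have "(real (Suc n) * x - 1) / real (Suc n) \<le> of_int \<lfloor>real (Suc n) * x\<rfloor> / real (Suc n)"
          by (intro divide_right_mono) auto
        then show "x - 1 / real (Suc n) \<le> of_int \<lfloor>real (Suc n) * x\<rfloor> / real (Suc n)"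
          by (simp add: diff_divide_distrib)
      qed
      show "\<forall>\<^sub>F n in sequentially. of_int \<lfloor>real (Suc n) * x\<rfloor> / real (Suc n) \<le> x"
      proof (intro always_eventually allI)
        fix n
        have "of_int \<lfloor>real (Suc n) * x\<rfloor> \<le> x * real (Suc n)" by (metis mult.commute of_int_floor_le)
        then show "of_int \<lfloor>real (Suc n) * x\<rfloor> / real (Suc n) \<le> x"
          by (subst pos_divide_le_eq) auto
      qed
      show "(\<lambda>n. x - 1 / real (Suc n)) \<longlonglongrightarrow> x"
        using tendsto_diff[OF tendsto_const LIMSEQ_inverse_real_of_nat, of x]
        by (simp add: inverse_eq_divide)
    qed simp
    then have "(\<lambda>n. r n w) \<longlonglongrightarrow> (\<Sum>b\<in>Basis. (w \<bullet> b) *\<^sub>R b)"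
      unfolding r_def by (intro tendsto_sum tendsto_scaleR tendsto_const)
    then show ?thesis by (simp add: euclidean_representation)
  qed
  have approx: "(\<lambda>x. F (fst x) (r n (snd x))) \<in> borel_measurable (P \<Otimes>\<^sub>M borel)" for n
  proof (rule measurable_compose_countable'[where g="\<lambda>x. r n (snd x)" and I="range (r n)"])
    show "(\<lambda>x. F (fst x) i) \<in> borel_measurable (P \<Otimes>\<^sub>M borel)" for i
      using measurable_compose[OF measurable_fst meas] .
    have "r n \<in> measurable borel (count_space (range (r n)))"
      using r_countable measurable_sets_borel[OF r_borel, of "{_}"]
      by (subst measurable_count_space_eq_countable) auto
    from measurable_compose[OF measurable_snd this]
    show "(\<lambda>x. r n (snd x)) \<in> measurable (P \<Otimes>\<^sub>M borel) (count_space (range (r n)))" .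
  qed (rule r_countable)
  show ?thesis
  proof (rule borel_measurable_LIMSEQ_real[OF _ approx])
    fix x assume "x \<in> space (P \<Otimes>\<^sub>M (borel :: 'a measure))"
    then have "fst x \<in> space P" by (auto simp: space_pair_measure)
    from isCont_tendsto_compose[OF cont[OF this] r_lim]
    show "(\<lambda>n. F (fst x) (r n (snd x))) \<longlonglongrightarrow> (case x of (\<xi>, w) \<Rightarrow> F \<xi> w)"
      by (simp add: case_prod_beta)
  qed
qed

lemma borel_measurable_grad_joint:
  fixes F :: "'s \<Rightarrow> 'a::euclidean_space \<Rightarrow> real"
  assumes meas: "\<And>w. (\<lambda>\<xi>. F \<xi> w) \<in> borel_measurable P"
    and diff: "\<And>\<xi> w. \<xi> \<in> space P \<Longrightarrow> F \<xi> differentiable (at w)"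
  shows "(\<lambda>(\<xi>, w). grad (F \<xi>) w) \<in> borel_measurable (P \<Otimes>\<^sub>M borel)"
proof (subst borel_measurable_euclidean_space, intro ballI)
  fix b :: 'a assume "b \<in> Basis"
  have F: "(\<lambda>(\<xi>, w). F \<xi> w) \<in> borel_measurable (P \<Otimes>\<^sub>M borel)"
    using meas diff by (intro borel_measurable_Caratheodory differentiable_imp_continuous_within) auto
  have F': "(\<lambda>x. F (fst x) (g (snd x))) \<in> borel_measurable (P \<Otimes>\<^sub>M borel)"
    if "g \<in> borel_measurable borel" for g
  proof -
    have "(\<lambda>x. (fst x, g (snd x))) \<in> measurable (P \<Otimes>\<^sub>M borel) (P \<Otimes>\<^sub>M borel)"
      using that by measurable
    from measurable_compose[OF this F] show ?thesis by simp
  qed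
  have approx: "(\<lambda>x. real (Suc n) * (F (fst x) (snd x + (1 / real (Suc n)) *\<^sub>R b) - F (fst x) (snd x)))
       \<in> borel_measurable (P \<Otimes>\<^sub>M borel)" for n
    using F'[of "\<lambda>w. w + (1 / real (Suc n)) *\<^sub>R b"] F'[of "\<lambda>w. w"] by measurable
  show "(\<lambda>x. (case x of (\<xi>, w) \<Rightarrow> grad (F \<xi>) w) \<bullet> b) \<in> borel_measurable (P \<Otimes>\<^sub>M borel)"
  proof (rule borel_measurable_LIMSEQ_real[OF _ approx])
    fix x assume "x \<in> space (P \<Otimes>\<^sub>M (borel :: 'a measure))"
    then have "F (fst x) differentiable (at (snd x))" using diff by (auto simp: space_pair_measure)
    from grad_component_limit[OF this]
    show "(\<lambda>n. real (Suc n) * (F (fst x) (snd x + (1 / real (Suc n)) *\<^sub>R b) - F (fst x) (snd x)))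
       \<longlonglongrightarrow> (case x of (\<xi>, w) \<Rightarrow> grad (F \<xi>) w) \<bullet> b"
      by (simp add: case_prod_beta)
  qed
qed

lemma borel_measurable_grad:
  fixes f :: "'a::euclidean_space \<Rightarrow> real"
  assumes "\<And>w. f differentiable (at w)"
  shows "grad f \<in> borel_measurable borel"
proof -
  have "(\<lambda>w. ((), w)) \<in> measurable borel (count_space UNIV \<Otimes>\<^sub>M borel)"
    by measurable
  moreover have "(\<lambda>(x, w). grad f w) \<in> borel_measurable (count_space (UNIV :: unit set) \<Otimes>\<^sub>M borel)"
    using assms by (intro borel_measurable_grad_joint) auto
  ultimately have "(\<lambda>w. (\<lambda>(x, w). grad f w) ((), w)) \<in> borel_measurable borel"
    by (rule measurable_compose)
  then show ?thesis by simp
qed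

section \<open>Powers and mean squares\<close>

text \<open>Concavity of the power: its graph lies below the tangent at \<open>c\<close>. This linearization turns moments of
  order \<open>\<alpha>\<close> into first moments.\<close>

lemma powr_le_tangent:
  fixes a c \<alpha> :: real
  assumes "0 \<le> \<alpha>" "\<alpha> \<le> 1" "0 \<le> a" "0 < c"
  shows "a powr \<alpha> \<le> (1 - \<alpha>) * c powr \<alpha> + \<alpha> * c powr (\<alpha> - 1) * a"
proof (cases "a = 0")
  case True
  then show ?thesis using assms by simp
next
  case False
  have "a powr \<alpha> * c powr (1 - \<alpha>) \<le> \<alpha> * a + (1 - \<alpha>) * c"
    using Youngs_inequality_0[of \<alpha> "1 - \<alpha>" a c] assms False by auto
  then have "a powr \<alpha> * c powr (1 - \<alpha>) * c powr (\<alpha> - 1) \<le> (\<alpha> * a + (1 - \<alpha>) * c) * c powr (\<alpha> - 1)"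
    by (intro mult_right_mono) auto
  moreover have "c powr (1 - \<alpha>) * c powr (\<alpha> - 1) = 1"
    using assms by (simp flip: powr_add)
  moreover have "c * c powr (\<alpha> - 1) = c powr \<alpha>"
    using assms by (simp add: powr_mult_base)
  ultimately show ?thesis by (simp add: algebra_simps)
qed

lemma powr_subadditive:
  fixes a b \<alpha> :: real
  assumes "0 < \<alpha>" "\<alpha> \<le> 1" "0 \<le> a" "0 \<le> b"
  shows "(a + b) powr \<alpha> \<le> a powr \<alpha> + b powr \<alpha>"
proof (cases "a + b = 0")
  case True
  then show ?thesis using assms by simp
next
  case False
  then have s: "a + b > 0" using assms by linarith
  have le: "x * (a + b) powr (\<alpha> - 1) \<le> x powr \<alpha>" if "0 \<le> x" "x \<le> a + b" for x
  proof (cases "x = 0")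
    case False
    then have "x > 0" using that by simp
    then have "(a + b) powr (\<alpha> - 1) \<le> x powr (\<alpha> - 1)"
      using that assms by (intro powr_mono2') auto
    then have "x * (a + b) powr (\<alpha> - 1) \<le> x * x powr (\<alpha> - 1)"
      using that by (intro mult_left_mono) auto
    then show ?thesis using \<open>x > 0\<close> by (simp add: powr_mult_base)
  qed simp
  have "(a + b) powr \<alpha> = (a + b) * (a + b) powr (\<alpha> - 1)"
    using s by (simp add: powr_mult_base)
  also have "\<dots> \<le> a powr \<alpha> + b powr \<alpha>"
    using le[of a] le[of b] assms by (simp add: algebra_simps)
  finally show ?thesis .
qed

text \<open>The factor \<open>1 / (1 - \<alpha>)\<close> that the self-bounding inequality costs is absorbed by the power of two in the
  smoothness constants. The bound comes from \<open>exp y \<ge> exp 1 * y\<close> at \<open>y = x * ln 2\<close>.\<close>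

lemma le_two_powr:
  fixes x :: real
  assumes "x \<ge> 0"
  shows "5 / 3 * x \<le> 2 powr x"
proof -
  have "x * ln 2 \<le> exp (x * ln 2 - 1)"
    using exp_ge_add_one_self[of "x * ln 2 - 1"] by simp
  then have 1: "x * ln 2 * exp 1 \<le> 2 powr x"
    by (simp add: exp_diff powr_def field_simps)
  have "5 / 2 \<le> exp (1::real)" using exp_lower_Taylor_quadratic[of 1] by simp
  then have "2 / 3 * (5 / 2) \<le> ln 2 * exp (1::real)"
    using ln2_ge_two_thirds by (intro mult_mono) auto
  then have "x * (5 / 3) \<le> x * (ln 2 * exp 1)"
    using assms by (intro mult_left_mono) auto
  with 1 show ?thesis by (simp add: mult.assoc)
qed

lemma integrable_mult_of_squares:
  fixes f g :: "'s \<Rightarrow> real"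
  assumes [measurable]: "f \<in> borel_measurable P" "g \<in> borel_measurable P"
    and "integrable P (\<lambda>x. (f x)\<^sup>2)" "integrable P (\<lambda>x. (g x)\<^sup>2)"
  shows "integrable P (\<lambda>x. f x * g x)"
proof (rule Bochner_Integration.integrable_bound)
  show "integrable P (\<lambda>x. (f x)\<^sup>2 + (g x)\<^sup>2)" using assms by auto
  show "AE x in P. norm (f x * g x) \<le> norm ((f x)\<^sup>2 + (g x)\<^sup>2)"
  proof (intro AE_I2)
    fix x
    have "0 \<le> (\<bar>f x\<bar> - \<bar>g x\<bar>)\<^sup>2" by simp
    then have "2 * \<bar>f x\<bar> * \<bar>g x\<bar> \<le> (f x)\<^sup>2 + (g x)\<^sup>2" by (simp add: power2_diff)
    moreover have "0 \<le> \<bar>f x\<bar> * \<bar>g x\<bar>" by simp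
    ultimately have "\<bar>f x\<bar> * \<bar>g x\<bar> \<le> (f x)\<^sup>2 + (g x)\<^sup>2" by linarith
    then show "norm (f x * g x) \<le> norm ((f x)\<^sup>2 + (g x)\<^sup>2)" by (simp add: abs_mult)
  qed
qed simp

text \<open>The Cauchy-Schwarz inequality for given bounds of the second moments. The weighted inequality between
  arithmetic and geometric mean needs positive weights; therefore the bounds are first enlarged and then
  let down to \<open>a\<close> and \<open>b\<close>.\<close>

lemma integral_mult_le_of_squares:
  fixes f g :: "'s \<Rightarrow> real"
  assumes [measurable]: "f \<in> borel_measurable P" "g \<in> borel_measurable P"
    and int: "integrable P (\<lambda>x. (f x)\<^sup>2)" "integrable P (\<lambda>x. (g x)\<^sup>2)"
    and f: "(\<integral>x. (f x)\<^sup>2 \<partial>P) \<le> a\<^sup>2" and g: "(\<integral>x. (g x)\<^sup>2 \<partial>P) \<le> b\<^sup>2"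
    and nonneg: "0 \<le> a" "0 \<le> b"
  shows "(\<integral>x. f x * g x \<partial>P) \<le> a * b"
proof -
  have fg: "integrable P (\<lambda>x. f x * g x)" by (rule integrable_mult_of_squares) (use int in auto)
  have scaled: "(\<integral>x. f x * g x \<partial>P) \<le> a' * b'" if "a' > a" "b' > b" for a' b'
  proof -
    have pos: "a' > 0" "b' > 0" using that nonneg by auto
    have "(\<integral>x. f x * g x \<partial>P) \<le> (\<integral>x. b' / (2 * a') * (f x)\<^sup>2 + a' / (2 * b') * (g x)\<^sup>2 \<partial>P)"
    proof (intro integral_mono fg Bochner_Integration.integrable_add integrable_mult_right int)
      fix x
      have "0 \<le> (b' * f x - a' * g x)\<^sup>2 / (2 * a' * b')" using pos by simp
      also have "\<dots> = b' / (2 * a') * (f x)\<^sup>2 + a' / (2 * b') * (g x)\<^sup>2 - f x * g x"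
        using pos by (simp add: field_simps power2_eq_square)
      finally show "f x * g x \<le> b' / (2 * a') * (f x)\<^sup>2 + a' / (2 * b') * (g x)\<^sup>2" by simp
    qed
    also have "\<dots> = b' / (2 * a') * (\<integral>x. (f x)\<^sup>2 \<partial>P) + a' / (2 * b') * (\<integral>x. (g x)\<^sup>2 \<partial>P)"
      using int by simp
    also have "\<dots> \<le> b' / (2 * a') * a'\<^sup>2 + a' / (2 * b') * b'\<^sup>2"
    proof -
      have "a\<^sup>2 \<le> a'\<^sup>2" "b\<^sup>2 \<le> b'\<^sup>2" using that nonneg by (auto intro!: power_mono)
      with f g have "(\<integral>x. (f x)\<^sup>2 \<partial>P) \<le> a'\<^sup>2" "(\<integral>x. (g x)\<^sup>2 \<partial>P) \<le> b'\<^sup>2" by auto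
      then show ?thesis using pos by (intro add_mono mult_left_mono) auto
    qed
    also have "\<dots> = a' * b'" using pos by (simp add: field_simps power2_eq_square)
    finally show ?thesis .
  qed
  have "((\<lambda>d. (a + d) * (b + d)) \<longlongrightarrow> (a + 0) * (b + 0)) (at_right 0)"
    by (intro tendsto_intros)
  moreover have "\<forall>\<^sub>F d in at_right 0. (\<integral>x. f x * g x \<partial>P) \<le> (a + d) * (b + d)"
    unfolding eventually_at_right_field by (auto intro!: exI[of _ 1] scaled)
  ultimately have "(\<integral>x. f x * g x \<partial>P) \<le> (a + 0) * (b + 0)"
    by (intro tendsto_lowerbound[of "\<lambda>d. (a + d) * (b + d)" _ "at_right 0"]) auto
  then show ?thesis by simp
qed

text \<open>The triangle inequality of the space of square integrable functions, in the form in which it is needed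
  for a constant and two functions with nonnegative coefficients.\<close>

lemma (in prob_space) mean_square_affine_le:
  fixes f g :: "'a \<Rightarrow> real"
  assumes [measurable]: "f \<in> borel_measurable M" "g \<in> borel_measurable M"
    and int: "integrable M (\<lambda>x. (f x)\<^sup>2)" "integrable M (\<lambda>x. (g x)\<^sup>2)"
    and f: "(\<integral>x. (f x)\<^sup>2 \<partial>M) \<le> a\<^sup>2" and g: "(\<integral>x. (g x)\<^sup>2 \<partial>M) \<le> b\<^sup>2"
    and nonneg: "0 \<le> a" "0 \<le> b" "0 \<le> c0" "0 \<le> c1" "0 \<le> c2"
  shows "integrable M (\<lambda>x. (c0 + c1 * f x + c2 * g x)\<^sup>2)"
    and "(\<integral>x. (c0 + c1 * f x + c2 * g x)\<^sup>2 \<partial>M) \<le> (c0 + c1 * a + c2 * b)\<^sup>2"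
proof -
  have fg: "integrable M (\<lambda>x. f x * g x)" by (rule integrable_mult_of_squares) (use int in auto)
  have f1: "integrable M f" by (rule square_integrable_imp_integrable) (use int in auto)
  have g1: "integrable M g" by (rule square_integrable_imp_integrable) (use int in auto)
  have one: "(\<integral>x. (1::real)\<^sup>2 \<partial>M) \<le> 1\<^sup>2" by (simp add: prob_space)
  have Ef: "(\<integral>x. f x \<partial>M) \<le> a"
    using integral_mult_le_of_squares[OF _ _ int(1) _ f one] nonneg by simp
  have Eg: "(\<integral>x. g x \<partial>M) \<le> b"
    using integral_mult_le_of_squares[OF _ _ int(2) _ g one] nonneg by simp
  have Efg: "(\<integral>x. f x * g x \<partial>M) \<le> a * b"
    by (rule integral_mult_le_of_squares[OF _ _ int f g]) (use nonneg in auto)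
  have expand: "(c0 + c1 * f x + c2 * g x)\<^sup>2 = c0\<^sup>2 + c1\<^sup>2 * (f x)\<^sup>2 + c2\<^sup>2 * (g x)\<^sup>2
      + 2 * c0 * c1 * f x + 2 * c0 * c2 * g x + 2 * c1 * c2 * (f x * g x)" for x
    by (simp add: power2_eq_square algebra_simps)
  show "integrable M (\<lambda>x. (c0 + c1 * f x + c2 * g x)\<^sup>2)"
    unfolding expand using fg f1 g1 int by simp
  have "(\<integral>x. (c0 + c1 * f x + c2 * g x)\<^sup>2 \<partial>M)
      = c0\<^sup>2 + c1\<^sup>2 * (\<integral>x. (f x)\<^sup>2 \<partial>M) + c2\<^sup>2 * (\<integral>x. (g x)\<^sup>2 \<partial>M)
      + 2 * c0 * c1 * (\<integral>x. f x \<partial>M) + 2 * c0 * c2 * (\<integral>x. g x \<partial>M) + 2 * c1 * c2 * (\<integral>x. f x * g x \<partial>M)"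
    unfolding expand using fg f1 g1 int by (simp add: prob_space)
  also have "\<dots> \<le> c0\<^sup>2 + c1\<^sup>2 * a\<^sup>2 + c2\<^sup>2 * b\<^sup>2 + 2 * c0 * c1 * a + 2 * c0 * c2 * b + 2 * c1 * c2 * (a * b)"
    using f g Ef Eg Efg nonneg by (intro add_mono mult_left_mono order_refl) auto
  also have "\<dots> = (c0 + c1 * a + c2 * b)\<^sup>2"
    by (simp add: power2_eq_square algebra_simps)
  finally show "(\<integral>x. (c0 + c1 * f x + c2 * g x)\<^sup>2 \<partial>M) \<le> (c0 + c1 * a + c2 * b)\<^sup>2" .
qed

lemma sum_square_le_card_mult:
  fixes f :: "'i \<Rightarrow> real"
  shows "(\<Sum>i\<in>A. f i)\<^sup>2 \<le> card A * (\<Sum>i\<in>A. (f i)\<^sup>2)"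
  using Cauchy_Schwarz_ineq_sum[of "\<lambda>_. 1" f A] by simp

section \<open>Generalized smoothness in mean square\<close>

lemma continuous_on_max_over_grid_tendsto:
  fixes \<phi> :: "real \<Rightarrow> real"
  assumes "continuous_on {0..1} \<phi>"
  shows "(\<lambda>n. Max ((\<lambda>k. \<phi> (real k / real (Suc n))) ` {..Suc n})) \<longlonglongrightarrow> (SUP \<theta>\<in>{0..1}. \<phi> \<theta>)"
proof -
  obtain t where t: "t \<in> {0..1}" and max: "\<And>s. s \<in> {0..1} \<Longrightarrow> \<phi> s \<le> \<phi> t"
    using continuous_attains_sup[OF _ _ assms] by auto
  have sup: "(SUP \<theta>\<in>{0..1}. \<phi> \<theta>) = \<phi> t"
    using t max by (intro cSup_eq_maximum) auto
  define r where "r n = real (nat \<lfloor>t * real (Suc n)\<rfloor>) / real (Suc n)" for n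
  have k: "nat \<lfloor>t * real (Suc n)\<rfloor> \<le> Suc n" for n
  proof -
    have "t * real (Suc n) \<le> 1 * real (Suc n)" using t by (intro mult_right_mono) auto
    then have "t * real (Suc n) < of_int (int (Suc n)) + 1" by (rule le_less_trans) simp
    then have "\<lfloor>t * real (Suc n)\<rfloor> \<le> int (Suc n)" unfolding floor_le_iff .
    then show ?thesis by (simp add: nat_le_iff)
  qed
  have bounds: "t - 1 / real (Suc n) \<le> r n" "r n \<le> t" for n
  proof -
    have "0 \<le> t * real (Suc n)" using t by simp
    then have "t * real (Suc n) - 1 \<le> real (nat \<lfloor>t * real (Suc n)\<rfloor>)"
      "real (nat \<lfloor>t * real (Suc n)\<rfloor>) \<le> t * real (Suc n)" by linarith+
    from this[THEN divide_right_mono, of "real (Suc n)"]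
    have "(t * real (Suc n) - 1) / real (Suc n) \<le> r n" "r n \<le> t * real (Suc n) / real (Suc n)"
      unfolding r_def by (simp_all only: of_nat_0_le_iff)
    then show "t - 1 / real (Suc n) \<le> r n" "r n \<le> t"
      by (simp_all add: diff_divide_distrib)
  qed
  have r01: "r n \<in> {0..1}" for n
  proof -
    have "0 \<le> r n" by (simp add: r_def)
    then show ?thesis using bounds(2)[of n] t by simp
  qed
  have "r \<longlonglongrightarrow> t"
  proof (rule tendsto_sandwich[of "\<lambda>n. t - 1 / real (Suc n)" _ _ "\<lambda>n. t"])
    show "(\<lambda>n. t - 1 / real (Suc n)) \<longlonglongrightarrow> t"
      using tendsto_diff[OF tendsto_const LIMSEQ_inverse_real_of_nat, of t]
      by (simp add: inverse_eq_divide)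
  qed (use bounds in auto)
  then have lower: "(\<lambda>n. \<phi> (r n)) \<longlonglongrightarrow> \<phi> t"
    by (rule continuous_on_tendsto_compose[OF assms _ t]) (use r01 in auto)
  show ?thesis unfolding sup
  proof (rule tendsto_sandwich[OF _ _ lower tendsto_const])
    show "\<forall>\<^sub>F n in sequentially. \<phi> (r n) \<le> Max ((\<lambda>k. \<phi> (real k / real (Suc n))) ` {..Suc n})"
      unfolding r_def using k by (intro always_eventually allI Max_ge) auto
    show "\<forall>\<^sub>F n in sequentially. Max ((\<lambda>k. \<phi> (real k / real (Suc n))) ` {..Suc n}) \<le> \<phi> t"
    proof (intro always_eventually allI)
      fix n
      have "\<phi> (real k / real (Suc n)) \<le> \<phi> t" if "k \<le> Suc n" for k
        using that by (intro max) (auto simp: divide_le_eq_1)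
      then show "Max ((\<lambda>k. \<phi> (real k / real (Suc n))) ` {..Suc n}) \<le> \<phi> t"
        by (subst Max_le_iff) auto
    qed
  qed
qed

text \<open>The self-bounding argument. With \<open>Q\<close> the mean of the squared bracket in the smoothness condition and \<open>D\<close> the length
  of the segment, the polygon of gradients over \<open>n\<close> pieces has length at most \<open>D * sqrt Q\<close> in mean
  square, because each piece contributes \<open>(D / n)\<^sup>2 * Q\<close> and there are \<open>n\<close> of them, with another factor \<open>n\<close> from
  squaring the sum. The hypothesis \<open>dominated\<close> converts this into
  \<open>D * sqrt Q \<le> c0 + c1 * m + c2 * (D * sqrt Q)\<close>, in which \<open>c2 < 1\<close> can be moved to the left.\<close>

lemma mean_square_grad_diff_le:
  fixes F :: "'s \<Rightarrow> 'a::euclidean_space \<Rightarrow> real"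
  assumes smooth: "EL_sym_star P F \<alpha> L0 L1" and \<alpha>: "0 < \<alpha>"
    and meas: "\<And>u. (\<lambda>\<xi>. grad (F \<xi>) u) \<in> borel_measurable P"
    and second_moment: "integrable P (\<lambda>\<xi>. (norm (grad (F \<xi>) w))\<^sup>2)"
      "(\<integral>\<xi>. (norm (grad (F \<xi>) w))\<^sup>2 \<partial>P) \<le> m\<^sup>2"
    and dominated: "\<And>N V. 0 \<le> N \<Longrightarrow> 0 \<le> V \<Longrightarrow>
      norm (w' - w) * (L0 + L1 * (N + V) powr \<alpha>) \<le> c0 + c1 * N + c2 * V"
    and nonneg: "0 \<le> m" "0 \<le> c0" "0 \<le> c1" "0 \<le> c2" "c2 < 1"
  shows "(\<integral>\<xi>. (norm (grad (F \<xi>) w' - grad (F \<xi>) w))\<^sup>2 \<partial>P) \<le> ((c0 + c1 * m) / (1 - c2))\<^sup>2"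
proof -
  have prob: "prob_space P" and L: "L0 > 0" "L1 > 0"
    using smooth by (auto simp: EL_sym_star_def differentiable_stochastic_def)
  interpret prob_space P by (rule prob)
  note [measurable] = meas
  define D where "D = norm (w' - w)"
  define pt where "pt \<theta> = \<theta> *\<^sub>R w' + (1 - \<theta>) *\<^sub>R w" for \<theta> :: real
  define c where "c \<xi> \<theta> = grad (F \<xi>) (pt \<theta>)" for \<xi> \<theta>
  define \<phi> where "\<phi> \<xi> \<theta> = norm (c \<xi> \<theta>) powr \<alpha>" for \<xi> \<theta>
  define S where "S \<xi> = segment_max (F \<xi>) \<alpha> w w'" for \<xi>
  define Q where "Q = (\<integral>\<xi>. (L0 + L1 * S \<xi>)\<^sup>2 \<partial>P)"
  define p where "p n k = real k / real (Suc n)" for n k :: nat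
  have S: "S \<xi> = (SUP \<theta>\<in>{0..1}. \<phi> \<xi> \<theta>)" for \<xi>
    using \<alpha> by (simp add: S_def segment_max_def \<phi>_def c_def pt_def)
  have Q_int: "integrable P (\<lambda>\<xi>. (L0 + L1 * S \<xi>)\<^sup>2)"
    using smooth by (auto simp: EL_sym_star_def S_def)
  have c_meas [measurable]: "(\<lambda>\<xi>. c \<xi> \<theta>) \<in> borel_measurable P" for \<theta>
    by (simp add: c_def)
  have \<phi>_meas [measurable]: "(\<lambda>\<xi>. \<phi> \<xi> \<theta>) \<in> borel_measurable P" for \<theta>
    unfolding \<phi>_def by measurable
  have \<phi>_nonneg: "\<phi> \<xi> \<theta> \<ge> 0" for \<xi> \<theta> by (simp add: \<phi>_def)
  have cont: "AE \<xi> in P. continuous_on {0..1} (\<phi> \<xi>)"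
  proof -
    have "AE \<xi> in P. continuous_on {0..1} (\<lambda>\<theta>. norm (c \<xi> \<theta>))"
      using smooth by (auto simp: EL_sym_star_def c_def pt_def)
    then show ?thesis
    proof eventually_elim
      case (elim \<xi>)
      then show ?case unfolding \<phi>_def using \<alpha> by (intro continuous_on_powr' continuous_on_const) auto
    qed
  qed
  have le_S: "\<phi> \<xi> \<theta> \<le> S \<xi>" if "continuous_on {0..1} (\<phi> \<xi>)" "\<theta> \<in> {0..1}" for \<xi> \<theta>
    unfolding S using that
    by (intro cSUP_upper bounded_imp_bdd_above compact_imp_bounded compact_continuous_image) auto
  have S_nonneg: "0 \<le> S \<xi>" if "continuous_on {0..1} (\<phi> \<xi>)" for \<xi>
    using le_S[OF that, of 0] \<phi>_nonneg[of \<xi> 0] by simp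

  \<comment> \<open>The maximum over a piece is at most the maximum over the whole segment, so \<open>Q\<close> serves all pieces.\<close>
  have step_int: "integrable P (\<lambda>\<xi>. (norm (c \<xi> t - c \<xi> s))\<^sup>2)" for s t
    using smooth by (auto simp: EL_sym_star_def c_def)
  have step: "(\<integral>\<xi>. (norm (c \<xi> (p n (Suc k)) - c \<xi> (p n k)))\<^sup>2 \<partial>P) \<le> (D / real (Suc n))\<^sup>2 * Q"
    if "k < Suc n" for n k
  proof -
    let ?u = "pt (p n k)" and ?u' = "pt (p n (Suc k))"
    let ?S = "\<lambda>\<xi>. segment_max (F \<xi>) \<alpha> ?u ?u'"
    have diff: "p n (Suc k) = p n k + 1 / real (Suc n)"
      by (simp add: p_def add_divide_distrib)
    have pk: "0 \<le> p n k" "p n (Suc k) \<le> 1" using that by (auto simp: p_def)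
    have sub: "\<theta> *\<^sub>R ?u' + (1 - \<theta>) *\<^sub>R ?u = pt (p n k + \<theta> / real (Suc n))" for \<theta>
      unfolding diff pt_def by (simp add: algebra_simps add_divide_distrib)
    have S': "?S \<xi> = (SUP \<theta>\<in>{0..1}. \<phi> \<xi> (p n k + \<theta> / real (Suc n)))" for \<xi>
      using \<alpha> by (simp add: segment_max_def sub \<phi>_def c_def)
    have in01: "p n k + \<theta> / real (Suc n) \<in> {0..1}" if "\<theta> \<in> {0..1}" for \<theta>
    proof -
      have "\<theta> / real (Suc n) \<le> 1 / real (Suc n)" using that by (intro divide_right_mono) auto
      moreover have "0 \<le> \<theta> / real (Suc n)" using that by simp
      ultimately show ?thesis using pk diff by auto
    qed
    have "?u' - ?u = (1 / real (Suc n)) *\<^sub>R (w' - w)"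
      unfolding diff pt_def by (simp add: algebra_simps)
    then have norm: "norm (?u' - ?u) = D / real (Suc n)"
      by (simp add: D_def)
    have int: "integrable P (\<lambda>\<xi>. (L0 + L1 * ?S \<xi>)\<^sup>2)"
      and le: "(\<integral>\<xi>. (norm (c \<xi> (p n (Suc k)) - c \<xi> (p n k)))\<^sup>2 \<partial>P)
        \<le> (norm (?u' - ?u))\<^sup>2 * (\<integral>\<xi>. (L0 + L1 * ?S \<xi>)\<^sup>2 \<partial>P)"
      using smooth by (auto simp: EL_sym_star_def c_def)
    have "(\<integral>\<xi>. (L0 + L1 * ?S \<xi>)\<^sup>2 \<partial>P) \<le> Q"
      unfolding Q_def
    proof (intro integral_mono_AE int Q_int)
      show "AE \<xi> in P. (L0 + L1 * ?S \<xi>)\<^sup>2 \<le> (L0 + L1 * S \<xi>)\<^sup>2"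
        using cont
      proof eventually_elim
        case (elim \<xi>)
        have bound: "\<phi> \<xi> (p n k + \<theta> / real (Suc n)) \<le> S \<xi>" if "\<theta> \<in> {0..1}" for \<theta>
          using le_S[OF elim in01[OF that]] .
        have "?S \<xi> \<le> S \<xi>" unfolding S' using bound by (intro cSUP_least) auto
        moreover have "0 \<le> ?S \<xi>"
        proof -
          have "\<phi> \<xi> (p n k + 0 / real (Suc n)) \<le> ?S \<xi>"
            unfolding S' using bound
            by (intro cSUP_upper[of 0 "{0..1}" "\<lambda>\<theta>. \<phi> \<xi> (p n k + \<theta> / real (Suc n))"] bdd_aboveI2[of _ _ "S \<xi>"]) auto
          then show ?thesis using \<phi>_nonneg by (meson order_trans)
        qed
        ultimately show ?case using L by (intro power_mono add_mono mult_left_mono add_nonneg_nonneg) auto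
      qed
    qed
    then show ?thesis using le unfolding norm
      by (smt (verit) mult_left_mono zero_le_power2)
  qed

  define V where "V n \<xi> = (\<Sum>k<Suc n. norm (c \<xi> (p n (Suc k)) - c \<xi> (p n k)))" for n \<xi>
  have V_meas [measurable]: "V n \<in> borel_measurable P" for n
    unfolding V_def by measurable
  have V_nonneg: "0 \<le> V n \<xi>" for n \<xi> unfolding V_def by (intro sum_nonneg) simp
  have V_sq: "(V n \<xi>)\<^sup>2 \<le> real (Suc n) * (\<Sum>k<Suc n. (norm (c \<xi> (p n (Suc k)) - c \<xi> (p n k)))\<^sup>2)" for n \<xi>
    using sum_square_le_card_mult[of _ "{..<Suc n}"] unfolding V_def by simp
  have V_int: "integrable P (\<lambda>\<xi>. (V n \<xi>)\<^sup>2)" for n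
  proof (rule Bochner_Integration.integrable_bound)
    show "integrable P (\<lambda>\<xi>. real (Suc n) * (\<Sum>k<Suc n. (norm (c \<xi> (p n (Suc k)) - c \<xi> (p n k)))\<^sup>2))"
      by (intro integrable_mult_right Bochner_Integration.integrable_sum step_int)
    show "AE \<xi> in P. norm ((V n \<xi>)\<^sup>2)
        \<le> norm (real (Suc n) * (\<Sum>k<Suc n. (norm (c \<xi> (p n (Suc k)) - c \<xi> (p n k)))\<^sup>2))"
    proof (intro AE_I2)
      fix \<xi>
      show "norm ((V n \<xi>)\<^sup>2)
        \<le> norm (real (Suc n) * (\<Sum>k<Suc n. (norm (c \<xi> (p n (Suc k)) - c \<xi> (p n k)))\<^sup>2))"
        using order_trans[OF V_sq abs_ge_self] unfolding real_norm_def abs_power2 .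
    qed
  qed simp
  have Q_nonneg: "0 \<le> Q" unfolding Q_def by (intro integral_nonneg_AE) auto
  have V_le: "(\<integral>\<xi>. (V n \<xi>)\<^sup>2 \<partial>P) \<le> (D * sqrt Q)\<^sup>2" for n
  proof -
    have "(\<integral>\<xi>. (V n \<xi>)\<^sup>2 \<partial>P)
        \<le> (\<integral>\<xi>. real (Suc n) * (\<Sum>k<Suc n. (norm (c \<xi> (p n (Suc k)) - c \<xi> (p n k)))\<^sup>2) \<partial>P)"
      using V_sq by (intro integral_mono V_int integrable_mult_right Bochner_Integration.integrable_sum step_int)
    also have "\<dots> = real (Suc n) * (\<Sum>k<Suc n. \<integral>\<xi>. (norm (c \<xi> (p n (Suc k)) - c \<xi> (p n k)))\<^sup>2 \<partial>P)"
      using step_int by (simp del: sum.lessThan_Suc)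
    also have "\<dots> \<le> real (Suc n) * (\<Sum>k<Suc n. (D / real (Suc n))\<^sup>2 * Q)"
      using step by (intro mult_left_mono sum_mono) auto
    also have "\<dots> = (D * sqrt Q)\<^sup>2"
    proof -
      have "N * (N * ((D / N)\<^sup>2 * Q)) = (D * sqrt Q)\<^sup>2" if "N > 0" for N
        using that Q_nonneg by (simp add: power_mult_distrib power_divide power2_eq_square[of N])
      from this[of "real (Suc n)"] show ?thesis by simp
    qed
    finally show ?thesis .
  qed

  \<comment> \<open>On the grid, the maximum is controlled by the initial gradient and the length of the polygon.\<close>
  define G where "G n \<xi> = Max ((\<lambda>k. \<phi> \<xi> (p n k)) ` {..Suc n})" for n \<xi>
  have G_meas [measurable]: "G n \<in> borel_measurable P" for n
    unfolding G_def by (intro borel_measurable_Max) auto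
  have norm_le: "norm (c \<xi> (p n k)) \<le> norm (grad (F \<xi>) w) + V n \<xi>" if "k \<le> Suc n" for \<xi> n k
  proof -
    have telescope: "c \<xi> (p n 0) + (\<Sum>j<k. c \<xi> (p n (Suc j)) - c \<xi> (p n j)) = c \<xi> (p n k)"
      by (subst sum_lessThan_telescope) simp
    have "norm (c \<xi> (p n 0) + (\<Sum>j<k. c \<xi> (p n (Suc j)) - c \<xi> (p n j)))
        \<le> norm (c \<xi> (p n 0)) + (\<Sum>j<k. norm (c \<xi> (p n (Suc j)) - c \<xi> (p n j)))"
      by (intro norm_triangle_mono order_refl norm_sum)
    then have "norm (c \<xi> (p n k)) \<le> norm (c \<xi> (p n 0)) + (\<Sum>j<k. norm (c \<xi> (p n (Suc j)) - c \<xi> (p n j)))"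
      unfolding telescope .
    also have "(\<Sum>j<k. norm (c \<xi> (p n (Suc j)) - c \<xi> (p n j))) \<le> V n \<xi>"
      unfolding V_def using that by (intro sum_mono2) auto
    also have "c \<xi> (p n 0) = grad (F \<xi>) w" by (simp add: c_def pt_def p_def)
    finally show ?thesis by simp
  qed
  have G_le: "G n \<xi> \<le> (norm (grad (F \<xi>) w) + V n \<xi>) powr \<alpha>" for n \<xi>
    unfolding G_def \<phi>_def using norm_le \<alpha> by (subst Max_le_iff) (auto intro!: powr_mono2)
  have G_nonneg: "0 \<le> G n \<xi>" for n \<xi>
    unfolding G_def using \<phi>_nonneg[of \<xi> "p n 0"] by (intro Max_ge_iff[THEN iffD2]) auto
  have G_sq: "(D * (L0 + L1 * G n \<xi>))\<^sup>2 \<le> (c0 + c1 * norm (grad (F \<xi>) w) + c2 * V n \<xi>)\<^sup>2" for n \<xi>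
  proof (rule power_mono)
    have "D * (L0 + L1 * G n \<xi>) \<le> D * (L0 + L1 * (norm (grad (F \<xi>) w) + V n \<xi>) powr \<alpha>)"
      using L G_le by (intro mult_left_mono add_mono) (auto simp: D_def)
    also have "\<dots> \<le> c0 + c1 * norm (grad (F \<xi>) w) + c2 * V n \<xi>"
      unfolding D_def by (intro dominated V_nonneg norm_ge_zero)
    finally show "D * (L0 + L1 * G n \<xi>) \<le> c0 + c1 * norm (grad (F \<xi>) w) + c2 * V n \<xi>" .
    show "0 \<le> D * (L0 + L1 * G n \<xi>)" using L G_nonneg[of n \<xi>] by (simp add: D_def)
  qed
  have "(\<integral>\<xi>. (D * (L0 + L1 * G n \<xi>))\<^sup>2 \<partial>P) \<le> (c0 + c1 * m + c2 * (D * sqrt Q))\<^sup>2" for n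
  proof -
    have 1: "integrable P (\<lambda>\<xi>. (c0 + c1 * norm (grad (F \<xi>) w) + c2 * V n \<xi>)\<^sup>2)"
      and 2: "(\<integral>\<xi>. (c0 + c1 * norm (grad (F \<xi>) w) + c2 * V n \<xi>)\<^sup>2 \<partial>P) \<le> (c0 + c1 * m + c2 * (D * sqrt Q))\<^sup>2"
      by (rule mean_square_affine_le[OF _ _ second_moment(1) V_int second_moment(2) V_le];
          use nonneg Q_nonneg in \<open>simp add: D_def\<close>)+
    have "(\<integral>\<xi>. (D * (L0 + L1 * G n \<xi>))\<^sup>2 \<partial>P)
        \<le> (\<integral>\<xi>. (c0 + c1 * norm (grad (F \<xi>) w) + c2 * V n \<xi>)\<^sup>2 \<partial>P)"
      by (intro integral_mono' 1 G_sq) auto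
    with 2 show ?thesis by simp
  qed
  then have bound: "D\<^sup>2 * (\<integral>\<xi>. (L0 + L1 * G n \<xi>)\<^sup>2 \<partial>P) \<le> (c0 + c1 * m + c2 * (D * sqrt Q))\<^sup>2" for n
    by (simp add: power_mult_distrib)

  \<comment> \<open>Refining the grid recovers the maximum over the segment; that maximum itself dominates the limit.\<close>
  have G_le_S: "G n \<xi> \<le> S \<xi>" if "continuous_on {0..1} (\<phi> \<xi>)" for n \<xi>
    unfolding G_def using that
    by (subst Max_le_iff) (auto intro!: le_S simp: p_def divide_le_eq_1)
  have "(\<lambda>n. \<integral>\<xi>. (L0 + L1 * G n \<xi>)\<^sup>2 \<partial>P) \<longlonglongrightarrow> Q"
    unfolding Q_def
  proof (rule integral_dominated_convergence[OF _ _ Q_int])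
    show "(\<lambda>\<xi>. (L0 + L1 * S \<xi>)\<^sup>2) \<in> borel_measurable P" using Q_int by auto
    show "AE \<xi> in P. (\<lambda>n. (L0 + L1 * G n \<xi>)\<^sup>2) \<longlonglongrightarrow> (L0 + L1 * S \<xi>)\<^sup>2"
      using cont
    proof eventually_elim
      case (elim \<xi>)
      show ?case unfolding G_def S p_def
        by (intro tendsto_intros continuous_on_max_over_grid_tendsto elim)
    qed
    show "AE \<xi> in P. norm ((L0 + L1 * G n \<xi>)\<^sup>2) \<le> (L0 + L1 * S \<xi>)\<^sup>2" for n
      using cont
    proof eventually_elim
      case (elim \<xi>)
      have "(L0 + L1 * G n \<xi>)\<^sup>2 \<le> (L0 + L1 * S \<xi>)\<^sup>2"
        using G_nonneg G_le_S[OF elim] L by (intro power_mono add_mono mult_left_mono add_nonneg_nonneg) auto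
      then show ?case by simp
    qed
  qed simp
  then have "(\<lambda>n. D\<^sup>2 * (\<integral>\<xi>. (L0 + L1 * G n \<xi>)\<^sup>2 \<partial>P)) \<longlonglongrightarrow> D\<^sup>2 * Q"
    by (intro tendsto_intros)
  then have "D\<^sup>2 * Q \<le> (c0 + c1 * m + c2 * (D * sqrt Q))\<^sup>2"
    using bound by (intro LIMSEQ_le_const2) auto
  then have "(D * sqrt Q)\<^sup>2 \<le> (c0 + c1 * m + c2 * (D * sqrt Q))\<^sup>2"
    using Q_nonneg by (simp add: power_mult_distrib)
  then have "D * sqrt Q \<le> c0 + c1 * m + c2 * (D * sqrt Q)"
    by (rule power2_le_imp_le) (use nonneg Q_nonneg in \<open>simp add: D_def\<close>)
  then have "D * sqrt Q \<le> (c0 + c1 * m) / (1 - c2)"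
    using nonneg by (simp add: field_simps)
  then have "(D * sqrt Q)\<^sup>2 \<le> ((c0 + c1 * m) / (1 - c2))\<^sup>2"
    using Q_nonneg by (intro power_mono) (auto simp: D_def)
  moreover have "(\<integral>\<xi>. (norm (grad (F \<xi>) w' - grad (F \<xi>) w))\<^sup>2 \<partial>P) \<le> D\<^sup>2 * Q"
    using smooth unfolding EL_sym_star_def Q_def S_def D_def by blast
  ultimately show ?thesis using Q_nonneg by (simp add: power_mult_distrib)
qed

lemma second_moment_grad_le:
  fixes F :: "'s \<Rightarrow> 'a::euclidean_space \<Rightarrow> real"
  assumes "prob_space P" and unbiased: "unbiased_gradients P F"
    and noise: "gradient_variance_bound P F \<Gamma> \<Lambda>"
  shows "integrable P (\<lambda>\<xi>. (norm (grad (F \<xi>) w))\<^sup>2)"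
    and "(\<integral>\<xi>. (norm (grad (F \<xi>) w))\<^sup>2 \<partial>P) \<le> (\<Gamma>\<^sup>2 + 1) * (norm (grad (risk P F) w))\<^sup>2 + \<Lambda>\<^sup>2"
proof -
  interpret prob_space P by fact
  let ?g = "grad (risk P F) w"
  have int: "integrable P (\<lambda>\<xi>. grad (F \<xi>) w)" and mean: "(\<integral>\<xi>. grad (F \<xi>) w \<partial>P) = ?g"
    using unbiased by (auto simp: unbiased_gradients_def)
  have var_int: "integrable P (\<lambda>\<xi>. (norm (grad (F \<xi>) w - ?g))\<^sup>2)"
    and var: "(\<integral>\<xi>. (norm (grad (F \<xi>) w - ?g))\<^sup>2 \<partial>P) \<le> \<Gamma>\<^sup>2 * (norm ?g)\<^sup>2 + \<Lambda>\<^sup>2"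
    using noise by (auto simp: gradient_variance_bound_def)
  have expand: "(norm (grad (F \<xi>) w))\<^sup>2
      = (norm (grad (F \<xi>) w - ?g))\<^sup>2 + 2 * (grad (F \<xi>) w \<bullet> ?g) - (norm ?g)\<^sup>2" for \<xi>
    by (simp add: power2_norm_eq_inner inner_diff inner_commute)
  show "integrable P (\<lambda>\<xi>. (norm (grad (F \<xi>) w))\<^sup>2)"
    unfolding expand using int var_int by simp
  have "(\<integral>\<xi>. (norm (grad (F \<xi>) w))\<^sup>2 \<partial>P)
      = (\<integral>\<xi>. (norm (grad (F \<xi>) w - ?g))\<^sup>2 \<partial>P) + 2 * (?g \<bullet> ?g) - (norm ?g)\<^sup>2"
    unfolding expand using int var_int mean by (simp add: prob_space)
  with var show "(\<integral>\<xi>. (norm (grad (F \<xi>) w))\<^sup>2 \<partial>P) \<le> (\<Gamma>\<^sup>2 + 1) * (norm ?g)\<^sup>2 + \<Lambda>\<^sup>2"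
    by (simp add: power2_norm_eq_inner algebra_simps)
qed

lemma sqrt_add_square_le:
  fixes g s \<Lambda> :: real
  assumes "0 \<le> s" "0 \<le> g" "0 \<le> \<Lambda>"
  shows "s\<^sup>2 * g\<^sup>2 + \<Lambda>\<^sup>2 \<le> (s * g + \<Lambda>)\<^sup>2"
  using assms by (simp add: power2_sum power_mult_distrib)

text \<open>For \<open>\<alpha> = 1\<close> the bracket is already affine in the gradient norm and the polygon length, with slope \<open>D * L1\<close>.
  The learning rate keeps this slope at most \<open>a / (5 * a + 8 * b)\<close>, and division by one minus the slope turns
  the denominator \<open>5 * a + 8 * b\<close> into \<open>4 * a + 8 * b\<close>.\<close>

lemma mean_square_grad_diff_le_linear:
  fixes F :: "'s \<Rightarrow> 'a::euclidean_space \<Rightarrow> real"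
  assumes smooth: "EL_sym_star P F 1 L0 L1"
    and unbiased: "unbiased_gradients P F"
    and noise: "gradient_variance_bound P F \<Gamma> \<Lambda>" "0 < \<Gamma>" "0 < \<Lambda>"
    and \<epsilon>: "0 < \<epsilon>" "\<epsilon> < 1"
    and near: "norm (w' - w) \<le> learning_rate 1 L0 L1 \<Gamma> \<Lambda> \<epsilon>"
  defines "a \<equiv> L1 * sqrt (\<Gamma>\<^sup>2 + 1)" and "b \<equiv> sqrt (L0\<^sup>2 + 2 * L1\<^sup>2 * \<Lambda>\<^sup>2)"
  shows "(\<integral>\<xi>. (norm (grad (F \<xi>) w' - grad (F \<xi>) w))\<^sup>2 \<partial>P)
      \<le> (norm (w' - w) / learning_rate 1 L0 L1 \<Gamma> \<Lambda> \<epsilon>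
          * (\<epsilon> * (4 / 3 * b / (4 * a + 8 * b) + a / (4 * a + 8 * b) * norm (grad (risk P F) w))))\<^sup>2"
proof -
  define \<gamma> where "\<gamma> = learning_rate 1 L0 L1 \<Gamma> \<Lambda> \<epsilon>"
  define D where "D = norm (w' - w)"
  define g where "g = norm (grad (risk P F) w)"
  define s where "s = sqrt (\<Gamma>\<^sup>2 + 1)"
  define m where "m = s * g + \<Lambda>"
  have prob: "prob_space P" and L: "L0 > 0" "L1 > 0"
    using smooth by (auto simp: EL_sym_star_def differentiable_stochastic_def)
  have meas: "(\<lambda>\<xi>. grad (F \<xi>) u) \<in> borel_measurable P" for u
    by (rule borel_measurable_integrable) (use unbiased in \<open>auto simp: unbiased_gradients_def\<close>)
  have s: "s \<ge> 1" "s\<^sup>2 = \<Gamma>\<^sup>2 + 1" by (auto simp: s_def)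
  have a: "L1 \<le> a" "a = L1 * s" using s L by (auto simp: a_def s_def)
  have b: "0 < b" "b\<^sup>2 = L0\<^sup>2 + 2 * L1\<^sup>2 * \<Lambda>\<^sup>2"
    unfolding b_def using L by (auto intro!: add_pos_nonneg)
  have apos: "0 < a" using a(1) L by linarith
  have den: "0 < 4 * a + 8 * b" "0 < 5 * a + 8 * b" using apos b by linarith+
  have \<gamma>: "\<gamma> = \<epsilon> / (5 * a + 8 * b)"
    by (simp add: \<gamma>_def learning_rate_def a_def b_def mult.assoc)
  have \<gamma>_pos: "0 < \<gamma>" unfolding \<gamma> using \<epsilon> den by simp
  have D: "0 \<le> D" "D \<le> \<gamma>" using near by (auto simp: D_def \<gamma>_def)
  have m: "0 \<le> m" using s noise by (simp add: m_def g_def)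
  have \<gamma>L1: "\<gamma> * L1 * (5 * a + 8 * b) \<le> a"
  proof -
    have "\<gamma> * L1 * (5 * a + 8 * b) = \<epsilon> * L1" unfolding \<gamma> using den by simp
    also have "\<dots> \<le> 1 * a" using \<epsilon> a L by (intro mult_mono) auto
    finally show ?thesis by simp
  qed
  have contract: "(4 * a + 8 * b) / (5 * a + 8 * b) \<le> 1 - \<gamma> * L1"
  proof -
    have "(4 * a + 8 * b) \<le> (1 - \<gamma> * L1) * (5 * a + 8 * b)"
      using \<gamma>L1 by (simp add: algebra_simps)
    then show ?thesis using den by (simp add: pos_divide_le_eq)
  qed
  have DL1: "D * L1 \<le> \<gamma> * L1" using D L by simp
  have "0 < (4 * a + 8 * b) / (5 * a + 8 * b)" using den by simp
  with contract DL1 have less1: "D * L1 < 1" "\<gamma> * L1 < 1" by linarith+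
  have "(\<integral>\<xi>. (norm (grad (F \<xi>) w' - grad (F \<xi>) w))\<^sup>2 \<partial>P) \<le> ((D * L0 + D * L1 * m) / (1 - D * L1))\<^sup>2"
  proof (rule mean_square_grad_diff_le[OF smooth _ meas second_moment_grad_le(1)[OF prob unbiased noise(1)]])
    show "(\<integral>\<xi>. (norm (grad (F \<xi>) w))\<^sup>2 \<partial>P) \<le> m\<^sup>2"
      using second_moment_grad_le(2)[OF prob unbiased noise(1), of w] sqrt_add_square_le[of s g \<Lambda>] s noise
      by (simp add: m_def g_def)
    show "norm (w' - w) * (L0 + L1 * (N + V) powr 1) \<le> D * L0 + D * L1 * N + D * L1 * V"
      if "0 \<le> N" "0 \<le> V" for N V
      using that by (simp add: D_def algebra_simps)
  qed (use m D L less1 in auto)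
  also have "\<dots> \<le> (D / \<gamma> * (\<epsilon> * (4 / 3 * b / (4 * a + 8 * b) + a / (4 * a + 8 * b) * g)))\<^sup>2"
  proof (rule power_mono)
    have "(L0 + L1 * \<Lambda>)\<^sup>2 \<le> (4 / 3 * b)\<^sup>2"
    proof -
      \<comment> \<open>Completing the square in \<open>16 / 9 * (L0\<^sup>2 + 2 * u\<^sup>2) - (L0 + u)\<^sup>2\<close>.\<close>
      define u where "u = L1 * \<Lambda>"
      have "0 \<le> 7 / 9 * (L0 - 9 / 7 * u)\<^sup>2 + 80 / 63 * u\<^sup>2" by simp
      also have "\<dots> = 16 / 9 * (L0\<^sup>2 + 2 * u\<^sup>2) - (L0 + u)\<^sup>2"
        by (simp add: power2_eq_square field_simps)
      finally show ?thesis
        unfolding power_mult_distrib b(2) by (simp add: u_def power_mult_distrib power_divide)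
    qed
    then have "L0 + L1 * \<Lambda> \<le> 4 / 3 * b" by (rule power2_le_imp_le) (use b(1) in simp)
    then have num: "L0 + L1 * m \<le> 4 / 3 * b + a * g"
      by (simp add: m_def a algebra_simps)
    have "(D * L0 + D * L1 * m) / (1 - D * L1) \<le> (D * L0 + D * L1 * m) / ((4 * a + 8 * b) / (5 * a + 8 * b))"
    proof (rule divide_left_mono)
      show "(4 * a + 8 * b) / (5 * a + 8 * b) \<le> 1 - D * L1" using contract DL1 by linarith
      show "0 \<le> D * L0 + D * L1 * m" using D L m by simp
      show "0 < (1 - D * L1) * ((4 * a + 8 * b) / (5 * a + 8 * b))" using den less1 by simp
    qed
    also have "\<dots> = D * (L0 + L1 * m) * (5 * a + 8 * b) / (4 * a + 8 * b)"
      by (simp add: algebra_simps)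
    also have "\<dots> \<le> D * (4 / 3 * b + a * g) * (5 * a + 8 * b) / (4 * a + 8 * b)"
      using num D a b L by (intro divide_right_mono mult_right_mono mult_left_mono) auto
    also have "\<dots> = D / \<gamma> * (\<epsilon> * ((4 / 3 * b + a * g) / (4 * a + 8 * b)))"
      unfolding \<gamma> using \<epsilon> by simp
    finally show "(D * L0 + D * L1 * m) / (1 - D * L1)
        \<le> D / \<gamma> * (\<epsilon> * (4 / 3 * b / (4 * a + 8 * b) + a / (4 * a + 8 * b) * g))"
      by (simp add: add_divide_distrib)
    show "0 \<le> (D * L0 + D * L1 * m) / (1 - D * L1)" using D L m less1 by simp
  qed
  finally show ?thesis by (simp add: D_def \<gamma>_def g_def)
qed

text \<open>For \<open>\<alpha> < 1\<close> the powers are linearized. The polygon length gets the slope \<open>\<alpha>\<close>, which is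
  possible for every step length at the price of the constant \<open>(D * L1) powr (1 / (1 - \<alpha>))\<close>, the origin of the
  constant \<open>K2_bar\<close>; the gradient norm is linearized at an upper bound of its own root mean square.
  The weight \<open>\<mu>\<close> is the share of the denominator of the learning rate that
  belongs to the terms with a power of the gradient norm of the risk.\<close>

lemma mean_square_grad_diff_le_sublinear:
  fixes F :: "'s \<Rightarrow> 'a::euclidean_space \<Rightarrow> real"
  assumes smooth: "EL_sym_star P F \<alpha> L0 L1" and \<alpha>: "0 < \<alpha>" "\<alpha> < 1"
    and unbiased: "unbiased_gradients P F"
    and noise: "gradient_variance_bound P F \<Gamma> \<Lambda>" "0 < \<Gamma>" "0 < \<Lambda>"
    and \<epsilon>: "0 < \<epsilon>" "\<epsilon> < 1"
    and near: "norm (w' - w) \<le> learning_rate \<alpha> L0 L1 \<Gamma> \<Lambda> \<epsilon>"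
  defines "\<mu> \<equiv> 2 * K1_bar \<alpha> L1 * (\<Gamma> powr \<alpha> + 1) / (2 * K0_bar \<alpha> L0 + 4 * K2_bar \<alpha> L1
                + 2 * K1_bar \<alpha> L1 * (\<Lambda> powr \<alpha> + \<Gamma> powr \<alpha> + 1) + 1)"
  shows "(\<integral>\<xi>. (norm (grad (F \<xi>) w' - grad (F \<xi>) w))\<^sup>2 \<partial>P)
      \<le> (norm (w' - w) / learning_rate \<alpha> L0 L1 \<Gamma> \<Lambda> \<epsilon>
          * (\<epsilon> * (3 / 20 * (1 - \<mu> * \<alpha>) + 3 / 20 * (\<mu> * \<alpha>) * norm (grad (risk P F) w))))\<^sup>2"
proof -
  define \<gamma> where "\<gamma> = learning_rate \<alpha> L0 L1 \<Gamma> \<Lambda> \<epsilon>"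
  define D where "D = norm (w' - w)"
  define g where "g = norm (grad (risk P F) w)"
  define x where "x = 1 / (1 - \<alpha>)"
  define s where "s = sqrt (\<Gamma>\<^sup>2 + 1)"
  define m where "m = s * g + \<Lambda>"
  \<comment> \<open>The point of linearization; unlike \<open>m\<close> it splits under powers into the terms of the learning rate.\<close>
  define c where "c = (\<Gamma> + 1) * g + \<Lambda>"
  define K0 K1 K2 where "K0 = K0_bar \<alpha> L0" and "K1 = K1_bar \<alpha> L1" and "K2 = K2_bar \<alpha> L1"
  define R where "R = 2 * K0 + 4 * K2 + 2 * K1 * (\<Lambda> powr \<alpha> + \<Gamma> powr \<alpha> + 1) + 1"
  have prob: "prob_space P" and L: "L0 > 0" "L1 > 0"
    using smooth by (auto simp: EL_sym_star_def differentiable_stochastic_def)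
  have meas: "(\<lambda>\<xi>. grad (F \<xi>) u) \<in> borel_measurable P" for u
    by (rule borel_measurable_integrable) (use unbiased in \<open>auto simp: unbiased_gradients_def\<close>)
  have s: "s \<ge> 1" "s\<^sup>2 = \<Gamma>\<^sup>2 + 1" by (auto simp: s_def)
  have "s \<le> \<Gamma> + 1" unfolding s_def using noise by (intro real_le_lsqrt) (auto simp: power2_sum)
  have g: "0 \<le> g" by (simp add: g_def)
  have m: "0 \<le> m" "m \<le> c" using s noise g \<open>s \<le> \<Gamma> + 1\<close>
    by (auto simp: m_def c_def mult_right_mono)
  have c: "0 < c" using noise g by (simp add: c_def add_nonneg_pos)
  have x: "1 \<le> x" "x * (1 - \<alpha>) = 1" using \<alpha> by (auto simp: x_def)
  have x2: "1 + \<alpha> * x = x" using x by (simp add: algebra_simps)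
  have K: "0 < K0" "0 < K1" "0 < K2" using L by (auto simp: K0_def K1_def K2_def K0_bar_def K1_bar_def K2_bar_def)
  have R: "1 < R" unfolding R_def using K by (auto intro!: add_pos_nonneg add_nonneg_nonneg mult_nonneg_nonneg)
  have \<gamma>: "\<gamma> = \<epsilon> / R" using \<alpha> by (simp add: \<gamma>_def learning_rate_def R_def K0_def K1_def K2_def)
  have \<gamma>_pos: "0 < \<gamma>" "\<gamma> < 1" unfolding \<gamma> using \<epsilon> R by (auto simp: divide_less_eq)
  have D: "0 \<le> D" "D \<le> \<gamma>" using near by (auto simp: D_def \<gamma>_def)
  have exponent: "(2 - \<alpha>) / (1 - \<alpha>) = 1 + x" using \<alpha> by (simp add: x_def field_simps)
  have K0: "x * L0 \<le> 3 / 20 * (2 * K0)" and K1: "x * L1 \<le> 3 / 20 * (2 * K1)"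
  proof -
    have "x \<le> 3 / 5 * 2 powr x" using le_two_powr[of x] x by simp
    then have "x * l \<le> 3 / 5 * 2 powr x * l" if "l > 0" for l using that by (intro mult_right_mono) auto
    from this[OF L(1)] this[OF L(2)]
    show "x * L0 \<le> 3 / 20 * (2 * K0)" "x * L1 \<le> 3 / 20 * (2 * K1)"
      by (simp_all add: K0_def K1_def K0_bar_def K1_bar_def exponent powr_add algebra_simps)
  qed
  have K2: "(D * L1) powr x \<le> D * (3 / 20 * (4 * K2))"
  proof -
    have "D powr x \<le> D"
    proof (cases "D = 0")
      case False
      then have "D powr x \<le> D powr 1" using D \<gamma>_pos x by (intro powr_mono') auto
      then show ?thesis using D False by simp
    qed simp
    moreover have "L1 powr x \<le> 3 / 5 * K2"
    proof -
      have "5 powr 1 \<le> (5::real) powr x" using x by (intro powr_mono) auto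
      then have "5 * L1 powr x \<le> 5 powr x * L1 powr x" by (intro mult_right_mono) auto
      then have "5 * L1 powr x \<le> K2" using L by (simp add: K2_def K2_bar_def x_def powr_mult)
      then show ?thesis using K by simp
    qed
    ultimately have "D powr x * L1 powr x \<le> D * (3 / 5 * K2)" using D by (intro mult_mono) auto
    then show ?thesis using D L by (simp add: powr_mult)
  qed
  have young: "D * L1 * V powr \<alpha> \<le> \<alpha> * V + (1 - \<alpha>) * (D * L1) powr x" if "0 \<le> V" for V
  proof (cases "D = 0")
    case True
    then show ?thesis using that \<alpha> by simp
  next
    case False
    define y where "y = D * L1"
    have y: "y > 0" using False D L by (simp add: y_def)
    \<comment> \<open>The tangent at \<open>y powr x\<close> has slope \<open>\<alpha> / y\<close>, because \<open>x * (\<alpha> - 1) = -1\<close>.\<close>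
    have "V powr \<alpha> \<le> (1 - \<alpha>) * (y powr x) powr \<alpha> + \<alpha> * (y powr x) powr (\<alpha> - 1) * V"
      using \<alpha> that y by (intro powr_le_tangent) auto
    then have "y * V powr \<alpha> \<le> y * ((1 - \<alpha>) * (y powr x) powr \<alpha> + \<alpha> * (y powr x) powr (\<alpha> - 1) * V)"
      using y by (intro mult_left_mono) auto
    also have "\<dots> = (1 - \<alpha>) * (y * y powr (\<alpha> * x)) + \<alpha> * (y * y powr (x * (\<alpha> - 1))) * V"
      by (simp add: powr_powr algebra_simps)
    also have "y * y powr (\<alpha> * x) = y powr x" using y by (simp add: powr_mult_base x2)
    also have "y * y powr (x * (\<alpha> - 1)) = 1"
    proof -
      have "x * (\<alpha> - 1) = -1" using x by (simp add: algebra_simps)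
      then show ?thesis using y by (simp add: powr_minus)
    qed
    finally show ?thesis by (simp add: y_def)
  qed
  define c0 where "c0 = D * L0 + D * L1 * ((1 - \<alpha>) * c powr \<alpha>) + (1 - \<alpha>) * (D * L1) powr x"
  define c1 where "c1 = D * L1 * (\<alpha> * c powr (\<alpha> - 1))"
  have c01: "0 \<le> c0" "0 \<le> c1" using D L \<alpha> by (auto simp: c0_def c1_def)
  have "(\<integral>\<xi>. (norm (grad (F \<xi>) w' - grad (F \<xi>) w))\<^sup>2 \<partial>P) \<le> ((c0 + c1 * m) / (1 - \<alpha>))\<^sup>2"
  proof (rule mean_square_grad_diff_le[OF smooth _ meas second_moment_grad_le(1)[OF prob unbiased noise(1)]])
    show "(\<integral>\<xi>. (norm (grad (F \<xi>) w))\<^sup>2 \<partial>P) \<le> m\<^sup>2"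
      using second_moment_grad_le(2)[OF prob unbiased noise(1), of w] sqrt_add_square_le[of s g \<Lambda>] s noise
      by (simp add: m_def g_def)
    show "norm (w' - w) * (L0 + L1 * (N + V) powr \<alpha>) \<le> c0 + c1 * N + \<alpha> * V"
      if "0 \<le> N" "0 \<le> V" for N V
    proof -
      have "(N + V) powr \<alpha> \<le> N powr \<alpha> + V powr \<alpha>"
        using \<alpha> that by (intro powr_subadditive) auto
      moreover have "N powr \<alpha> \<le> (1 - \<alpha>) * c powr \<alpha> + \<alpha> * c powr (\<alpha> - 1) * N"
        using \<alpha> that c by (intro powr_le_tangent) auto
      ultimately have "(N + V) powr \<alpha> \<le> ((1 - \<alpha>) * c powr \<alpha> + \<alpha> * c powr (\<alpha> - 1) * N) + V powr \<alpha>"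
        by simp
      then have "D * L1 * (N + V) powr \<alpha> \<le> D * L1 * (((1 - \<alpha>) * c powr \<alpha> + \<alpha> * c powr (\<alpha> - 1) * N) + V powr \<alpha>)"
        using D L by (intro mult_left_mono) auto
      then show ?thesis using young[OF that(2)]
        by (simp add: c0_def c1_def D_def algebra_simps)
    qed
  qed (use m c01 \<alpha> in auto)
  also have "\<dots> \<le> (D / \<gamma> * (\<epsilon> * (3 / 20 * (1 - \<mu> * \<alpha>) + 3 / 20 * (\<mu> * \<alpha>) * g)))\<^sup>2"
  proof (rule power_mono)
    have "c1 * m \<le> c1 * c" using m c01 by (intro mult_left_mono)
    also have "\<dots> = D * L1 * (\<alpha> * c powr \<alpha>)"
      using c by (simp add: c1_def powr_mult_base algebra_simps)
    finally have "(c0 + c1 * m) / (1 - \<alpha>)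
        \<le> (D * L0 + D * L1 * c powr \<alpha> + (1 - \<alpha>) * (D * L1) powr x) / (1 - \<alpha>)"
      using \<alpha> by (intro divide_right_mono) (auto simp: c0_def algebra_simps)
    also have "\<dots> = D * (x * L0) + D * (x * L1 * c powr \<alpha>) + (D * L1) powr x"
      using \<alpha> by (simp add: x_def add_divide_distrib)
    also have "\<dots> \<le> D * (3 / 20 * (2 * K0))
        + D * (3 / 20 * (2 * K1) * (\<Lambda> powr \<alpha> + (\<Gamma> powr \<alpha> + 1) * (1 - \<alpha> + \<alpha> * g))) + D * (3 / 20 * (4 * K2))"
    proof (intro K0 K1 K2 add_mono mult_left_mono mult_mono)
      have "c powr \<alpha> \<le> ((\<Gamma> + 1) * g) powr \<alpha> + \<Lambda> powr \<alpha>"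
        unfolding c_def using \<alpha> noise g by (intro powr_subadditive) auto
      also have "((\<Gamma> + 1) * g) powr \<alpha> = (\<Gamma> + 1) powr \<alpha> * g powr \<alpha>"
        using noise g by (simp add: powr_mult)
      also have "(\<Gamma> + 1) powr \<alpha> * g powr \<alpha> \<le> (\<Gamma> powr \<alpha> + 1) * (1 - \<alpha> + \<alpha> * g)"
        using powr_subadditive[of \<alpha> \<Gamma> 1] powr_le_tangent[of \<alpha> g 1] \<alpha> noise g
        by (intro mult_mono) auto
      finally show "c powr \<alpha> \<le> \<Lambda> powr \<alpha> + (\<Gamma> powr \<alpha> + 1) * (1 - \<alpha> + \<alpha> * g)" by simp
    qed (use D K in auto)
    also have "\<dots> = D * (3 / 20) * (R - 1 - 2 * K1 * (\<Gamma> powr \<alpha> + 1) * \<alpha> + 2 * K1 * (\<Gamma> powr \<alpha> + 1) * \<alpha> * g)"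
      unfolding R_def by (simp add: field_simps)
    also have "\<dots> = D * (3 / 20) * (R - 1 - R * (\<mu> * \<alpha>) + R * (\<mu> * \<alpha>) * g)"
    proof -
      have "2 * K1 * (\<Gamma> powr \<alpha> + 1) = R * \<mu>"
        unfolding \<mu>_def K0_def[symmetric] K1_def[symmetric] K2_def[symmetric] R_def[symmetric] using R by simp
      then show ?thesis by (simp add: mult.assoc)
    qed
    also have "\<dots> \<le> D * (3 / 20) * (R - R * (\<mu> * \<alpha>) + R * (\<mu> * \<alpha>) * g)"
      using D by (intro mult_left_mono) auto
    also have "\<dots> = D / \<gamma> * (\<epsilon> * (3 / 20 * (1 - \<mu> * \<alpha>) + 3 / 20 * (\<mu> * \<alpha>) * g))"
      unfolding \<gamma> using \<epsilon> R by (simp add: field_simps)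
    finally show "(c0 + c1 * m) / (1 - \<alpha>) \<le> D / \<gamma> * (\<epsilon> * (3 / 20 * (1 - \<mu> * \<alpha>) + 3 / 20 * (\<mu> * \<alpha>) * g))" .
    show "0 \<le> (c0 + c1 * m) / (1 - \<alpha>)" using c01 m \<alpha> by simp
  qed
  finally show ?thesis by (simp add: D_def \<gamma>_def g_def)
qed

lemma learning_rate_pos:
  assumes "0 < L0" "0 < L1" "0 < \<Gamma>" "0 < \<Lambda>" "0 < \<epsilon>"
  shows "0 < learning_rate \<alpha> L0 L1 \<Gamma> \<Lambda> \<epsilon>"
proof -
  have "0 < 5 * L1 * sqrt (\<Gamma>\<^sup>2 + 1)"
    using assms by (intro mult_pos_pos real_sqrt_gt_zero add_nonneg_pos) auto
  moreover have "0 \<le> 8 * sqrt (L0\<^sup>2 + 2 * L1\<^sup>2 * \<Lambda>\<^sup>2)" by simp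
  moreover have "0 < K0_bar \<alpha> L0" "0 \<le> K1_bar \<alpha> L1" "0 \<le> K2_bar \<alpha> L1"
    using assms by (simp_all add: K0_bar_def K1_bar_def K2_bar_def)
  moreover from this have "0 \<le> K1_bar \<alpha> L1 * (\<Lambda> powr \<alpha> + \<Gamma> powr \<alpha> + 1)"
    by simp
  ultimately have "0 < 5 * L1 * sqrt (\<Gamma>\<^sup>2 + 1) + 8 * sqrt (L0\<^sup>2 + 2 * L1\<^sup>2 * \<Lambda>\<^sup>2)"
    "0 < 2 * K0_bar \<alpha> L0 + 4 * K2_bar \<alpha> L1 + 2 * K1_bar \<alpha> L1 * (\<Lambda> powr \<alpha> + \<Gamma> powr \<alpha> + 1) + 1"
    by linarith+
  then show ?thesis unfolding learning_rate_def using assms(5) by (cases "\<alpha> < 1") (simp_all only: if_True if_False divide_pos_pos)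
qed

text \<open>In both regimes the two constants are shares of the denominator of the learning rate, so they cannot be large
  at the same time. This trade-off is what the condition \<open>6 * \<beta> + 4 * \<kappa> \<le> 1\<close> records.\<close>

lemma mean_square_grad_diff_le_affine:
  fixes F :: "'s \<Rightarrow> 'a::euclidean_space \<Rightarrow> real"
  assumes smooth: "EL_sym_star P F \<alpha> L0 L1" and \<alpha>: "0 < \<alpha>" "\<alpha> \<le> 1"
    and unbiased: "unbiased_gradients P F"
    and noise: "gradient_variance_bound P F \<Gamma> \<Lambda>" "0 < \<Gamma>" "0 < \<Lambda>"
    and \<epsilon>: "0 < \<epsilon>" "\<epsilon> < 1"
  obtains \<beta> \<kappa> where "0 \<le> \<beta>" "0 \<le> \<kappa>" "6 * \<beta> + 4 * \<kappa> \<le> 1"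
    and "\<And>w w'. norm (w' - w) \<le> learning_rate \<alpha> L0 L1 \<Gamma> \<Lambda> \<epsilon> \<Longrightarrow>
      (\<integral>\<xi>. (norm (grad (F \<xi>) w' - grad (F \<xi>) w))\<^sup>2 \<partial>P)
        \<le> (norm (w' - w) / learning_rate \<alpha> L0 L1 \<Gamma> \<Lambda> \<epsilon> * (\<epsilon> * (\<beta> + \<kappa> * norm (grad (risk P F) w))))\<^sup>2"
proof (cases "\<alpha> = 1")
  case True
  define a where "a = L1 * sqrt (\<Gamma>\<^sup>2 + 1)"
  define b where "b = sqrt (L0\<^sup>2 + 2 * L1\<^sup>2 * \<Lambda>\<^sup>2)"
  have L: "L0 > 0" "L1 > 0" using smooth by (auto simp: EL_sym_star_def)
  have ab: "0 < a" "0 \<le> b" using L by (auto simp: a_def b_def add_nonneg_pos)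
  define d where "d = 4 * a + 8 * b"
  have d: "0 < d" using ab by (simp add: d_def)
  show ?thesis
  proof (rule that[of "4 / 3 * b / d" "a / d"])
    have "6 * (4 / 3 * b / d) + 4 * (a / d) = (8 * b + 4 * a) / d"
      by (simp add: add_divide_distrib)
    also have "\<dots> = 1" using d by (simp add: d_def)
    finally show "6 * (4 / 3 * b / d) + 4 * (a / d) \<le> 1" by simp
  qed (use ab d mean_square_grad_diff_le_linear[OF smooth[unfolded True] unbiased noise \<epsilon>] True in
      \<open>auto simp: a_def b_def d_def\<close>)
next
  case False
  then have \<alpha>': "\<alpha> < 1" using \<alpha> by simp
  define A where "A = 2 * K1_bar \<alpha> L1 * (\<Gamma> powr \<alpha> + 1)"
  define R where "R = 2 * K0_bar \<alpha> L0 + 4 * K2_bar \<alpha> L1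
                + 2 * K1_bar \<alpha> L1 * (\<Lambda> powr \<alpha> + \<Gamma> powr \<alpha> + 1) + 1"
  have L: "L0 > 0" "L1 > 0" using smooth by (auto simp: EL_sym_star_def)
  have K: "0 < K0_bar \<alpha> L0" "0 < K1_bar \<alpha> L1" "0 \<le> K2_bar \<alpha> L1"
    using L by (simp_all add: K0_bar_def K1_bar_def K2_bar_def)
  then have "0 \<le> A" by (auto simp: A_def)
  moreover have "A < R"
  proof -
    have "R = A + (2 * K0_bar \<alpha> L0 + 4 * K2_bar \<alpha> L1 + 2 * K1_bar \<alpha> L1 * \<Lambda> powr \<alpha> + 1)"
      by (simp add: A_def R_def algebra_simps)
    moreover have "0 \<le> K1_bar \<alpha> L1 * \<Lambda> powr \<alpha>" using K by simp
    ultimately show ?thesis using K by linarith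
  qed
  ultimately have \<mu>: "0 \<le> A / R" "A / R \<le> 1" by (auto simp: divide_le_eq_1)
  define z where "z = A / R * \<alpha>"
  have z: "0 \<le> z" "z \<le> 1"
    unfolding z_def using \<mu> \<alpha> by (auto intro: mult_nonneg_nonneg mult_le_one simp del: times_divide_eq_left)
  show ?thesis
  proof (rule that[of "3 / 20 * (1 - z)" "3 / 20 * (z)"])
    show "0 \<le> 3 / 20 * (1 - z)" using z by simp
    show "0 \<le> 3 / 20 * z" using z by linarith
    show "6 * (3 / 20 * (1 - z)) + 4 * (3 / 20 * z) \<le> 1" using z by (simp add: field_simps)
    show "(\<integral>\<xi>. (norm (grad (F \<xi>) w' - grad (F \<xi>) w))\<^sup>2 \<partial>P)
        \<le> (norm (w' - w) / learning_rate \<alpha> L0 L1 \<Gamma> \<Lambda> \<epsilon> * (\<epsilon> * (3 / 20 * (1 - z)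
            + 3 / 20 * (z) * norm (grad (risk P F) w))))\<^sup>2"
      if "norm (w' - w) \<le> learning_rate \<alpha> L0 L1 \<Gamma> \<Lambda> \<epsilon>" for w w'
      using mean_square_grad_diff_le_sublinear[OF smooth \<alpha>(1) \<alpha>' unbiased noise \<epsilon> that]
      unfolding z_def A_def R_def .
  qed
qed

section \<open>Descent along normalized steps\<close>

lemma sgn_inner_self: "sgn v \<bullet> v = norm (v :: 'a::real_inner)"
  by (cases "v = 0") (simp_all add: sgn_div_norm power2_norm_eq_inner[symmetric] power2_eq_square)

text \<open>What the analysis of the algorithm uses of the stochastic gradients: steps of length at most \<open>\<gamma>\<close> change them, in mean
  square, proportionally to the step and by an affine function of the gradient norm of the risk.\<close>

locale affine_smooth_oracle =
  fixes P :: "'s measure" and F :: "'s \<Rightarrow> 'a::euclidean_space \<Rightarrow> real"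
    and \<gamma> \<epsilon> \<beta> \<kappa> \<Gamma> \<Lambda> fstar :: real
  assumes stochastic: "differentiable_stochastic P F"
    and unbiased: "unbiased_gradients P F"
    and noise: "gradient_variance_bound P F \<Gamma> \<Lambda>"
    and \<gamma>_pos: "0 < \<gamma>" and \<epsilon>: "0 < \<epsilon>" "\<epsilon> < 1"
    and \<beta>: "0 \<le> \<beta>" and \<kappa>: "0 \<le> \<kappa>" and slope: "6 * \<beta> + 4 * \<kappa> \<le> 1"
    and diff_square_integrable:
      "\<And>w w'. integrable P (\<lambda>\<xi>. (norm (grad (F \<xi>) w' - grad (F \<xi>) w))\<^sup>2)"
    and mean_square_lipschitz: "\<And>w w'. norm (w' - w) \<le> \<gamma> \<Longrightarrow>
      (\<integral>\<xi>. (norm (grad (F \<xi>) w' - grad (F \<xi>) w))\<^sup>2 \<partial>P)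
        \<le> (norm (w' - w) / \<gamma> * (\<epsilon> * (\<beta> + \<kappa> * norm (grad (risk P F) w))))\<^sup>2"
    and lower_bound: "\<And>w. fstar \<le> risk P F w"
begin

abbreviation "f \<equiv> risk P F"

sublocale sampling: prob_space P
  using stochastic by (simp add: differentiable_stochastic_def)

definition modulus :: "'a \<Rightarrow> real" where
  "modulus w = \<beta> + \<kappa> * norm (grad f w)"

lemma modulus_nonneg: "0 \<le> modulus w"
  using \<beta> \<kappa> by (simp add: modulus_def)

lemma grad_integrable: "integrable P (\<lambda>\<xi>. grad (F \<xi>) w)"
  and grad_mean: "(\<integral>\<xi>. grad (F \<xi>) w \<partial>P) = grad f w"
  using unbiased by (auto simp: unbiased_gradients_def)

lemma f_differentiable: "f differentiable (at w)"
  using stochastic by (simp add: differentiable_stochastic_def)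

lemma grad_joint_measurable:
  "(\<lambda>(\<xi>, w). grad (F \<xi>) w) \<in> borel_measurable (P \<Otimes>\<^sub>M borel)"
  using stochastic by (intro borel_measurable_grad_joint) (auto simp: differentiable_stochastic_def)

lemma grad_f_measurable [measurable]: "grad f \<in> borel_measurable borel"
  by (intro borel_measurable_grad f_differentiable)

lemma f_measurable [measurable]: "f \<in> borel_measurable borel"
  by (intro borel_measurable_continuous_onI continuous_at_imp_continuous_on ballI
      differentiable_imp_continuous_within f_differentiable)

text \<open>Subtracting the mean from the gradient difference removes its square from the second moment. The same
  identity gives the variance of a SPIDER correction and, since a variance is nonnegative, the
  continuity of the gradient of the risk.\<close>

lemma centered_diff_variance:
  assumes "norm (w' - w) \<le> \<gamma>"
  shows "integrable P (\<lambda>\<xi>. (norm ((grad (F \<xi>) w' - grad (F \<xi>) w) - (grad f w' - grad f w)))\<^sup>2)"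
    and "(\<integral>\<xi>. (norm ((grad (F \<xi>) w' - grad (F \<xi>) w) - (grad f w' - grad f w)))\<^sup>2 \<partial>P)
        \<le> (norm (w' - w) / \<gamma> * (\<epsilon> * modulus w))\<^sup>2 - (norm (grad f w' - grad f w))\<^sup>2"
proof -
  let ?d = "\<lambda>\<xi>. grad (F \<xi>) w' - grad (F \<xi>) w" and ?m = "grad f w' - grad f w"
  have expand: "(norm (?d \<xi> - ?m))\<^sup>2 = (norm (?d \<xi>))\<^sup>2 - 2 * (?d \<xi> \<bullet> ?m) + (norm ?m)\<^sup>2" for \<xi>
    by (simp only: power2_norm_eq_inner) (simp add: inner_diff inner_commute)
  have int: "integrable P ?d" using grad_integrable by simp
  have mean: "(\<integral>\<xi>. ?d \<xi> \<partial>P) = ?m" using grad_integrable grad_mean by simp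
  show "integrable P (\<lambda>\<xi>. (norm (?d \<xi> - ?m))\<^sup>2)"
    unfolding expand using int diff_square_integrable by simp
  have "(\<integral>\<xi>. (norm (?d \<xi> - ?m))\<^sup>2 \<partial>P)
      = (\<integral>\<xi>. (norm (?d \<xi>))\<^sup>2 \<partial>P) - 2 * ((\<integral>\<xi>. ?d \<xi> \<partial>P) \<bullet> ?m) + (norm ?m)\<^sup>2"
    unfolding expand using int diff_square_integrable[of w' w]
    by (subst Bochner_Integration.integral_add Bochner_Integration.integral_diff, (simp; fail), (simp; fail))+
      (simp add: sampling.prob_space del: integral_diff)
  also have "\<dots> = (\<integral>\<xi>. (norm (?d \<xi>))\<^sup>2 \<partial>P) - (norm ?m)\<^sup>2"
    unfolding mean by (simp add: power2_norm_eq_inner)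
  also have "\<dots> \<le> (norm (w' - w) / \<gamma> * (\<epsilon> * modulus w))\<^sup>2 - (norm ?m)\<^sup>2"
    using mean_square_lipschitz[OF assms] by (simp add: modulus_def)
  finally show "(\<integral>\<xi>. (norm (?d \<xi> - ?m))\<^sup>2 \<partial>P)
      \<le> (norm (w' - w) / \<gamma> * (\<epsilon> * modulus w))\<^sup>2 - (norm ?m)\<^sup>2" .
qed

lemma grad_f_diff_le:
  assumes "norm (w' - w) \<le> \<gamma>"
  shows "norm (grad f w' - grad f w) \<le> norm (w' - w) / \<gamma> * (\<epsilon> * modulus w)"
proof (rule power2_le_imp_le)
  have "0 \<le> (\<integral>\<xi>. (norm ((grad (F \<xi>) w' - grad (F \<xi>) w) - (grad f w' - grad f w)))\<^sup>2 \<partial>P)"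
    by (intro integral_nonneg_AE) auto
  then show "(norm (grad f w' - grad f w))\<^sup>2 \<le> (norm (w' - w) / \<gamma> * (\<epsilon> * modulus w))\<^sup>2"
    using centered_diff_variance(2)[OF assms] by linarith
  show "0 \<le> norm (w' - w) / \<gamma> * (\<epsilon> * modulus w)"
    using \<gamma>_pos \<epsilon> modulus_nonneg by simp
qed

text \<open>The factor one half arises because the gradient varies proportionally to the distance from \<open>w\<close>: along the
  segment, the linearization error plus or minus a parabola is monotone.\<close>

lemma f_le_quadratic:
  assumes "norm h \<le> \<gamma>"
  shows "\<bar>f (w + h) - f w - h \<bullet> grad f w\<bar> \<le> \<gamma> * (\<epsilon> * modulus w) / 2"
proof -
  define c where "c = norm h * (norm h / \<gamma> * (\<epsilon> * modulus w))"
  have c: "0 \<le> c" unfolding c_def using \<gamma>_pos \<epsilon> modulus_nonneg by simp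
  have der: "((\<lambda>t. f (w + t *\<^sub>R h) - t * (h \<bullet> grad f w))
      has_real_derivative (h \<bullet> (grad f (w + t *\<^sub>R h) - grad f w))) (at t)" for t
    unfolding inner_diff_right
    by (auto intro!: derivative_eq_intros DERIV_along_line f_differentiable)
  have bound: "\<bar>h \<bullet> (grad f (w + t *\<^sub>R h) - grad f w)\<bar> \<le> c * t" if "0 \<le> t" "t \<le> 1" for t
  proof -
    have n: "norm (w + t *\<^sub>R h - w) = t * norm h" using that by simp
    have "t * norm h \<le> 1 * \<gamma>" using that assms by (intro mult_mono) auto
    then have "norm (grad f (w + t *\<^sub>R h) - grad f w) \<le> t * norm h / \<gamma> * (\<epsilon> * modulus w)"
      using grad_f_diff_le[of "w + t *\<^sub>R h" w] unfolding n by simp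
    then have "norm h * norm (grad f (w + t *\<^sub>R h) - grad f w) \<le> norm h * (t * norm h / \<gamma> * (\<epsilon> * modulus w))"
      by (intro mult_left_mono) auto
    also have "\<dots> = c * t" by (simp add: c_def)
    finally show ?thesis using Cauchy_Schwarz_ineq2 order_trans by blast
  qed
  have side: "s * (f (w + 1 *\<^sub>R h) - 1 * (h \<bullet> grad f w)) - c / 2 * 1\<^sup>2
      \<le> s * (f (w + 0 *\<^sub>R h) - 0 * (h \<bullet> grad f w)) - c / 2 * 0\<^sup>2" if s: "s = 1 \<or> s = -1" for s :: real
  proof (rule DERIV_nonpos_imp_nonincreasing[of 0 1 "\<lambda>t. s * (f (w + t *\<^sub>R h) - t * (h \<bullet> grad f w)) - c / 2 * t\<^sup>2"])
    fix t :: real assume t: "0 \<le> t" "t \<le> 1"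
    have "((\<lambda>t. s * (f (w + t *\<^sub>R h) - t * (h \<bullet> grad f w)) - c / 2 * t\<^sup>2)
        has_real_derivative (s * (h \<bullet> (grad f (w + t *\<^sub>R h) - grad f w)) - c * t)) (at t)"
      by (rule DERIV_diff[OF DERIV_cmult[OF der]]) (auto intro!: derivative_eq_intros)
    moreover have "s * (h \<bullet> (grad f (w + t *\<^sub>R h) - grad f w)) \<le> c * t"
    proof -
      have "s * (h \<bullet> (grad f (w + t *\<^sub>R h) - grad f w)) \<le> \<bar>s * (h \<bullet> (grad f (w + t *\<^sub>R h) - grad f w))\<bar>"
        by (rule abs_ge_self)
      also have "\<dots> = \<bar>h \<bullet> (grad f (w + t *\<^sub>R h) - grad f w)\<bar>" unfolding abs_mult using s by auto
      finally show ?thesis using bound[OF t] by (rule order_trans)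
    qed
    ultimately show "\<exists>y. ((\<lambda>t. s * (f (w + t *\<^sub>R h) - t * (h \<bullet> grad f w)) - c / 2 * t\<^sup>2)
        has_real_derivative y) (at t) \<and> y \<le> 0"
      by (intro exI conjI) (assumption, simp)
  qed simp
  have "c \<le> \<gamma> * (\<epsilon> * modulus w)"
  proof -
    have "norm h * norm h \<le> \<gamma> * \<gamma>" using assms by (intro mult_mono) (use \<gamma>_pos in auto)
    then have "norm h * norm h / \<gamma> \<le> \<gamma>" using \<gamma>_pos by (simp add: pos_divide_le_eq)
    then have "norm h * norm h / \<gamma> * (\<epsilon> * modulus w) \<le> \<gamma> * (\<epsilon> * modulus w)"
      using \<epsilon> modulus_nonneg by (intro mult_right_mono) auto
    then show ?thesis by (simp add: c_def)
  qed
  moreover have "f (w + h) - f w - h \<bullet> grad f w \<le> c / 2" using side[of 1] by simp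
  moreover have "- (f (w + h) - f w - h \<bullet> grad f w) \<le> c / 2" using side[of "-1"] by simp
  ultimately show ?thesis by linarith
qed

text \<open>A step against the exact gradient cannot descend below the minimum. Hence integrability of the risk
  passes to the norm of its gradient.\<close>

lemma norm_grad_f_le_gap:
  "\<gamma> * norm (grad f w) \<le> 2 * (f w - fstar) + \<gamma>"
proof -
  let ?g = "norm (grad f w)"
  have n: "norm (- (\<gamma> *\<^sub>R sgn (grad f w))) \<le> \<gamma>"
    using \<gamma>_pos by (simp add: norm_sgn)
  have inner: "sgn (grad f w) \<bullet> grad f w = ?g"
    by (rule sgn_inner_self)
  have "f (w + - (\<gamma> *\<^sub>R sgn (grad f w))) \<le> f w - \<gamma> * ?g + \<gamma> * (\<epsilon> * modulus w) / 2"
    using f_le_quadratic[OF n, of w, THEN abs_le_D1] by (simp add: inner)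
  then have 1: "fstar \<le> f w - \<gamma> * ?g + \<gamma> * (\<epsilon> * modulus w) / 2"
    using lower_bound order_trans by blast
  have "\<kappa> * ?g \<le> 1 / 4 * ?g" using slope \<beta> by (intro mult_right_mono) auto
  then have "modulus w \<le> 1 / 6 + 1 / 4 * ?g" using slope \<kappa> unfolding modulus_def by linarith
  moreover have "\<epsilon> * modulus w \<le> 1 * modulus w"
    using \<epsilon> modulus_nonneg by (intro mult_right_mono) auto
  ultimately have "\<gamma> * (\<epsilon> * modulus w) \<le> \<gamma> * (1 / 6 + 1 / 4 * ?g)"
    using \<gamma>_pos by (intro mult_left_mono) auto
  then have "\<gamma> * (\<epsilon> * modulus w) \<le> \<gamma> / 6 + \<gamma> * ?g / 4" by (simp add: algebra_simps)
  moreover have "0 \<le> \<gamma> * ?g" using \<gamma>_pos by simp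
  moreover have arith: "G \<le> 2 * (a - b) + \<gamma>"
    if "E \<le> \<gamma> / 6 + G / 4" "0 \<le> G" "b \<le> a - G + E / 2" "b \<le> a" for a b E G :: real
    using that \<gamma>_pos by (simp add: field_simps)
  ultimately show ?thesis using 1 lower_bound[of w] by (intro arith[of "\<gamma> * (\<epsilon> * modulus w)"])
qed

text \<open>The direction \<open>sgn v\<close> loses at most twice the error against the exact gradient: once for replacing the gradient by
  \<open>v\<close> in the inner product, once for replacing the norm of \<open>v\<close> by the norm of the gradient.\<close>

lemma normalized_step_descent:
  "f (w - \<gamma> *\<^sub>R sgn v) \<le> f w - \<gamma> * norm (grad f w) + 2 * \<gamma> * norm (v - grad f w)
      + \<gamma> * (\<epsilon> * modulus w) / 2"
proof -
  have n: "norm (- (\<gamma> *\<^sub>R sgn v)) \<le> \<gamma>" using \<gamma>_pos by (simp add: norm_sgn)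
  have "norm (grad f w) - 2 * norm (v - grad f w) \<le> sgn v \<bullet> grad f w"
  proof -
    have "norm v = sgn v \<bullet> v"
      by (simp add: sgn_inner_self)
    also have "\<dots> = sgn v \<bullet> grad f w + sgn v \<bullet> (v - grad f w)" by (simp add: inner_diff)
    also have "sgn v \<bullet> (v - grad f w) \<le> norm (sgn v) * norm (v - grad f w)"
      by (rule norm_cauchy_schwarz)
    also have "\<dots> \<le> 1 * norm (v - grad f w)"
      by (intro mult_right_mono) (auto simp: norm_sgn)
    finally have "norm v \<le> sgn v \<bullet> grad f w + norm (v - grad f w)" by simp
    moreover have "norm (grad f w) \<le> norm v + norm (v - grad f w)"
      by (metis norm_minus_commute norm_triangle_sub)
    ultimately show ?thesis by linarith
  qed
  then have "\<gamma> * (norm (grad f w) - 2 * norm (v - grad f w)) \<le> \<gamma> * (sgn v \<bullet> grad f w)"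
    using \<gamma>_pos by (intro mult_left_mono) auto
  then show ?thesis using f_le_quadratic[OF n, of w, THEN abs_le_D1] by (simp add: algebra_simps)
qed

lemma normalized_step_norm: "norm (w - \<gamma> *\<^sub>R sgn v - w) \<le> \<gamma>"
  using \<gamma>_pos by (simp add: norm_sgn)

end

section \<open>Fresh samples\<close>

text \<open>Independence as a product formula for the joint law, hence as Tonelli's theorem. The two variables
  may have different types of values.\<close>

lemma (in prob_space) nn_integral_indep_pair:
  assumes Y: "Y \<in> measurable M N" and Z: "Z \<in> measurable M N'"
    and indep: "indep_set {Y -` A \<inter> space M |A. A \<in> sets N} {Z -` A \<inter> space M |A. A \<in> sets N'}"
    and H: "H \<in> borel_measurable (N \<Otimes>\<^sub>M N')"
  shows "(\<integral>\<^sup>+\<omega>. H (Y \<omega>, Z \<omega>) \<partial>M) = (\<integral>\<^sup>+\<omega>. (\<integral>\<^sup>+\<omega>'. H (Y \<omega>, Z \<omega>') \<partial>M) \<partial>M)"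
proof -
  note [measurable] = Y Z H
  interpret Y: prob_space "distr M N Y" by (rule prob_space_distr[OF Y])
  interpret Z: prob_space "distr M N' Z" by (rule prob_space_distr[OF Z])
  have joint: "distr M N Y \<Otimes>\<^sub>M distr M N' Z = distr M (N \<Otimes>\<^sub>M N') (\<lambda>\<omega>. (Y \<omega>, Z \<omega>))"
  proof (rule pair_measure_eqI)
    fix A B assume "A \<in> sets (distr M N Y)" "B \<in> sets (distr M N' Z)"
    then have A: "A \<in> sets N" and B: "B \<in> sets N'" by simp_all
    have "prob ((Y -` A \<inter> space M) \<inter> (Z -` B \<inter> space M)) = prob (Y -` A \<inter> space M) * prob (Z -` B \<inter> space M)"
      using indep A B unfolding indep_sets2_eq by blast
    moreover have "(\<lambda>\<omega>. (Y \<omega>, Z \<omega>)) -` (A \<times> B) \<inter> space M = (Y -` A \<inter> space M) \<inter> (Z -` B \<inter> space M)"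
      by auto
    ultimately show "emeasure (distr M N Y) A * emeasure (distr M N' Z) B
        = emeasure (distr M (N \<Otimes>\<^sub>M N') (\<lambda>\<omega>. (Y \<omega>, Z \<omega>))) (A \<times> B)"
      using A B by (simp add: emeasure_distr emeasure_eq_measure ennreal_mult)
  qed (auto simp: Y.sigma_finite_measure_axioms Z.sigma_finite_measure_axioms cong: sets_pair_measure_cong)
  have "(\<integral>\<^sup>+\<omega>. H (Y \<omega>, Z \<omega>) \<partial>M) = (\<integral>\<^sup>+x. H x \<partial>(distr M N Y \<Otimes>\<^sub>M distr M N' Z))"
    unfolding joint by (subst nn_integral_distr) auto
  also have "\<dots> = (\<integral>\<^sup>+y. (\<integral>\<^sup>+z. H (y, z) \<partial>distr M N' Z) \<partial>distr M N Y)"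
    by (rule Z.nn_integral_fst[symmetric]) simp
  also have "\<dots> = (\<integral>\<^sup>+\<omega>. (\<integral>\<^sup>+z. H (Y \<omega>, z) \<partial>distr M N' Z) \<partial>M)"
    by (intro nn_integral_distr Z.borel_measurable_nn_integral) simp_all
  also have "\<dots> = (\<integral>\<^sup>+\<omega>. (\<integral>\<^sup>+\<omega>'. H (Y \<omega>, Z \<omega>') \<partial>M) \<partial>M)"
    by (intro nn_integral_cong nn_integral_distr) (auto dest: measurable_space[OF Y])
  finally show ?thesis .
qed

locale independent_samples = prob_space M for M :: "'o measure" +
  fixes N :: "'b measure" and init :: "'o \<Rightarrow> 'b" and P :: "'s measure" and X :: "'i \<Rightarrow> 'o \<Rightarrow> 's"
  assumes init_meas: "init \<in> measurable M N"
    and sample_distr: "distr M P (X j) = P"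
    and samples_indep: "indep_vars (\<lambda>_. P) X UNIV"
    and init_indep: "indep_set {init -` A \<inter> space M |A. A \<in> sets N}
      {(\<lambda>\<omega> j. X j \<omega>) -` A \<inter> space M |A. A \<in> sets (Pi\<^sub>M UNIV (\<lambda>_. P))}"
begin

definition init_events :: "'o set set" where
  "init_events = {init -` A \<inter> space M |A. A \<in> sets N}"

definition sample_events :: "'i \<Rightarrow> 'o set set" where
  "sample_events j = {X j -` A \<inter> space M |A. A \<in> sets P}"

definition history :: "'i set \<Rightarrow> 'o measure" where
  "history A = sigma (space M) (init_events \<union> (\<Union>j\<in>A. sample_events j))"

lemma sample_meas: "X j \<in> measurable M P"
  using samples_indep by (simp add: indep_vars_def)

lemma history_generators: "init_events \<union> (\<Union>j\<in>A. sample_events j) \<subseteq> Pow (space M)"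
  by (auto simp: init_events_def sample_events_def)

lemma space_history [simp]: "space (history A) = space M"
  by (simp add: history_def space_measure_of_conv)

lemma sets_history: "sets (history A) = sigma_sets (space M) (init_events \<union> (\<Union>j\<in>A. sample_events j))"
  unfolding history_def using history_generators by (rule sets_measure_of)

lemma events_subset: "init_events \<subseteq> events" "sample_events j \<subseteq> events"
  using measurable_sets[OF init_meas] measurable_sets[OF sample_meas]
  by (auto simp: init_events_def sample_events_def)

lemma sets_history_subset: "sets (history A) \<subseteq> events"
  unfolding sets_history using events_subset by (intro sets.sigma_sets_subset) auto

lemma measurable_history_mono:
  assumes "Y \<in> measurable (history A) K" "A \<subseteq> B"
  shows "Y \<in> measurable (history B) K"
proof -
  have "sets (history A) \<subseteq> sets (history B)"
    unfolding sets_history using assms(2) by (intro sigma_sets_mono') auto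
  then show ?thesis using assms(1) measurable_mono[of K K "history A" "history B"] by auto
qed

lemma measurable_history: "Y \<in> measurable (history A) K \<Longrightarrow> Y \<in> measurable M K"
  using sets_history_subset[of A] measurable_mono[of K K "history A" M] by auto

lemma init_history_measurable: "init \<in> measurable (history A) N"
  by (rule measurableI) (auto simp: sets_history init_events_def dest: measurable_space[OF init_meas] intro!: sigma_sets.Basic)

lemma sample_history_measurable:
  assumes "j \<in> A" shows "X j \<in> measurable (history A) P"
  using assms
  by (intro measurableI) (auto simp: sets_history sample_events_def dest: measurable_space[OF sample_meas] intro!: sigma_sets.Basic)

text \<open>The starting point is independent of all samples jointly and the samples are independent of each other;
  a finite intersection of events splits off the event of the starting point first.\<close>

lemma init_and_samples_indep: "indep_sets (case_option init_events sample_events) UNIV"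
proof (rule indep_setsI)
  fix k show "(case k of None \<Rightarrow> init_events | Some j \<Rightarrow> sample_events j) \<subseteq> events"
    using events_subset by (cases k) auto
next
  fix A and J :: "'i option set"
  assume J: "J \<noteq> {}" "finite J"
    and A: "\<forall>j\<in>J. A j \<in> (case j of None \<Rightarrow> init_events | Some i \<Rightarrow> sample_events i)"
  define K where "K = {j. Some j \<in> J}"
  have K: "finite K" using J finite_vimageI[of J Some] by (simp add: K_def vimage_def)
  have AK: "A (Some k) \<in> sample_events k" if "k \<in> K" for k using A that by (force simp: K_def)
  have prod_K: "prob (\<Inter>k\<in>K. A (Some k)) = (\<Prod>k\<in>K. prob (A (Some k)))" if "K \<noteq> {}"
    using samples_indep K AK that unfolding indep_vars_def2
    by (intro indep_setsD[of sample_events UNIV]) (auto simp: sample_events_def[abs_def])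
  show "prob (\<Inter>j\<in>J. A j) = (\<Prod>j\<in>J. prob (A j))"
  proof (cases "None \<in> J")
    case False
    then have "J = Some ` K" by (auto simp: K_def) (metis option.exhaust image_eqI mem_Collect_eq)
    then show ?thesis using prod_K J by (simp add: prod.reindex image_image)
  next
    case True
    then have JK: "J = insert None (Some ` K)"
      by (auto simp: K_def) (metis option.exhaust image_eqI mem_Collect_eq)
    show ?thesis
    proof (cases "K = {}")
      case True then show ?thesis using JK by simp
    next
      case False
      obtain B where B: "\<And>k. k \<in> K \<Longrightarrow> B k \<in> sets P" "\<And>k. k \<in> K \<Longrightarrow> A (Some k) = X k -` B k \<inter> space M"
        using AK unfolding sample_events_def by (simp add: subset_eq) metis
      define C where "C = {x \<in> space (Pi\<^sub>M UNIV (\<lambda>_. P)). \<forall>k\<in>K. x k \<in> B k}"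
      have C: "C \<in> sets (Pi\<^sub>M UNIV (\<lambda>_. P))"
        unfolding C_def using K B by (intro sets.sets_Collect_finite_All measurable_sets_Collect[OF measurable_component_singleton]) auto
      have "(\<Inter>k\<in>K. A (Some k)) = (\<lambda>\<omega> j. X j \<omega>) -` C \<inter> space M"
        using B False measurable_space[OF sample_meas] by (auto simp: C_def space_PiM)
      moreover have "A None \<in> init_events" using A \<open>None \<in> J\<close> by force
      ultimately have "prob (A None \<inter> (\<Inter>k\<in>K. A (Some k))) = prob (A None) * prob (\<Inter>k\<in>K. A (Some k))"
        using init_indep C unfolding indep_sets2_eq init_events_def by blast
      then show ?thesis unfolding JK using prod_K[OF False] K by (simp add: prod.reindex image_image)
    qed
  qed
qed

lemma Int_stable_events: "Int_stable init_events" "Int_stable (sample_events j)"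
proof -
  have "Int_stable {Y -` A \<inter> space M |A. A \<in> sets K}" for Y :: "'o \<Rightarrow> 'z" and K
  proof (rule Int_stableI)
    fix a b assume "a \<in> {Y -` A \<inter> space M |A. A \<in> sets K}" "b \<in> {Y -` A \<inter> space M |A. A \<in> sets K}"
    then obtain A B where "a = Y -` A \<inter> space M" "b = Y -` B \<inter> space M" "A \<in> sets K" "B \<in> sets K" by auto
    then show "a \<inter> b \<in> {Y -` A \<inter> space M |A. A \<in> sets K}"
      by (intro CollectI exI[of _ "A \<inter> B"]) auto
  qed
  note * = this
  show "Int_stable init_events" "Int_stable (sample_events j)"
    unfolding init_events_def sample_events_def by (rule *)+
qed

lemma history_indep_fresh_sample:
  assumes "j \<notin> A"
  shows "indep_set (sets (history A)) (sample_events j)"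
proof -
  let ?E = "case_option init_events sample_events"
  let ?I = "case_bool (insert None (Some ` A)) {Some j}"
  have "indep_sets (\<lambda>b. sigma_sets (space M) (\<Union>k\<in>?I b. ?E k)) UNIV"
  proof (rule indep_sets_collect_sigma)
    show "indep_sets ?E (\<Union>b\<in>UNIV. ?I b)"
      using init_and_samples_indep by (rule indep_sets_mono_index[rotated]) simp
    show "Int_stable (?E k)" if "k \<in> ?I b" for k b
      using Int_stable_events by (cases k) auto
    show "disjoint_family_on ?I UNIV"
      using assms by (auto simp: disjoint_family_on_def split: bool.splits)
  qed
  then have "indep_set (sigma_sets (space M) (\<Union>k\<in>?I True. ?E k)) (sigma_sets (space M) (\<Union>k\<in>?I False. ?E k))"
    unfolding indep_set_def by (rule indep_sets_cong[THEN iffD1, rotated -1]) (auto split: bool.splits)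
  then have "indep_set (sets (history A)) (sigma_sets (space M) (sample_events j))"
    by (simp add: sets_history)
  then show ?thesis unfolding indep_sets2_eq by auto
qed

text \<open>Conditioning on the past without conditional expectations: a sample that has not been seen may be
  replaced by an integration variable. The past enters as the identity map into the smaller
  \<open>\<sigma>\<close>-algebra, so that \<open>H\<close> may depend on it through any past-measurable quantities.\<close>

lemma nn_integral_fresh_sample:
  assumes "j \<notin> A" and H: "H \<in> borel_measurable (history A \<Otimes>\<^sub>M P)"
  shows "(\<integral>\<^sup>+\<omega>. H (\<omega>, X j \<omega>) \<partial>M) = (\<integral>\<^sup>+\<omega>. (\<integral>\<^sup>+\<xi>. H (\<omega>, \<xi>) \<partial>P) \<partial>M)"
proof -
  have id: "(\<lambda>\<omega>. \<omega>) \<in> measurable M (history A)"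
    using measurable_history[OF measurable_ident] by (simp add: id_def)
  have "(\<integral>\<^sup>+\<omega>. H (\<omega>, X j \<omega>) \<partial>M) = (\<integral>\<^sup>+\<omega>. (\<integral>\<^sup>+\<omega>'. H (\<omega>, X j \<omega>') \<partial>M) \<partial>M)"
  proof (rule nn_integral_indep_pair[OF id sample_meas _ H])
    have "{(\<lambda>\<omega>. \<omega>) -` B \<inter> space M |B. B \<in> sets (history A)} = sets (history A)"
    proof -
      have "B \<inter> space M = B" if "B \<in> sets (history A)" for B
        using sets.Int_space_eq2[OF that] by simp
      then show ?thesis by (auto intro!: exI)
    qed
    then show "indep_set {(\<lambda>\<omega>. \<omega>) -` B \<inter> space M |B. B \<in> sets (history A)} {X j -` B \<inter> space M |B. B \<in> sets P}"
      using history_indep_fresh_sample[OF assms(1)] by (simp add: sample_events_def)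
  qed
  also have "\<dots> = (\<integral>\<^sup>+\<omega>. (\<integral>\<^sup>+\<xi>. H (\<omega>, \<xi>) \<partial>P) \<partial>M)"
  proof (rule nn_integral_cong)
    fix \<omega> assume "\<omega> \<in> space M"
    then have "(\<lambda>\<xi>. H (\<omega>, \<xi>)) \<in> borel_measurable P"
      using H by (intro measurable_compose[OF measurable_Pair1']) auto
    then have "(\<integral>\<^sup>+\<omega>'. H (\<omega>, X j \<omega>') \<partial>M) = (\<integral>\<^sup>+\<xi>. H (\<omega>, \<xi>) \<partial>distr M P (X j))"
      by (subst nn_integral_distr[OF sample_meas]) auto
    then show "(\<integral>\<^sup>+\<omega>'. H (\<omega>, X j \<omega>') \<partial>M) = (\<integral>\<^sup>+\<xi>. H (\<omega>, \<xi>) \<partial>P)"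
      by (simp add: sample_distr)
  qed
  finally show ?thesis .
qed

end

section \<open>Mini-batches along the trajectory\<close>

lemma (in prob_space) nn_integral_norm_square_centered:
  fixes \<phi> :: "'a \<Rightarrow> 'b::euclidean_space"
  assumes int: "integrable M \<phi>" and mean: "(\<integral>x. \<phi> x \<partial>M) = 0"
    and sq: "integrable M (\<lambda>x. (norm (\<phi> x))\<^sup>2)" and le: "(\<integral>x. (norm (\<phi> x))\<^sup>2 \<partial>M) \<le> \<sigma>2"
  shows "(\<integral>\<^sup>+x. ennreal ((norm (y + \<phi> x))\<^sup>2) \<partial>M) \<le> ennreal ((norm y)\<^sup>2 + \<sigma>2)"
proof -
  have expand: "(norm (y + \<phi> x))\<^sup>2 = (norm y)\<^sup>2 + 2 * (\<phi> x \<bullet> y) + (norm (\<phi> x))\<^sup>2" for x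
    by (simp only: power2_norm_eq_inner) (simp add: inner_add inner_commute)
  have "integrable M (\<lambda>x. (norm (y + \<phi> x))\<^sup>2)"
    unfolding expand using int sq by simp
  then have "(\<integral>\<^sup>+x. ennreal ((norm (y + \<phi> x))\<^sup>2) \<partial>M) = ennreal (\<integral>x. (norm (y + \<phi> x))\<^sup>2 \<partial>M)"
    by (intro nn_integral_eq_integral) auto
  also have "(\<integral>x. (norm (y + \<phi> x))\<^sup>2 \<partial>M) = (norm y)\<^sup>2 + (\<integral>x. (norm (\<phi> x))\<^sup>2 \<partial>M)"
    unfolding expand using int sq mean by (simp add: prob_space)
  also have "ennreal ((norm y)\<^sup>2 + (\<integral>x. (norm (\<phi> x))\<^sup>2 \<partial>M)) \<le> ennreal ((norm y)\<^sup>2 + \<sigma>2)"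
    using le by (intro ennreal_leI) simp
  finally show ?thesis .
qed

locale spider_run =
  affine_smooth_oracle P F \<gamma> \<epsilon> \<beta> \<kappa> \<Gamma> \<Lambda> fstar +
  independent_samples M borel w0 P "\<lambda>(t, i) \<omega>. X \<omega> t i"
  for P :: "'s measure" and F :: "'s \<Rightarrow> 'a::euclidean_space \<Rightarrow> real"
    and \<gamma> \<epsilon> \<beta> \<kappa> \<Gamma> \<Lambda> fstar :: real
    and M :: "'o measure" and w0 :: "'o \<Rightarrow> 'a" and X :: "'o \<Rightarrow> nat \<Rightarrow> nat \<Rightarrow> 's" +
  fixes q B B' :: nat
  assumes q_pos: "0 < q"
    and \<Lambda>_pos: "0 < \<Lambda>"
    and large: "large_batch \<Gamma> \<Lambda> \<epsilon> q B" and small: "small_batch \<epsilon> q B'"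
begin

definition w :: "nat \<Rightarrow> 'o \<Rightarrow> 'a" where
  "w t \<omega> = spider_iterate F \<gamma> q B B' (w0 \<omega>) (X \<omega>) t"

definition v :: "nat \<Rightarrow> 'o \<Rightarrow> 'a" where
  "v t \<omega> = snd (spider F \<gamma> q B B' (w0 \<omega>) (X \<omega>) t)"

definition past :: "nat \<Rightarrow> 'o measure" where
  "past t = history {(s, i). s < t}"

lemma space_past [simp]: "space (past t) = space M"
  by (simp add: past_def)

lemma past_mono: "Y \<in> measurable (past s) K \<Longrightarrow> s \<le> t \<Longrightarrow> Y \<in> measurable (past t) K"
  unfolding past_def by (rule measurable_history_mono) auto

lemma past_measurable: "Y \<in> measurable (past t) K \<Longrightarrow> Y \<in> measurable M K"
  unfolding past_def by (rule measurable_history)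

lemma w_0: "w 0 \<omega> = w0 \<omega>"
  by (simp add: w_def spider_iterate_def)

lemma w_Suc: "w (Suc t) \<omega> = w t \<omega> - \<gamma> *\<^sub>R sgn (v t \<omega>)"
  by (simp add: w_def v_def spider_iterate_def Let_def case_prod_beta)

lemma v_restart: "t mod q = 0 \<Longrightarrow> v t \<omega> = batch_grad F B (X \<omega> t) (w t \<omega>)"
  by (cases t) (simp_all add: v_def w_def spider_iterate_def Let_def case_prod_beta batch_size_def)

lemma v_update:
  "Suc t mod q \<noteq> 0 \<Longrightarrow> v (Suc t) \<omega> = v t \<omega> + batch_grad F B' (X \<omega> (Suc t)) (w (Suc t) \<omega>)
      - batch_grad F B' (X \<omega> (Suc t)) (w t \<omega>)"
  by (simp add: v_def w_def spider_iterate_def Let_def case_prod_beta batch_size_def)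

lemma sample_grad_measurable:
  assumes "Y \<in> borel_measurable K" "Z \<in> measurable K P"
  shows "(\<lambda>\<omega>. grad (F (Z \<omega>)) (Y \<omega>)) \<in> borel_measurable K"
proof -
  have "(\<lambda>\<omega>. (Z \<omega>, Y \<omega>)) \<in> measurable K (P \<Otimes>\<^sub>M borel)" using assms by simp
  from measurable_compose[OF this grad_joint_measurable] show ?thesis by simp
qed

lemma batch_grad_measurable:
  assumes "Y \<in> borel_measurable (past (Suc t))"
  shows "(\<lambda>\<omega>. batch_grad F b (X \<omega> t) (Y \<omega>)) \<in> borel_measurable (past (Suc t))"
proof -
  have "(\<lambda>\<omega>. X \<omega> t i) \<in> measurable (past (Suc t)) P" for i
    using sample_history_measurable[of "(t, i)" "{(s, i). s < Suc t}"] by (simp add: past_def)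
  from sample_grad_measurable[OF assms this] show ?thesis
    unfolding batch_grad_def by (intro borel_measurable_scaleR borel_measurable_sum) auto
qed

text \<open>The iterate \<open>w t\<close> depends on the batches before time \<open>t\<close> only, while \<open>v t\<close> also uses the batch of time \<open>t\<close>.
  This shift by one makes the error budgets below predictable.\<close>

lemma w_v_measurable: "w t \<in> borel_measurable (past t) \<and> v t \<in> borel_measurable (past (Suc t))"
proof (induction t)
  case 0
  have w: "w 0 \<in> borel_measurable (past 0)"
    using init_history_measurable unfolding w_0[abs_def] past_def by simp
  have "v 0 \<in> borel_measurable (past (Suc 0))"
    using batch_grad_measurable[of "w 0" 0 B] past_mono[OF w, of "Suc 0"]
    by (subst measurable_cong[OF v_restart]) auto
  with w show ?case by (rule conjI)
next
  case (Suc t)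
  then have [measurable]: "w t \<in> borel_measurable (past (Suc t))" "v t \<in> borel_measurable (past (Suc t))"
    by (auto intro: past_mono[of "w t" t])
  have w: "w (Suc t) \<in> borel_measurable (past (Suc t))"
    unfolding w_Suc[abs_def] sgn_div_norm by measurable
  have w': "w (Suc t) \<in> borel_measurable (past (Suc (Suc t)))"
    "w t \<in> borel_measurable (past (Suc (Suc t)))" "v t \<in> borel_measurable (past (Suc (Suc t)))"
    by (rule past_mono[OF w] past_mono[of "w t" "Suc t"] past_mono[of "v t" "Suc t"]; simp)+
  have "v (Suc t) \<in> borel_measurable (past (Suc (Suc t)))"
  proof (cases "Suc t mod q = 0")
    case True
    show ?thesis
      using batch_grad_measurable[OF w'(1), of B] by (subst measurable_cong[OF v_restart[OF True]])
  next
    case False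
    show ?thesis
      using batch_grad_measurable[OF w'(1), of B'] batch_grad_measurable[OF w'(2), of B'] w'(3)
      by (subst measurable_cong[OF v_update[OF False]]) auto
  qed
  with w show ?case by (rule conjI)
qed

lemmas w_measurable = w_v_measurable[THEN conjunct1]
lemmas v_measurable = w_v_measurable[THEN conjunct2]

text \<open>Averaging \<open>b\<close> fresh centered samples divides the conditional variance by \<open>b\<close>. The samples are added one at a time, each being
  independent of the past and of the part of the batch already drawn. The weight
  \<open>Z\<close> plays the part of a conditioning, and extended nonnegative integrals
  allow infinite second moments.\<close>

lemma minibatch_mean_square:
  fixes \<phi> :: "'o \<Rightarrow> 's \<Rightarrow> 'a"
  assumes Z: "Z \<in> borel_measurable (past t)" and u: "u \<in> borel_measurable (past t)"
    and \<sigma>: "\<sigma>2 \<in> borel_measurable (past t)"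
    and \<phi>: "(\<lambda>(\<omega>, \<xi>). \<phi> \<omega> \<xi>) \<in> borel_measurable (past t \<Otimes>\<^sub>M P)"
    and int: "\<And>\<omega>. \<omega> \<in> space M \<Longrightarrow> integrable P (\<phi> \<omega>)"
    and mean: "\<And>\<omega>. \<omega> \<in> space M \<Longrightarrow> (\<integral>\<xi>. \<phi> \<omega> \<xi> \<partial>P) = 0"
    and sq: "\<And>\<omega>. \<omega> \<in> space M \<Longrightarrow> integrable P (\<lambda>\<xi>. (norm (\<phi> \<omega> \<xi>))\<^sup>2)"
    and var: "\<And>\<omega>. \<omega> \<in> space M \<Longrightarrow> (\<integral>\<xi>. (norm (\<phi> \<omega> \<xi>))\<^sup>2 \<partial>P) \<le> \<sigma>2 \<omega>"
    and b: "0 < b"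
  shows "(\<integral>\<^sup>+\<omega>. Z \<omega> * ennreal ((norm (u \<omega> + (1 / real b) *\<^sub>R (\<Sum>i<b. \<phi> \<omega> (X \<omega> t i))))\<^sup>2) \<partial>M)
    \<le> (\<integral>\<^sup>+\<omega>. Z \<omega> * ennreal ((norm (u \<omega>))\<^sup>2 + \<sigma>2 \<omega> / real b) \<partial>M)"
proof -
  define A where "A k = {(s, i). s < t} \<union> {(s, i). s = t \<and> i < k}" for k :: nat
  define S where "S k \<omega> = real b *\<^sub>R u \<omega> + (\<Sum>i<k. \<phi> \<omega> (X \<omega> t i))" for k \<omega>
  define Z' where "Z' \<omega> = Z \<omega> * ennreal (1 / (real b)\<^sup>2)" for \<omega>
  have Z': "Z' \<in> borel_measurable (past t)" using Z unfolding Z'_def by measurable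
  have \<sigma>_nonneg: "0 \<le> \<sigma>2 \<omega>" if "\<omega> \<in> space M" for \<omega>
    using var[OF that] by (rule order_trans[rotated]) (intro integral_nonneg_AE, auto)
  have lift: "Y \<in> measurable (history (A k)) K" if "Y \<in> measurable (past t) K" for Y :: "'o \<Rightarrow> 'z" and K k
    using that unfolding past_def A_def by (rule measurable_history_mono) auto
  have id: "(\<lambda>\<omega>. \<omega>) \<in> measurable (history (A k)) (past t)" for k
    by (rule lift) simp
  have S: "S k \<in> borel_measurable (history (A k))" for k
  proof -
    have "(\<lambda>\<omega>. \<phi> \<omega> (X \<omega> t i)) \<in> borel_measurable (history (A k))" if "i < k" for i
    proof -
      have "(\<lambda>\<omega>. X \<omega> t i) \<in> measurable (history (A k)) P"
        using sample_history_measurable[of "(t, i)" "A k"] that by (simp add: A_def)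
      then have "(\<lambda>\<omega>. (\<omega>, X \<omega> t i)) \<in> measurable (history (A k)) (past t \<Otimes>\<^sub>M P)"
        using id by (intro measurable_Pair) auto
      from measurable_compose[OF this \<phi>] show ?thesis by simp
    qed
    then show ?thesis unfolding S_def[abs_def]
      using lift[OF u] by (intro borel_measurable_add borel_measurable_scaleR borel_measurable_sum) auto
  qed
  have meas_M: "Z' \<in> borel_measurable M" "u \<in> borel_measurable M" "\<sigma>2 \<in> borel_measurable M" "S k \<in> borel_measurable M" for k
    using Z' u \<sigma> S by (auto intro: past_measurable measurable_history)
  have "(\<integral>\<^sup>+\<omega>. Z' \<omega> * ennreal ((norm (S k \<omega>))\<^sup>2) \<partial>M)
      \<le> (\<integral>\<^sup>+\<omega>. Z' \<omega> * ennreal ((norm (real b *\<^sub>R u \<omega>))\<^sup>2 + real k * \<sigma>2 \<omega>) \<partial>M)" for k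
  proof (induction k)
    case 0
    then show ?case by (simp add: S_def)
  next
    case (Suc k)
    define H where "H = (\<lambda>(\<omega>, \<xi>). Z' \<omega> * ennreal ((norm (S k \<omega> + \<phi> \<omega> \<xi>))\<^sup>2))"
    have H: "H \<in> borel_measurable (history (A k) \<Otimes>\<^sub>M P)"
    proof -
      have "(\<lambda>x. (fst x, snd x)) \<in> measurable (history (A k) \<Otimes>\<^sub>M P) (past t \<Otimes>\<^sub>M P)"
        using measurable_compose[OF measurable_fst id] by (intro measurable_Pair) auto
      from measurable_compose[OF this \<phi>]
      have [measurable]: "(\<lambda>x. \<phi> (fst x) (snd x)) \<in> borel_measurable (history (A k) \<Otimes>\<^sub>M P)" by simp
      have [measurable]: "(\<lambda>x. S k (fst x)) \<in> borel_measurable (history (A k) \<Otimes>\<^sub>M P)"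
        "(\<lambda>x. Z' (fst x)) \<in> borel_measurable (history (A k) \<Otimes>\<^sub>M P)"
        using measurable_compose[OF measurable_fst S] measurable_compose[OF measurable_fst lift[OF Z']] by auto
      have "(\<lambda>x. Z' (fst x) * ennreal ((norm (S k (fst x) + \<phi> (fst x) (snd x)))\<^sup>2))
          \<in> borel_measurable (history (A k) \<Otimes>\<^sub>M P)"
        by measurable
      then show ?thesis by (simp add: H_def split_beta')
    qed
    have "(\<integral>\<^sup>+\<omega>. Z' \<omega> * ennreal ((norm (S (Suc k) \<omega>))\<^sup>2) \<partial>M) = (\<integral>\<^sup>+\<omega>. H (\<omega>, X \<omega> t k) \<partial>M)"
      by (simp add: H_def S_def add.assoc)
    also have "\<dots> = (\<integral>\<^sup>+\<omega>. (\<integral>\<^sup>+\<xi>. H (\<omega>, \<xi>) \<partial>P) \<partial>M)"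
      using nn_integral_fresh_sample[OF _ H, of "(t, k)"] by (simp add: A_def)
    also have "\<dots> \<le> (\<integral>\<^sup>+\<omega>. Z' \<omega> * ennreal ((norm (S k \<omega>))\<^sup>2 + \<sigma>2 \<omega>) \<partial>M)"
    proof (rule nn_integral_mono)
      fix \<omega> assume \<omega>: "\<omega> \<in> space M"
      have "(\<lambda>\<xi>. \<phi> \<omega> \<xi>) \<in> borel_measurable P" using int[OF \<omega>] by auto
      then have "(\<integral>\<^sup>+\<xi>. H (\<omega>, \<xi>) \<partial>P) = Z' \<omega> * (\<integral>\<^sup>+\<xi>. ennreal ((norm (S k \<omega> + \<phi> \<omega> \<xi>))\<^sup>2) \<partial>P)"
        unfolding H_def by (simp add: nn_integral_cmult)
      also have "\<dots> \<le> Z' \<omega> * ennreal ((norm (S k \<omega>))\<^sup>2 + \<sigma>2 \<omega>)"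
        by (intro mult_left_mono sampling.nn_integral_norm_square_centered int mean sq var \<omega>) auto
      finally show "(\<integral>\<^sup>+\<xi>. H (\<omega>, \<xi>) \<partial>P) \<le> Z' \<omega> * ennreal ((norm (S k \<omega>))\<^sup>2 + \<sigma>2 \<omega>)" .
    qed
    also have "\<dots> = (\<integral>\<^sup>+\<omega>. Z' \<omega> * ennreal ((norm (S k \<omega>))\<^sup>2) + Z' \<omega> * ennreal (\<sigma>2 \<omega>) \<partial>M)"
      by (intro nn_integral_cong) (simp add: ennreal_plus \<sigma>_nonneg distrib_left)
    also have "\<dots> = (\<integral>\<^sup>+\<omega>. Z' \<omega> * ennreal ((norm (S k \<omega>))\<^sup>2) \<partial>M) + (\<integral>\<^sup>+\<omega>. Z' \<omega> * ennreal (\<sigma>2 \<omega>) \<partial>M)"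
      by (intro nn_integral_add) (use meas_M(1,2,3) meas_M(4)[of k] in \<open>simp_all\<close>)
    also have "\<dots> \<le> (\<integral>\<^sup>+\<omega>. Z' \<omega> * ennreal ((norm (real b *\<^sub>R u \<omega>))\<^sup>2 + real k * \<sigma>2 \<omega>) \<partial>M)
        + (\<integral>\<^sup>+\<omega>. Z' \<omega> * ennreal (\<sigma>2 \<omega>) \<partial>M)"
      by (intro add_right_mono Suc)
    also have "\<dots> = (\<integral>\<^sup>+\<omega>. Z' \<omega> * ennreal ((norm (real b *\<^sub>R u \<omega>))\<^sup>2 + real k * \<sigma>2 \<omega>) + Z' \<omega> * ennreal (\<sigma>2 \<omega>) \<partial>M)"
      by (intro nn_integral_add[symmetric]) (use meas_M(1,2,3) meas_M(4)[of k] in \<open>simp_all\<close>)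
    also have "\<dots> = (\<integral>\<^sup>+\<omega>. Z' \<omega> * ennreal ((norm (real b *\<^sub>R u \<omega>))\<^sup>2 + real (Suc k) * \<sigma>2 \<omega>) \<partial>M)"
      by (intro nn_integral_cong)
        (simp add: \<sigma>_nonneg algebra_simps flip: ennreal_plus distrib_left)
    finally show ?case .
  qed
  note induct = this[of b]
  have "(\<integral>\<^sup>+\<omega>. Z \<omega> * ennreal ((norm (u \<omega> + (1 / real b) *\<^sub>R (\<Sum>i<b. \<phi> \<omega> (X \<omega> t i))))\<^sup>2) \<partial>M)
      = (\<integral>\<^sup>+\<omega>. Z' \<omega> * ennreal ((norm (S b \<omega>))\<^sup>2) \<partial>M)"
  proof (intro nn_integral_cong)
    fix \<omega>
    have "S b \<omega> = real b *\<^sub>R (u \<omega> + (1 / real b) *\<^sub>R (\<Sum>i<b. \<phi> \<omega> (X \<omega> t i)))"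
      using b by (simp add: S_def scaleR_add_right)
    then have "(norm (u \<omega> + (1 / real b) *\<^sub>R (\<Sum>i<b. \<phi> \<omega> (X \<omega> t i))))\<^sup>2 = 1 / (real b)\<^sup>2 * (norm (S b \<omega>))\<^sup>2"
      using b by (simp add: power_mult_distrib)
    then show "Z \<omega> * ennreal ((norm (u \<omega> + (1 / real b) *\<^sub>R (\<Sum>i<b. \<phi> \<omega> (X \<omega> t i))))\<^sup>2) = Z' \<omega> * ennreal ((norm (S b \<omega>))\<^sup>2)"
      unfolding Z'_def by (simp only: ennreal_mult'' zero_le_power2 mult.assoc)
  qed
  also note induct
  also have "(\<integral>\<^sup>+\<omega>. Z' \<omega> * ennreal ((norm (real b *\<^sub>R u \<omega>))\<^sup>2 + real b * \<sigma>2 \<omega>) \<partial>M)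
      = (\<integral>\<^sup>+\<omega>. Z \<omega> * ennreal ((norm (u \<omega>))\<^sup>2 + \<sigma>2 \<omega> / real b) \<partial>M)"
  proof (intro nn_integral_cong)
    fix \<omega> assume "\<omega> \<in> space M"
    have "1 / (real b)\<^sup>2 * ((norm (real b *\<^sub>R u \<omega>))\<^sup>2 + real b * \<sigma>2 \<omega>) = (norm (u \<omega>))\<^sup>2 + \<sigma>2 \<omega> / real b"
      using b by (simp add: power_mult_distrib field_simps power2_eq_square)
    moreover have "0 \<le> (norm (real b *\<^sub>R u \<omega>))\<^sup>2 + real b * \<sigma>2 \<omega>" using \<sigma>_nonneg[OF \<open>\<omega> \<in> space M\<close>] by simp
    ultimately show "Z' \<omega> * ennreal ((norm (real b *\<^sub>R u \<omega>))\<^sup>2 + real b * \<sigma>2 \<omega>)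
        = Z \<omega> * ennreal ((norm (u \<omega>))\<^sup>2 + \<sigma>2 \<omega> / real b)"
      unfolding Z'_def by (metis ennreal_mult'' mult.assoc)
  qed
  finally show ?thesis .
qed

end

section \<open>The gradient estimation error\<close>

text \<open>Each square is accompanied by the product of neighbouring terms in the square of the sum, and these
  products are at least three quarters of the square, up to the drift \<open>b\<close>. So the square of the sum contains the sum
  of squares at least two and a half times, and \<open>sqrt (2 / 5) \<le> 16 / 25\<close>.\<close>

lemma sum_squares_le_of_slow_variation:
  fixes g :: "nat \<Rightarrow> real"
  assumes nonneg: "\<And>k. 0 \<le> g k" and b: "0 \<le> b"
    and slow: "\<And>k. 3 / 4 * g k - b \<le> g (Suc k)"
    and "s \<le> t"
  shows "(\<Sum>k\<in>{s..<t}. (g k)\<^sup>2) \<le> (16 / 25 * ((\<Sum>k\<in>{s..t}. g k) + b))\<^sup>2"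
proof -
  \<comment> \<open>The last square, not yet paired with a successor, is carried along so that the induction closes.\<close>
  have strong: "5 / 2 * (\<Sum>k\<in>{s..<t}. (g k)\<^sup>2) - 2 * b * (\<Sum>k\<in>{s..<t}. g k) + (g t)\<^sup>2 \<le> (\<Sum>k\<in>{s..t}. g k)\<^sup>2"
    using \<open>s \<le> t\<close>
  proof (induction t rule: dec_induct)
    case base
    then show ?case by simp
  next
    case (step t)
    define S where "S = (\<Sum>k\<in>{s..t}. g k)"
    have "g t \<le> S" unfolding S_def using step.hyps nonneg by (intro member_le_sum) auto
    then have "g t * g (Suc t) \<le> S * g (Suc t)" using nonneg by (intro mult_right_mono)
    moreover have "g t * (3 / 4 * g t - b) \<le> g t * g (Suc t)" using slow nonneg by (intro mult_left_mono)
    ultimately have "3 / 2 * (g t)\<^sup>2 - 2 * b * g t \<le> 2 * S * g (Suc t)"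
      by (simp add: power2_eq_square algebra_simps)
    moreover have "(\<Sum>k\<in>{s..Suc t}. g k)\<^sup>2 = S\<^sup>2 + 2 * S * g (Suc t) + (g (Suc t))\<^sup>2"
      using step.hyps by (simp add: S_def power2_sum)
    ultimately show ?case
      using step.IH step.hyps by (simp add: S_def[symmetric] algebra_simps)
  qed
  define S where "S = (\<Sum>k\<in>{s..t}. g k)"
  have "(\<Sum>k\<in>{s..<t}. g k) \<le> S" unfolding S_def using nonneg by (intro sum_mono2) auto
  then have "2 * b * (\<Sum>k\<in>{s..<t}. g k) \<le> 2 * b * S" using b by (intro mult_left_mono) auto
  then have "5 / 2 * (\<Sum>k\<in>{s..<t}. (g k)\<^sup>2) \<le> S\<^sup>2 + 2 * b * S"
    using strong zero_le_power2[of "g t"] unfolding S_def by linarith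
  also have "\<dots> \<le> (S + b)\<^sup>2" by (simp add: power2_sum)
  finally have "(\<Sum>k\<in>{s..<t}. (g k)\<^sup>2) \<le> 2 / 5 * (S + b)\<^sup>2" by simp
  also have "\<dots> \<le> (16 / 25)\<^sup>2 * (S + b)\<^sup>2" by (intro mult_right_mono) (auto simp: power2_eq_square)
  finally show ?thesis unfolding S_def power_mult_distrib .
qed

context spider_run
begin

definition err :: "nat \<Rightarrow> 'o \<Rightarrow> 'a" where
  "err t \<omega> = v t \<omega> - grad f (w t \<omega>)"

definition gn :: "nat \<Rightarrow> 'o \<Rightarrow> real" where
  "gn t \<omega> = norm (grad f (w t \<omega>))"

definition epoch_start :: "nat \<Rightarrow> nat" where
  "epoch_start t = t - t mod q"

text \<open>A bound of the conditional variance that the error has accumulated since the start of the epoch. It depends on the batches before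
  time \<open>t\<close> only and is positive because of the summand \<open>\<epsilon>\<^sup>2\<close>.\<close>

definition budget :: "nat \<Rightarrow> 'o \<Rightarrow> real" where
  "budget t \<omega> = ((gn (epoch_start t) \<omega> / real q)\<^sup>2 + \<epsilon>\<^sup>2) / 10000
     + (\<Sum>k\<in>{epoch_start t..<t}. (\<epsilon> * modulus (w k \<omega>))\<^sup>2 / real B')"

lemma modulus_w: "modulus (w t \<omega>) = \<beta> + \<kappa> * gn t \<omega>"
  by (simp add: modulus_def gn_def)

lemma epoch_start_le: "epoch_start t \<le> t"
  by (simp add: epoch_start_def)

lemma epoch_start_Suc: "Suc t mod q \<noteq> 0 \<Longrightarrow> epoch_start (Suc t) = epoch_start t"
  using mod_Suc[of t q] by (auto simp: epoch_start_def split: if_splits)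

lemma B_pos: "0 < B" "0 < B'"
proof -
  have "0 < \<Lambda>\<^sup>2 / \<epsilon>\<^sup>2" using \<Lambda>_pos \<epsilon> by simp
  then have "0 < real B" using large unfolding large_batch_def by linarith
  then show "0 < B" by simp
  have "0 < real B'" using small q_pos unfolding small_batch_def by linarith
  then show "0 < B'" by simp
qed

lemma restart_variance_le: "(\<Gamma>\<^sup>2 * g\<^sup>2 + \<Lambda>\<^sup>2) / real B \<le> ((g / real q)\<^sup>2 + \<epsilon>\<^sup>2) / 10000"
proof -
  have "10000 * (\<Lambda>\<^sup>2 / \<epsilon>\<^sup>2) \<le> real B" "10000 * (\<Gamma>\<^sup>2 * (real q)\<^sup>2) \<le> real B"
    using large unfolding large_batch_def by linarith+
  then have "\<Lambda>\<^sup>2 \<le> \<epsilon>\<^sup>2 / 10000 * real B" "\<Gamma>\<^sup>2 \<le> 1 / (real q)\<^sup>2 / 10000 * real B"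
    using \<epsilon> q_pos by (simp_all add: field_simps)
  then have "\<Gamma>\<^sup>2 * g\<^sup>2 + \<Lambda>\<^sup>2 \<le> 1 / (real q)\<^sup>2 / 10000 * real B * g\<^sup>2 + \<epsilon>\<^sup>2 / 10000 * real B"
    by (intro add_mono mult_right_mono) auto
  also have "\<dots> = ((g / real q)\<^sup>2 + \<epsilon>\<^sup>2) / 10000 * real B"
    by (simp add: power_divide algebra_simps)
  finally show ?thesis using B_pos by (simp add: pos_divide_le_eq)
qed

lemma budget_pos: "0 < budget t \<omega>"
  unfolding budget_def using \<epsilon>
  by (intro add_pos_nonneg sum_nonneg divide_pos_pos add_nonneg_pos) auto

lemma budget_restart: "t mod q = 0 \<Longrightarrow> budget t \<omega> = ((gn t \<omega> / real q)\<^sup>2 + \<epsilon>\<^sup>2) / 10000"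
  by (simp add: budget_def epoch_start_def)

lemma budget_update:
  assumes "Suc t mod q \<noteq> 0"
  shows "budget (Suc t) \<omega> = budget t \<omega> + (\<epsilon> * modulus (w t \<omega>))\<^sup>2 / real B'"
  unfolding budget_def epoch_start_Suc[OF assms] sum.atLeastLessThan_Suc[OF epoch_start_le] by simp

lemma gn_measurable: "gn t \<in> borel_measurable (past t)"
  using w_measurable[of t] unfolding gn_def[abs_def] by measurable

lemma modulus_measurable: "(\<lambda>\<omega>. modulus (w t \<omega>)) \<in> borel_measurable (past t)"
  using gn_measurable[of t] unfolding modulus_w by measurable

lemma err_measurable: "err t \<in> borel_measurable (past (Suc t))"
  using v_measurable[of t] past_mono[OF w_measurable[of t], of "Suc t"] unfolding err_def[abs_def] by simp

lemma budget_measurable: "budget t \<in> borel_measurable (past t)"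
proof -
  have "gn (epoch_start t) \<in> borel_measurable (past t)"
    by (rule past_mono[OF gn_measurable epoch_start_le])
  moreover have "(\<lambda>\<omega>. modulus (w k \<omega>)) \<in> borel_measurable (past t)" if "k \<in> {epoch_start t..<t}" for k
    using that by (intro past_mono[OF modulus_measurable]) auto
  ultimately show ?thesis
    unfolding budget_def[abs_def] by (intro borel_measurable_add borel_measurable_sum borel_measurable_divide
      borel_measurable_power borel_measurable_times borel_measurable_const) auto
qed

lemma grad_pair_measurable:
  assumes "Y \<in> borel_measurable (past t)"
  shows "(\<lambda>x. grad (F (snd x)) (Y (fst x))) \<in> borel_measurable (past t \<Otimes>\<^sub>M P)"
  by (rule sample_grad_measurable[OF measurable_compose[OF measurable_fst assms] measurable_snd])

lemma grad_f_pair_measurable: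
  assumes "Y \<in> borel_measurable (past t)"
  shows "(\<lambda>x. grad f (Y (fst x))) \<in> borel_measurable (past t \<Otimes>\<^sub>M P)"
  by (rule measurable_compose[OF measurable_compose[OF measurable_fst assms] grad_f_measurable])

lemma ennreal_divide_sqrt_budget:
  "0 \<le> x \<Longrightarrow> ennreal (x / sqrt (budget t \<omega>)) = ennreal (1 / sqrt (budget t \<omega>)) * ennreal x"
  using budget_pos[of t \<omega>] by (subst ennreal_mult[symmetric]) auto

lemma err_restart:
  assumes t: "t mod q = 0" and Z: "Z \<in> borel_measurable (past t)"
  shows "(\<integral>\<^sup>+\<omega>. Z \<omega> * ennreal ((norm (err t \<omega>))\<^sup>2) \<partial>M) \<le> (\<integral>\<^sup>+\<omega>. Z \<omega> * ennreal (budget t \<omega>) \<partial>M)"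
proof -
  define \<phi> where "\<phi> \<omega> \<xi> = grad (F \<xi>) (w t \<omega>) - grad f (w t \<omega>)" for \<omega> \<xi>
  define \<sigma>2 where "\<sigma>2 \<omega> = \<Gamma>\<^sup>2 * (gn t \<omega>)\<^sup>2 + \<Lambda>\<^sup>2" for \<omega>
  note [measurable] = w_measurable[of t] gn_measurable[of t]
  have \<phi>: "(\<lambda>(\<omega>, \<xi>). \<phi> \<omega> \<xi>) \<in> borel_measurable (past t \<Otimes>\<^sub>M P)"
  proof -
    have "(\<lambda>x. grad (F (snd x)) (w t (fst x)) - grad f (w t (fst x))) \<in> borel_measurable (past t \<Otimes>\<^sub>M P)"
      by (intro borel_measurable_diff grad_pair_measurable grad_f_pair_measurable w_measurable)
    then show ?thesis by (simp add: \<phi>_def split_beta')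
  qed
  have err: "err t \<omega> = 0 + (1 / real B) *\<^sub>R (\<Sum>i<B. \<phi> \<omega> (X \<omega> t i))" for \<omega>
    using B_pos by (simp add: err_def v_restart[OF t] batch_grad_def \<phi>_def sum_subtractf scaleR_diff_right
      sum_constant_scaleR)
  have "(\<integral>\<^sup>+\<omega>. Z \<omega> * ennreal ((norm (err t \<omega>))\<^sup>2) \<partial>M)
      \<le> (\<integral>\<^sup>+\<omega>. Z \<omega> * ennreal ((norm (0::'a))\<^sup>2 + \<sigma>2 \<omega> / real B) \<partial>M)"
    unfolding err
  proof (rule minibatch_mean_square[OF Z _ _ \<phi>])
    show "\<sigma>2 \<in> borel_measurable (past t)" unfolding \<sigma>2_def[abs_def] by measurable
    show "integrable P (\<phi> \<omega>)" "(\<integral>\<xi>. \<phi> \<omega> \<xi> \<partial>P) = 0" for \<omega>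
      using grad_integrable grad_mean by (simp_all add: \<phi>_def[abs_def] sampling.prob_space)
    show "integrable P (\<lambda>\<xi>. (norm (\<phi> \<omega> \<xi>))\<^sup>2)" "(\<integral>\<xi>. (norm (\<phi> \<omega> \<xi>))\<^sup>2 \<partial>P) \<le> \<sigma>2 \<omega>" for \<omega>
      using noise by (simp_all add: gradient_variance_bound_def \<phi>_def \<sigma>2_def gn_def)
  qed (use B_pos in simp_all)
  also have "\<dots> \<le> (\<integral>\<^sup>+\<omega>. Z \<omega> * ennreal (budget t \<omega>) \<partial>M)"
    using restart_variance_le
    by (intro nn_integral_mono mult_left_mono ennreal_leI) (auto simp: budget_restart[OF t] \<sigma>2_def)
  finally show ?thesis .
qed

lemma err_update:
  assumes t: "Suc t mod q \<noteq> 0" and Z: "Z \<in> borel_measurable (past (Suc t))"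
  shows "(\<integral>\<^sup>+\<omega>. Z \<omega> * ennreal ((norm (err (Suc t) \<omega>))\<^sup>2) \<partial>M)
      \<le> (\<integral>\<^sup>+\<omega>. Z \<omega> * ennreal ((norm (err t \<omega>))\<^sup>2 + (budget (Suc t) \<omega> - budget t \<omega>)) \<partial>M)"
proof -
  let ?w = "w t" and ?w' = "w (Suc t)"
  define \<phi> where "\<phi> \<omega> \<xi> = (grad (F \<xi>) (?w' \<omega>) - grad (F \<xi>) (?w \<omega>)) - (grad f (?w' \<omega>) - grad f (?w \<omega>))" for \<omega> \<xi>
  define \<sigma>2 where "\<sigma>2 \<omega> = (\<epsilon> * modulus (?w \<omega>))\<^sup>2" for \<omega>
  have w: "?w \<in> borel_measurable (past (Suc t))" by (rule past_mono[OF w_measurable]) simp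
  note w' = w_measurable[of "Suc t"]
  note [measurable] = w w' past_mono[OF modulus_measurable[of t], of "Suc t"]
  have \<phi>: "(\<lambda>(\<omega>, \<xi>). \<phi> \<omega> \<xi>) \<in> borel_measurable (past (Suc t) \<Otimes>\<^sub>M P)"
  proof -
    have "(\<lambda>x. (grad (F (snd x)) (?w' (fst x)) - grad (F (snd x)) (?w (fst x)))
        - (grad f (?w' (fst x)) - grad f (?w (fst x)))) \<in> borel_measurable (past (Suc t) \<Otimes>\<^sub>M P)"
      by (intro borel_measurable_diff grad_pair_measurable grad_f_pair_measurable w w')
    then show ?thesis by (simp add: \<phi>_def split_beta')
  qed
  have err: "err (Suc t) \<omega> = err t \<omega> + (1 / real B') *\<^sub>R (\<Sum>i<B'. \<phi> \<omega> (X \<omega> (Suc t) i))" for \<omega>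
    using B_pos by (simp add: err_def v_update[OF t] batch_grad_def \<phi>_def sum_subtractf scaleR_diff_right
      sum_constant_scaleR)
  have near: "norm (?w' \<omega> - ?w \<omega>) \<le> \<gamma>" for \<omega>
    unfolding w_Suc by (rule normalized_step_norm)
  have "(\<integral>\<^sup>+\<omega>. Z \<omega> * ennreal ((norm (err (Suc t) \<omega>))\<^sup>2) \<partial>M)
      \<le> (\<integral>\<^sup>+\<omega>. Z \<omega> * ennreal ((norm (err t \<omega>))\<^sup>2 + \<sigma>2 \<omega> / real B') \<partial>M)"
    unfolding err
  proof (rule minibatch_mean_square[OF Z err_measurable _ \<phi>])
    show "\<sigma>2 \<in> borel_measurable (past (Suc t))" unfolding \<sigma>2_def[abs_def] by measurable
    show "integrable P (\<phi> \<omega>)" "(\<integral>\<xi>. \<phi> \<omega> \<xi> \<partial>P) = 0" for \<omega>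
      using grad_integrable grad_mean by (simp_all add: \<phi>_def[abs_def] sampling.prob_space)
    show "integrable P (\<lambda>\<xi>. (norm (\<phi> \<omega> \<xi>))\<^sup>2)" for \<omega>
      unfolding \<phi>_def by (rule centered_diff_variance(1)[OF near])
    show "(\<integral>\<xi>. (norm (\<phi> \<omega> \<xi>))\<^sup>2 \<partial>P) \<le> \<sigma>2 \<omega>" for \<omega>
    proof -
      have "(\<integral>\<xi>. (norm (\<phi> \<omega> \<xi>))\<^sup>2 \<partial>P) \<le> (norm (?w' \<omega> - ?w \<omega>) / \<gamma> * (\<epsilon> * modulus (?w \<omega>)))\<^sup>2"
        using centered_diff_variance(2)[OF near, of \<omega>] zero_le_power2 unfolding \<phi>_def by (smt (verit))
      also have "\<dots> \<le> \<sigma>2 \<omega>" unfolding \<sigma>2_def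
      proof (rule power_mono)
        have "norm (?w' \<omega> - ?w \<omega>) / \<gamma> \<le> 1" using near \<gamma>_pos by (simp add: divide_le_eq_1)
        then show "norm (?w' \<omega> - ?w \<omega>) / \<gamma> * (\<epsilon> * modulus (?w \<omega>)) \<le> \<epsilon> * modulus (?w \<omega>)"
          using \<epsilon> modulus_nonneg \<gamma>_pos by (intro mult_left_le_one_le) auto
      qed (use \<epsilon> modulus_nonneg \<gamma>_pos in auto)
      finally show ?thesis .
    qed
  qed (use B_pos in simp_all)
  also have "\<dots> = (\<integral>\<^sup>+\<omega>. Z \<omega> * ennreal ((norm (err t \<omega>))\<^sup>2 + (budget (Suc t) \<omega> - budget t \<omega>)) \<partial>M)"
    by (simp add: budget_update[OF t] \<sigma>2_def)
  finally show ?thesis .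
qed

lemma weighted_square_err_restart:
  assumes t: "t mod q = 0"
  shows "(\<integral>\<^sup>+\<omega>. ennreal ((norm (err t \<omega>))\<^sup>2 / sqrt (budget t \<omega>)) \<partial>M)
      \<le> (\<integral>\<^sup>+\<omega>. ennreal (2 * sqrt (budget t \<omega>)) \<partial>M)"
proof -
  let ?Z = "\<lambda>\<omega>. ennreal (1 / sqrt (budget t \<omega>))"
  have Z: "?Z \<in> borel_measurable (past t)" using budget_measurable[of t] by measurable
  have "(\<integral>\<^sup>+\<omega>. ennreal ((norm (err t \<omega>))\<^sup>2 / sqrt (budget t \<omega>)) \<partial>M)
      = (\<integral>\<^sup>+\<omega>. ?Z \<omega> * ennreal ((norm (err t \<omega>))\<^sup>2) \<partial>M)"
    by (intro nn_integral_cong ennreal_divide_sqrt_budget) simp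
  also have "\<dots> \<le> (\<integral>\<^sup>+\<omega>. ?Z \<omega> * ennreal (budget t \<omega>) \<partial>M)"
    by (rule err_restart[OF t Z])
  also have "\<dots> \<le> (\<integral>\<^sup>+\<omega>. ennreal (2 * sqrt (budget t \<omega>)) \<partial>M)"
  proof (intro nn_integral_mono)
    fix \<omega>
    have "?Z \<omega> * ennreal (budget t \<omega>) = ennreal (budget t \<omega> / sqrt (budget t \<omega>))"
      using budget_pos[of t \<omega>] by (intro ennreal_divide_sqrt_budget[symmetric]) simp
    also have "\<dots> \<le> ennreal (2 * sqrt (budget t \<omega>))"
      using budget_pos[of t \<omega>] by (intro ennreal_leI) (simp add: real_div_sqrt)
    finally show "?Z \<omega> * ennreal (budget t \<omega>) \<le> ennreal (2 * sqrt (budget t \<omega>))" .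
  qed
  finally show ?thesis .
qed

text \<open>An update adds at most the increment of the budget to the squared error, while division by the larger budget shrinks
  what is there already. The added terms \<open>(b - a) / sqrt b\<close> are at most \<open>2 * (sqrt b - sqrt a)\<close> and telescope. At a
  restart the old error is forgotten.\<close>

lemma weighted_square_err_le:
  "(\<integral>\<^sup>+\<omega>. ennreal ((norm (err t \<omega>))\<^sup>2 / sqrt (budget t \<omega>)) \<partial>M) \<le> (\<integral>\<^sup>+\<omega>. ennreal (2 * sqrt (budget t \<omega>)) \<partial>M)"
proof (induction t)
  case 0
  show ?case by (rule weighted_square_err_restart) simp
next
  case (Suc t)
  let ?a = "budget t" and ?b = "budget (Suc t)"
  let ?Z = "\<lambda>\<omega>. ennreal (1 / sqrt (?b \<omega>))"
  have Z: "?Z \<in> borel_measurable (past (Suc t))" using budget_measurable[of "Suc t"] by measurable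
  note split = ennreal_divide_sqrt_budget[of _ "Suc t"]
  show ?case
  proof (cases "Suc t mod q = 0")
    case True
    then show ?thesis by (rule weighted_square_err_restart)
  next
    case False
    have ab: "?a \<omega> \<le> ?b \<omega>" for \<omega> by (simp add: budget_update[OF False])
    have [measurable]: "?a \<in> borel_measurable M" "?b \<in> borel_measurable M" "err t \<in> borel_measurable M"
      using budget_measurable err_measurable by (blast intro: past_measurable)+
    have "(\<integral>\<^sup>+\<omega>. ennreal ((norm (err (Suc t) \<omega>))\<^sup>2 / sqrt (?b \<omega>)) \<partial>M)
        = (\<integral>\<^sup>+\<omega>. ?Z \<omega> * ennreal ((norm (err (Suc t) \<omega>))\<^sup>2) \<partial>M)"
      by (intro nn_integral_cong split) simp
    also have "\<dots> \<le> (\<integral>\<^sup>+\<omega>. ?Z \<omega> * ennreal ((norm (err t \<omega>))\<^sup>2 + (?b \<omega> - ?a \<omega>)) \<partial>M)"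
      by (rule err_update[OF False Z])
    also have "\<dots> \<le> (\<integral>\<^sup>+\<omega>. ennreal ((norm (err t \<omega>))\<^sup>2 / sqrt (?a \<omega>)) + ennreal (2 * (sqrt (?b \<omega>) - sqrt (?a \<omega>))) \<partial>M)"
    proof (intro nn_integral_mono)
      fix \<omega>
      define x y where "x = sqrt (?a \<omega>)" and "y = sqrt (?b \<omega>)"
      have xy: "0 < x" "x \<le> y" "?a \<omega> = x\<^sup>2" "?b \<omega> = y\<^sup>2"
        using budget_pos[of t \<omega>] budget_pos[of "Suc t" \<omega>] ab[of \<omega>] by (auto simp: x_def y_def)
      have "(norm (err t \<omega>))\<^sup>2 / y \<le> (norm (err t \<omega>))\<^sup>2 / x" using xy by (intro divide_left_mono) auto
      moreover have "(y\<^sup>2 - x\<^sup>2) / y \<le> 2 * (y - x)"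
      proof -
        have "(y - x) * (y + x) \<le> (y - x) * (2 * y)" using xy by (intro mult_left_mono) auto
        then have "y\<^sup>2 - x\<^sup>2 \<le> 2 * (y - x) * y" by (simp add: power2_eq_square algebra_simps)
        then show ?thesis using xy by (simp add: pos_divide_le_eq)
      qed
      ultimately have "((norm (err t \<omega>))\<^sup>2 + (?b \<omega> - ?a \<omega>)) / y \<le> (norm (err t \<omega>))\<^sup>2 / x + 2 * (y - x)"
        unfolding xy(3,4) add_divide_distrib by (rule add_mono)
      then have "ennreal (((norm (err t \<omega>))\<^sup>2 + (?b \<omega> - ?a \<omega>)) / y) \<le> ennreal ((norm (err t \<omega>))\<^sup>2 / x + 2 * (y - x))"
        by (rule ennreal_leI)
      also have "\<dots> = ennreal ((norm (err t \<omega>))\<^sup>2 / x) + ennreal (2 * (y - x))"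
        using xy by (intro ennreal_plus) auto
      finally show "?Z \<omega> * ennreal ((norm (err t \<omega>))\<^sup>2 + (?b \<omega> - ?a \<omega>))
          \<le> ennreal ((norm (err t \<omega>))\<^sup>2 / sqrt (?a \<omega>)) + ennreal (2 * (sqrt (?b \<omega>) - sqrt (?a \<omega>)))"
        using ab[of \<omega>] by (subst split[symmetric]) (auto simp: x_def y_def)
    qed
    also have "\<dots> = (\<integral>\<^sup>+\<omega>. ennreal ((norm (err t \<omega>))\<^sup>2 / sqrt (?a \<omega>)) \<partial>M)
        + (\<integral>\<^sup>+\<omega>. ennreal (2 * (sqrt (?b \<omega>) - sqrt (?a \<omega>))) \<partial>M)"
      by (intro nn_integral_add) measurable
    also have "\<dots> \<le> (\<integral>\<^sup>+\<omega>. ennreal (2 * sqrt (?a \<omega>)) \<partial>M)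
        + (\<integral>\<^sup>+\<omega>. ennreal (2 * (sqrt (?b \<omega>) - sqrt (?a \<omega>))) \<partial>M)"
      by (intro add_right_mono Suc)
    also have "\<dots> = (\<integral>\<^sup>+\<omega>. ennreal (2 * sqrt (?a \<omega>)) + ennreal (2 * (sqrt (?b \<omega>) - sqrt (?a \<omega>))) \<partial>M)"
      by (intro nn_integral_add[symmetric]) measurable
    also have "\<dots> = (\<integral>\<^sup>+\<omega>. ennreal (2 * sqrt (?b \<omega>)) \<partial>M)"
    proof (intro nn_integral_cong)
      fix \<omega>
      show "ennreal (2 * sqrt (?a \<omega>)) + ennreal (2 * (sqrt (?b \<omega>) - sqrt (?a \<omega>))) = ennreal (2 * sqrt (?b \<omega>))"
        using ab[of \<omega>] budget_pos[of t \<omega>] by (subst ennreal_plus[symmetric]) auto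
    qed
    finally show ?thesis .
  qed
qed

lemma expected_err_le:
  "(\<integral>\<^sup>+\<omega>. ennreal (2 * norm (err t \<omega>)) \<partial>M) \<le> (\<integral>\<^sup>+\<omega>. ennreal (3 * sqrt (budget t \<omega>)) \<partial>M)"
proof -
  let ?a = "budget t"
  have [measurable]: "?a \<in> borel_measurable M" "err t \<in> borel_measurable M"
    using budget_measurable err_measurable by (blast intro: past_measurable)+
  have "(\<integral>\<^sup>+\<omega>. ennreal (2 * norm (err t \<omega>)) \<partial>M)
      \<le> (\<integral>\<^sup>+\<omega>. ennreal ((norm (err t \<omega>))\<^sup>2 / sqrt (?a \<omega>)) + ennreal (sqrt (?a \<omega>)) \<partial>M)"
  proof (intro nn_integral_mono)
    fix \<omega>
    define x where "x = sqrt (?a \<omega>)"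
    have x: "0 < x" using budget_pos[of t \<omega>] by (simp add: x_def)
    have "0 \<le> (norm (err t \<omega>) - x)\<^sup>2 / x" using x by simp
    also have "\<dots> = (norm (err t \<omega>))\<^sup>2 / x + x - 2 * norm (err t \<omega>)"
      using x by (simp add: power2_eq_square field_simps)
    finally have "ennreal (2 * norm (err t \<omega>)) \<le> ennreal ((norm (err t \<omega>))\<^sup>2 / x + x)"
      by (intro ennreal_leI) simp
    also have "\<dots> = ennreal ((norm (err t \<omega>))\<^sup>2 / x) + ennreal x" using x by (intro ennreal_plus) auto
    finally show "ennreal (2 * norm (err t \<omega>)) \<le> ennreal ((norm (err t \<omega>))\<^sup>2 / sqrt (?a \<omega>)) + ennreal (sqrt (?a \<omega>))"
      by (simp add: x_def)
  qed
  also have "\<dots> = (\<integral>\<^sup>+\<omega>. ennreal ((norm (err t \<omega>))\<^sup>2 / sqrt (?a \<omega>)) \<partial>M) + (\<integral>\<^sup>+\<omega>. ennreal (sqrt (?a \<omega>)) \<partial>M)"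
    by (intro nn_integral_add) measurable
  also have "\<dots> \<le> (\<integral>\<^sup>+\<omega>. ennreal (2 * sqrt (?a \<omega>)) \<partial>M) + (\<integral>\<^sup>+\<omega>. ennreal (sqrt (?a \<omega>)) \<partial>M)"
    by (intro add_right_mono weighted_square_err_le)
  also have "\<dots> = (\<integral>\<^sup>+\<omega>. ennreal (2 * sqrt (?a \<omega>)) + ennreal (sqrt (?a \<omega>)) \<partial>M)"
    by (intro nn_integral_add[symmetric]) measurable
  also have "\<dots> = (\<integral>\<^sup>+\<omega>. ennreal (3 * sqrt (?a \<omega>)) \<partial>M)"
  proof (intro nn_integral_cong)
    fix \<omega>
    show "ennreal (2 * sqrt (?a \<omega>)) + ennreal (sqrt (?a \<omega>)) = ennreal (3 * sqrt (?a \<omega>))"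
      using budget_pos[of t \<omega>] by (subst ennreal_plus[symmetric]) auto
  qed
  finally show ?thesis .
qed

lemma gn_slow: "3 / 4 * gn k \<omega> - \<epsilon> * \<beta> \<le> gn (Suc k) \<omega>"
proof -
  have "norm (grad f (w (Suc k) \<omega>) - grad f (w k \<omega>))
      \<le> norm (w (Suc k) \<omega> - w k \<omega>) / \<gamma> * (\<epsilon> * modulus (w k \<omega>))"
    unfolding w_Suc by (intro grad_f_diff_le normalized_step_norm)
  also have "\<dots> \<le> \<epsilon> * modulus (w k \<omega>)"
    unfolding w_Suc using normalized_step_norm[of "w k \<omega>" "v k \<omega>"] \<gamma>_pos \<epsilon> modulus_nonneg
    by (intro mult_left_le_one_le) (auto simp: divide_le_eq_1)
  finally have "gn k \<omega> - gn (Suc k) \<omega> \<le> \<epsilon> * (\<beta> + \<kappa> * gn k \<omega>)"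
    using norm_triangle_ineq3[of "grad f (w (Suc k) \<omega>)" "grad f (w k \<omega>)"]
    unfolding modulus_w gn_def by linarith
  moreover have "\<epsilon> * (\<kappa> * gn k \<omega>) \<le> 1 * (1 / 4 * gn k \<omega>)"
    using \<epsilon> \<kappa> slope \<beta> by (intro mult_mono mult_right_mono) (auto simp: gn_def)
  ultimately show ?thesis by (simp add: distrib_left)
qed

text \<open>The three groups of terms come from the restart, from the constant part \<open>\<beta>\<close> and from the part \<open>\<kappa>\<close> of the modulus. For the
  second, \<open>q \<le> B'\<close> compensates the number of updates; for the third, \<open>(q * \<epsilon>)\<^sup>2 \<le> B'\<close> turns the sum over the
  epoch into an average.\<close>

lemma sqrt_budget_le:
  assumes S: "(\<Sum>k\<in>{epoch_start t..t}. gn k \<omega>) \<le> S"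
  shows "sqrt (budget t \<omega>) \<le> (\<epsilon> + gn (epoch_start t) \<omega> / real q) / 100 + 7 / 6 * (\<beta> * \<epsilon>)
      + 16 / 25 * \<kappa> * (S / real q)"
proof -
  let ?s = "epoch_start t"
  have gn: "0 \<le> gn k \<omega>" for k by (simp add: gn_def)
  have S0: "0 \<le> S" using S by (rule order_trans[rotated]) (intro sum_nonneg gn)
  have B': "real q \<le> real B'" "(real q * \<epsilon>)\<^sup>2 \<le> real B'"
    using small unfolding small_batch_def by (auto simp: power_mult_distrib)
  then have rB': "sqrt (real q) \<le> sqrt (real B')" "real q * \<epsilon> \<le> sqrt (real B')" "0 < sqrt (real B')"
    using B_pos by (auto intro: real_le_rsqrt)
  have restart: "sqrt (((gn ?s \<omega> / real q)\<^sup>2 + \<epsilon>\<^sup>2) / 10000) \<le> (\<epsilon> + gn ?s \<omega> / real q) / 100"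
  proof (rule real_le_lsqrt)
    show "((gn ?s \<omega> / real q)\<^sup>2 + \<epsilon>\<^sup>2) / 10000 \<le> ((\<epsilon> + gn ?s \<omega> / real q) / 100)\<^sup>2"
      using gn[of ?s] \<epsilon> by (simp add: power_divide power2_sum)
  qed (use gn \<epsilon> in simp)
  have steps: "L2_set (\<lambda>k. \<beta> + \<kappa> * gn k \<omega>) {?s..<t} \<le> \<beta> * sqrt (real q) + \<kappa> * (16 / 25 * (S + \<epsilon> * \<beta>))"
  proof -
    have "t - ?s \<le> q" using q_pos by (simp add: epoch_start_def)
    then have "L2_set (\<lambda>k. \<beta>) {?s..<t} \<le> \<beta> * sqrt (real q)"
      using \<beta> by (simp add: L2_set_def real_sqrt_mult mult.commute mult_left_mono)
    moreover have "L2_set (\<lambda>k. \<kappa> * gn k \<omega>) {?s..<t} \<le> \<kappa> * (16 / 25 * (S + \<epsilon> * \<beta>))"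
    proof -
      have "L2_set (\<lambda>k. gn k \<omega>) {?s..<t} \<le> 16 / 25 * ((\<Sum>k\<in>{?s..t}. gn k \<omega>) + \<epsilon> * \<beta>)"
        unfolding L2_set_def
        using sum_squares_le_of_slow_variation[of "\<lambda>k. gn k \<omega>" "\<epsilon> * \<beta>" ?s t] gn gn_slow \<epsilon> \<beta> epoch_start_le
        by (intro real_le_lsqrt) (auto intro!: add_nonneg_nonneg sum_nonneg)
      also have "\<dots> \<le> 16 / 25 * (S + \<epsilon> * \<beta>)" using S by simp
      finally show ?thesis
        unfolding L2_set_right_distrib[OF \<kappa>, symmetric] using \<kappa> by (rule mult_left_mono)
    qed
    ultimately show ?thesis
      using L2_set_triangle_ineq[of "\<lambda>k. \<beta>" "\<lambda>k. \<kappa> * gn k \<omega>" "{?s..<t}"] by linarith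
  qed
  have "sqrt (\<Sum>k\<in>{?s..<t}. (\<epsilon> * modulus (w k \<omega>))\<^sup>2 / real B')
      = \<epsilon> / sqrt (real B') * L2_set (\<lambda>k. \<beta> + \<kappa> * gn k \<omega>) {?s..<t}"
  proof -
    have "(\<Sum>k\<in>{?s..<t}. (\<epsilon> * modulus (w k \<omega>))\<^sup>2 / real B') = \<epsilon>\<^sup>2 / real B' * (\<Sum>k\<in>{?s..<t}. (\<beta> + \<kappa> * gn k \<omega>)\<^sup>2)"
      by (simp add: modulus_w power_mult_distrib sum_distrib_left)
    then show ?thesis using \<epsilon> by (simp add: L2_set_def real_sqrt_mult real_sqrt_divide)
  qed
  also have "\<dots> \<le> \<epsilon> / sqrt (real B') * (\<beta> * sqrt (real q) + \<kappa> * (16 / 25 * (S + \<epsilon> * \<beta>)))"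
    using steps \<epsilon> by (intro mult_left_mono) auto
  also have "\<dots> = \<epsilon> * \<beta> * (sqrt (real q) / sqrt (real B')) + \<epsilon> / sqrt (real B') * (16 / 25 * \<kappa> * (S + \<epsilon> * \<beta>))"
    by (simp add: distrib_left)
  also have "\<dots> \<le> \<epsilon> * \<beta> * 1 + 1 / real q * (16 / 25 * \<kappa> * (S + \<epsilon> * \<beta>))"
  proof (intro add_mono mult_left_mono mult_right_mono)
    show "sqrt (real q) / sqrt (real B') \<le> 1" using rB' by (simp add: divide_le_eq_1)
    show "\<epsilon> / sqrt (real B') \<le> 1 / real q" using rB' q_pos by (simp add: field_simps)
  qed (use \<epsilon> \<beta> \<kappa> S0 in auto)
  also have "\<dots> = \<beta> * \<epsilon> + 16 / 25 * \<kappa> * (S / real q) + 16 / 25 * (\<kappa> * (\<beta> * \<epsilon> / real q))"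
    by (simp add: algebra_simps add_divide_distrib)
  also have "\<dots> \<le> \<beta> * \<epsilon> + 16 / 25 * \<kappa> * (S / real q) + 16 / 25 * (1 / 4 * (\<beta> * \<epsilon>))"
  proof -
    have "\<beta> * \<epsilon> / real q \<le> \<beta> * \<epsilon> / 1" using \<beta> \<epsilon> q_pos by (intro divide_left_mono) auto
    then have "\<kappa> * (\<beta> * \<epsilon> / real q) \<le> 1 / 4 * (\<beta> * \<epsilon>)"
      using slope \<beta> \<kappa> \<epsilon> by (intro mult_mono) auto
    then show ?thesis by (intro add_left_mono mult_left_mono) auto
  qed
  finally have "sqrt (\<Sum>k\<in>{?s..<t}. (\<epsilon> * modulus (w k \<omega>))\<^sup>2 / real B')
      \<le> 29 / 25 * (\<beta> * \<epsilon>) + 16 / 25 * \<kappa> * (S / real q)" by (simp add: algebra_simps)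
  moreover have "sqrt (budget t \<omega>) \<le> sqrt (((gn ?s \<omega> / real q)\<^sup>2 + \<epsilon>\<^sup>2) / 10000)
      + sqrt (\<Sum>k\<in>{?s..<t}. (\<epsilon> * modulus (w k \<omega>))\<^sup>2 / real B')"
    unfolding budget_def by (intro sqrt_add_le_add_sqrt sum_nonneg) auto
  moreover have "29 / 25 * (\<beta> * \<epsilon>) \<le> 7 / 6 * (\<beta> * \<epsilon>)" using \<beta> \<epsilon> by (intro mult_right_mono) auto
  ultimately show ?thesis using restart by linarith
qed

end

section \<open>Averaging over the run\<close>

context independent_samples
begin

text \<open>Independence of the output index is formulated with the joint variable of starting point and samples; this
  inclusion transfers it to everything that the run determines.\<close>

lemma sets_history_subset_joint:
  "sets (history A) \<subseteq> {(\<lambda>\<omega>. (init \<omega>, \<lambda>j. X j \<omega>)) -` C \<inter> space M |C. C \<in> sets (N \<Otimes>\<^sub>M Pi\<^sub>M UNIV (\<lambda>_. P))}"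
proof -
  let ?Z = "\<lambda>\<omega>. (init \<omega>, \<lambda>j. X j \<omega>)" and ?K = "N \<Otimes>\<^sub>M Pi\<^sub>M UNIV (\<lambda>_. P)"
  let ?V = "vimage_algebra (space M) ?Z ?K"
  have Z: "?Z \<in> space M \<rightarrow> space ?K"
    using measurable_space[OF init_meas] measurable_space[OF sample_meas]
    by (auto simp: space_pair_measure space_PiM)
  have ZV: "?Z \<in> measurable ?V ?K" by (rule measurable_vimage_algebra1[OF Z])
  have init_V: "init \<in> measurable ?V N"
    using measurable_compose[OF ZV measurable_fst] by simp
  have X_V: "X j \<in> measurable ?V P" for j
    using measurable_compose[OF measurable_compose[OF ZV measurable_snd] measurable_component_singleton[of j UNIV]]
    by simp
  have "sigma_sets (space ?V) (init_events \<union> (\<Union>j\<in>A. sample_events j)) \<subseteq> sets ?V"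
    using measurable_sets[OF init_V] measurable_sets[OF X_V]
    by (intro sets.sigma_sets_subset) (auto simp: init_events_def sample_events_def)
  then have "sets (history A) \<subseteq> sets ?V" by (simp add: sets_history)
  also have "\<dots> = {?Z -` C \<inter> space M |C. C \<in> sets ?K}" by (rule sets_vimage_algebra2[OF Z])
  finally show ?thesis .
qed

lemma nn_integral_uniform_index:
  fixes g :: "nat \<Rightarrow> 'o \<Rightarrow> ennreal" and \<tau> :: "'o \<Rightarrow> nat"
  assumes T: "0 < T"
    and uniform: "distr M (count_space UNIV) \<tau> = measure_pmf (pmf_of_set {0..<T})"
    and indep: "indep_rv M (count_space UNIV) \<tau> (N \<Otimes>\<^sub>M Pi\<^sub>M UNIV (\<lambda>_. P)) (\<lambda>\<omega>. (init \<omega>, \<lambda>j. X j \<omega>))"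
    and g: "\<And>t. g t \<in> borel_measurable (history UNIV)"
  shows "(\<integral>\<^sup>+\<omega>. g (\<tau> \<omega>) \<omega> \<partial>M) = (\<Sum>t<T. \<integral>\<^sup>+\<omega>. g t \<omega> \<partial>M) / of_nat T"
proof -
  let ?H = "\<lambda>(t, \<omega>). g t \<omega>"
  have \<tau>: "\<tau> \<in> measurable M (count_space UNIV)" using indep by (simp add: indep_rv_def)
  have id: "(\<lambda>\<omega>. \<omega>) \<in> measurable M (history UNIV)"
    using measurable_history[OF measurable_ident] by (simp add: id_def)
  have "(\<integral>\<^sup>+\<omega>. ?H (\<tau> \<omega>, \<omega>) \<partial>M) = (\<integral>\<^sup>+\<omega>. (\<integral>\<^sup>+\<omega>'. ?H (\<tau> \<omega>, \<omega>') \<partial>M) \<partial>M)"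
  proof (rule nn_integral_indep_pair[OF \<tau> id])
    have sub: "{(\<lambda>\<omega>. \<omega>) -` B \<inter> space M |B. B \<in> sets (history UNIV)} \<subseteq> sets (history UNIV)"
    proof -
      have "B \<inter> space M = B" if "B \<in> sets (history UNIV)" for B
        using sets.Int_space_eq2[OF that] by simp
      then show ?thesis by auto
    qed
    note sub' = order_trans[OF sub sets_history_subset_joint]
    have joint: "indep_set {\<tau> -` A \<inter> space M |A. A \<in> sets (count_space UNIV)}
        {(\<lambda>\<omega>. (init \<omega>, \<lambda>j. X j \<omega>)) -` C \<inter> space M |C. C \<in> sets (N \<Otimes>\<^sub>M Pi\<^sub>M UNIV (\<lambda>_. P))}"
      using indep unfolding indep_rv_def by (elim conjE)
    show "indep_set {\<tau> -` A \<inter> space M |A. A \<in> sets (count_space UNIV)}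
        {(\<lambda>\<omega>. \<omega>) -` B \<inter> space M |B. B \<in> sets (history UNIV)}"
      unfolding indep_sets2_eq
    proof (intro conjI ballI)
      show "{\<tau> -` A \<inter> space M |A. A \<in> sets (count_space UNIV)} \<subseteq> events"
        using joint unfolding indep_sets2_eq by (elim conjE)
      show "{(\<lambda>\<omega>. \<omega>) -` B \<inter> space M |B. B \<in> sets (history UNIV)} \<subseteq> events"
        by (rule order_trans[OF sub sets_history_subset])
      fix a b assume "a \<in> {\<tau> -` A \<inter> space M |A. A \<in> sets (count_space UNIV)}"
        "b \<in> {(\<lambda>\<omega>. \<omega>) -` B \<inter> space M |B. B \<in> sets (history UNIV)}"
      from joint[unfolded indep_sets2_eq, THEN conjunct2, THEN conjunct2, rule_format, OF this(1) subsetD[OF sub' this(2)]]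
      show "prob (a \<inter> b) = prob a * prob b" .
    qed
    show "?H \<in> borel_measurable (count_space UNIV \<Otimes>\<^sub>M history UNIV)"
      using g by (intro measurable_pair_measure_countable1) auto
  qed
  also have "\<dots> = (\<integral>\<^sup>+t. (\<integral>\<^sup>+\<omega>. g t \<omega> \<partial>M) \<partial>distr M (count_space UNIV) \<tau>)"
    by (simp add: nn_integral_distr[OF \<tau>])
  also have "\<dots> = (\<Sum>t\<in>{0..<T}. \<integral>\<^sup>+\<omega>. g t \<omega> \<partial>M) / of_nat T"
    unfolding uniform using T by (subst nn_integral_pmf_of_set) auto
  finally show ?thesis by (simp add: atLeast0LessThan)
qed

end

context spider_run
begin

text \<open>Integrability propagates along the run: the gap bounds the gradient norm, and the gradient norm bounds
  the change of the risk in a step.\<close>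

lemma integrable_risk_iterate:
  assumes init: "integrable M (\<lambda>\<omega>. f (w0 \<omega>))"
  shows "integrable M (\<lambda>\<omega>. f (w t \<omega>))" and "integrable M (gn t)"
proof -
  have w: "w t \<in> borel_measurable M" for t by (rule past_measurable[OF w_measurable])
  have f: "(\<lambda>\<omega>. f (w t \<omega>)) \<in> borel_measurable M" for t
    by (rule measurable_compose[OF w f_measurable])
  have gn_meas: "gn t \<in> borel_measurable M" for t by (rule past_measurable[OF gn_measurable])
  have gn_int: "integrable M (gn t)" if "integrable M (\<lambda>\<omega>. f (w t \<omega>))" for t
  proof (rule Bochner_Integration.integrable_bound[OF _ gn_meas])
    show "integrable M (\<lambda>\<omega>. (2 * (f (w t \<omega>) - fstar) + \<gamma>) / \<gamma>)" using that by simp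
    show "AE \<omega> in M. norm (gn t \<omega>) \<le> norm ((2 * (f (w t \<omega>) - fstar) + \<gamma>) / \<gamma>)"
    proof (intro AE_I2)
      fix \<omega>
      have "gn t \<omega> \<le> (2 * (f (w t \<omega>) - fstar) + \<gamma>) / \<gamma>"
        using norm_grad_f_le_gap[of "w t \<omega>"] \<gamma>_pos by (simp add: gn_def pos_le_divide_eq mult.commute)
      then show "norm (gn t \<omega>) \<le> norm ((2 * (f (w t \<omega>) - fstar) + \<gamma>) / \<gamma>)"
        using abs_ge_self[of "(2 * (f (w t \<omega>) - fstar) + \<gamma>) / \<gamma>"] by (simp add: gn_def del: abs_divide)
    qed
  qed
  show "integrable M (\<lambda>\<omega>. f (w t \<omega>))"
  proof (induction t)
    case 0
    then show ?case using init by (simp add: w_0)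
  next
    case (Suc t)
    show ?case
    proof (rule Bochner_Integration.integrable_bound[OF _ f])
      show "integrable M (\<lambda>\<omega>. \<bar>f (w t \<omega>)\<bar> + \<gamma> * gn t \<omega> + \<gamma> * (\<epsilon> * modulus (w t \<omega>)) / 2)"
        using Suc gn_int[OF Suc] by (simp add: modulus_w)
      show "AE \<omega> in M. norm (f (w (Suc t) \<omega>))
          \<le> norm (\<bar>f (w t \<omega>)\<bar> + \<gamma> * gn t \<omega> + \<gamma> * (\<epsilon> * modulus (w t \<omega>)) / 2)"
      proof (intro AE_I2)
        fix \<omega>
        let ?h = "- (\<gamma> *\<^sub>R sgn (v t \<omega>))"
        have h: "norm ?h \<le> \<gamma>" using \<gamma>_pos by (simp add: norm_sgn)
        have "\<bar>?h \<bullet> grad f (w t \<omega>)\<bar> \<le> norm ?h * norm (grad f (w t \<omega>))" by (rule Cauchy_Schwarz_ineq2)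
        also have "\<dots> \<le> \<gamma> * gn t \<omega>" unfolding gn_def using h by (intro mult_right_mono) auto
        finally have "\<bar>?h \<bullet> grad f (w t \<omega>)\<bar> \<le> \<gamma> * gn t \<omega>" .
        moreover have "\<bar>f (w t \<omega> + ?h) - f (w t \<omega>) - ?h \<bullet> grad f (w t \<omega>)\<bar> \<le> \<gamma> * (\<epsilon> * modulus (w t \<omega>)) / 2"
          by (rule f_le_quadratic[OF h])
        moreover have "f (w (Suc t) \<omega>) = f (w t \<omega> + ?h)" by (simp add: w_Suc)
        ultimately show "norm (f (w (Suc t) \<omega>))
            \<le> norm (\<bar>f (w t \<omega>)\<bar> + \<gamma> * gn t \<omega> + \<gamma> * (\<epsilon> * modulus (w t \<omega>)) / 2)"
          unfolding real_norm_def by linarith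
      qed
    qed
  qed
  then show "integrable M (gn t)" by (rule gn_int)
qed

definition mean_gn :: "nat \<Rightarrow> real" where
  "mean_gn t = (\<integral>\<omega>. gn t \<omega> \<partial>M)"

text \<open>The mean of the bound in \<open>sqrt_budget_le\<close> for the sum over the full epoch, which makes it constant along an epoch.\<close>

definition mean_err_bound :: "nat \<Rightarrow> real" where
  "mean_err_bound t = (\<epsilon> + mean_gn (epoch_start t) / real q) / 100 + 7 / 6 * (\<beta> * \<epsilon>)
      + 16 / 25 * \<kappa> * ((\<Sum>k\<in>{epoch_start t..<epoch_start t + q}. mean_gn k) / real q)"

lemma mean_gn_nonneg: "0 \<le> mean_gn t"
  unfolding mean_gn_def by (intro integral_nonneg_AE) (auto simp: gn_def)

lemma mean_err_le:
  assumes init: "integrable M (\<lambda>\<omega>. f (w0 \<omega>))"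
  shows "integrable M (\<lambda>\<omega>. norm (err t \<omega>))"
    and "2 * (\<integral>\<omega>. norm (err t \<omega>) \<partial>M) \<le> 3 * mean_err_bound t"
proof -
  note gn = integrable_risk_iterate(2)[OF init]
  let ?s = "epoch_start t"
  define U where "U \<omega> = (\<epsilon> + gn ?s \<omega> / real q) / 100 + 7 / 6 * (\<beta> * \<epsilon>)
      + 16 / 25 * \<kappa> * ((\<Sum>k\<in>{?s..<?s + q}. gn k \<omega>) / real q)" for \<omega>
  have U_int: "integrable M U"
    unfolding U_def using gn by (intro Bochner_Integration.integrable_add integrable_divide
      integrable_mult_right Bochner_Integration.integrable_sum integrable_const)
  have U_mean: "(\<integral>\<omega>. U \<omega> \<partial>M) = mean_err_bound t"
    unfolding U_def mean_err_bound_def mean_gn_def using gn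
    by (simp add: prob_space Bochner_Integration.integral_sum)
  have le_U: "sqrt (budget t \<omega>) \<le> U \<omega>" for \<omega>
  proof -
    have "t < ?s + q" using mod_less_divisor[OF q_pos, of t] unfolding epoch_start_def by linarith
    then have "(\<Sum>k\<in>{?s..t}. gn k \<omega>) \<le> (\<Sum>k\<in>{?s..<?s + q}. gn k \<omega>)"
      by (intro sum_mono2) (auto simp: gn_def)
    from sqrt_budget_le[OF this] show ?thesis by (simp add: U_def)
  qed
  have U_nonneg: "0 \<le> U \<omega>" for \<omega> using le_U[of \<omega>] budget_pos[of t \<omega>] by (meson less_imp_le order_trans real_sqrt_ge_zero)
  have "(\<integral>\<^sup>+\<omega>. ennreal (2 * norm (err t \<omega>)) \<partial>M) \<le> (\<integral>\<^sup>+\<omega>. ennreal (3 * sqrt (budget t \<omega>)) \<partial>M)"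
    by (rule expected_err_le)
  also have "\<dots> \<le> (\<integral>\<^sup>+\<omega>. ennreal (3 * U \<omega>) \<partial>M)"
    using le_U by (intro nn_integral_mono ennreal_leI) simp
  also have "\<dots> = ennreal (\<integral>\<omega>. 3 * U \<omega> \<partial>M)"
    using U_int U_nonneg by (intro nn_integral_eq_integral) auto
  also have "(\<integral>\<omega>. 3 * U \<omega> \<partial>M) = 3 * mean_err_bound t" using U_mean by simp
  finally have le: "(\<integral>\<^sup>+\<omega>. ennreal (2 * norm (err t \<omega>)) \<partial>M) \<le> ennreal (3 * mean_err_bound t)" .
  have err: "err t \<in> borel_measurable M" by (rule past_measurable[OF err_measurable])
  have int2: "integrable M (\<lambda>\<omega>. 2 * norm (err t \<omega>))"
    using le err by (intro integrableI_bounded) (auto simp: le_less_trans)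
  then show "integrable M (\<lambda>\<omega>. norm (err t \<omega>))" by simp
  have "ennreal (\<integral>\<omega>. 2 * norm (err t \<omega>) \<partial>M) \<le> ennreal (3 * mean_err_bound t)"
    using le nn_integral_eq_integral[OF int2] by simp
  moreover have "0 \<le> mean_err_bound t"
    using U_nonneg unfolding U_mean[symmetric] by (intro integral_nonneg_AE) auto
  ultimately show "2 * (\<integral>\<omega>. norm (err t \<omega>) \<partial>M) \<le> 3 * mean_err_bound t"
    by simp
qed

lemma sum_mean_err_bound:
  "(\<Sum>t<q * K. mean_err_bound t)
    \<le> (real (q * K) * \<epsilon> + (\<Sum>t<q * K. mean_gn t)) / 100 + 7 / 6 * (\<beta> * \<epsilon>) * real (q * K)
      + 16 / 25 * \<kappa> * (\<Sum>t<q * K. mean_gn t)"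
proof -
  define S where "S j = (\<Sum>k\<in>{j * q..<j * q + q}. mean_gn k)" for j
  have block: "(\<Sum>t\<in>{j * q..<j * q + q}. mean_err_bound t)
      \<le> (real q * \<epsilon> + S j) / 100 + 7 / 6 * (\<beta> * \<epsilon>) * real q + 16 / 25 * \<kappa> * S j" for j
  proof -
    have start: "epoch_start t = j * q" if "t \<in> {j * q..<j * q + q}" for t
    proof -
      obtain d where "t = j * q + d" using \<open>t \<in> {j * q..<j * q + q}\<close> by (auto simp: le_iff_add)
      then show ?thesis using \<open>t \<in> {j * q..<j * q + q}\<close> by (simp add: epoch_start_def)
    qed
    have "(\<Sum>t\<in>{j * q..<j * q + q}. mean_err_bound t)
        = (\<Sum>t\<in>{j * q..<j * q + q}. (\<epsilon> + mean_gn (j * q) / real q) / 100 + 7 / 6 * (\<beta> * \<epsilon>) + 16 / 25 * \<kappa> * (S j / real q))"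
      by (intro sum.cong) (auto simp: mean_err_bound_def start S_def)
    also have "\<dots> = (real q * \<epsilon> + mean_gn (j * q)) / 100 + 7 / 6 * (\<beta> * \<epsilon>) * real q + 16 / 25 * \<kappa> * S j"
      using q_pos by (simp add: field_simps)
    also have "mean_gn (j * q) \<le> S j"
      unfolding S_def using q_pos mean_gn_nonneg by (intro member_le_sum) auto
    finally show ?thesis by simp
  qed
  have total: "(\<Sum>j<K. S j) = (\<Sum>t<q * K. mean_gn t)"
    unfolding S_def by (simp add: sum.nat_group mult.commute)
  have "(\<Sum>t<q * K. mean_err_bound t) = (\<Sum>j<K. \<Sum>t\<in>{j * q..<j * q + q}. mean_err_bound t)"
    by (simp add: sum.nat_group mult.commute)
  also have "\<dots> \<le> (\<Sum>j<K. (real q * \<epsilon> + S j) / 100 + 7 / 6 * (\<beta> * \<epsilon>) * real q + 16 / 25 * \<kappa> * S j)"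
    by (intro sum_mono block)
  also have "\<dots> = (real (q * K) * \<epsilon> + (\<Sum>j<K. S j)) / 100 + 7 / 6 * (\<beta> * \<epsilon>) * real (q * K) + 16 / 25 * \<kappa> * (\<Sum>j<K. S j)"
    by (induction K) (simp_all add: field_simps)
  finally show ?thesis unfolding total .
qed

text \<open>Summing the descent inequality leaves the coefficient \<open>c = 97 / 100 - 242 / 100 * \<kappa>\<close> in front of the sum of gradient norms and an
  error of \<open>4 * \<beta> + 3 / 100\<close> times \<open>\<epsilon>\<close> per step. The constraint \<open>6 * \<beta> + 4 * \<kappa> \<le> 1\<close> gives
  \<open>c \<ge> 5 / 16\<close> and makes the error at most \<open>4 / 5 * c\<close>.\<close>

lemma sum_mean_gn_le:
  assumes init: "integrable M (\<lambda>\<omega>. f (w0 \<omega>))"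
  shows "(\<Sum>t<q * K. mean_gn t) \<le> 16 / (5 * \<gamma>) * ((\<integral>\<omega>. f (w0 \<omega>) \<partial>M) - fstar) + 4 / 5 * \<epsilon> * real (q * K)"
proof -
  define T where "T = q * K"
  define G where "G = (\<Sum>t<T. mean_gn t)"
  define \<Delta> where "\<Delta> = (\<integral>\<omega>. f (w0 \<omega>) \<partial>M) - fstar"
  define r where "r t = (\<integral>\<omega>. f (w t \<omega>) \<partial>M)" for t
  note f_int = integrable_risk_iterate(1)[OF init] and gn_int = integrable_risk_iterate(2)[OF init]
  have r_ge: "fstar \<le> r t" for t
  proof -
    have "(\<integral>\<omega>. fstar \<partial>M) \<le> r t"
      unfolding r_def using f_int lower_bound by (intro integral_mono) auto
    then show ?thesis by (simp add: prob_space)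
  qed
  have \<Delta>: "\<Delta> = r 0 - fstar" by (simp add: \<Delta>_def r_def w_0)
  have step: "\<gamma> * mean_gn t \<le> r t - r (Suc t) + \<gamma> * (3 * mean_err_bound t + \<epsilon> * (\<beta> + \<kappa> * mean_gn t) / 2)" for t
  proof -
    have "r (Suc t) \<le> (\<integral>\<omega>. f (w t \<omega>) - \<gamma> * gn t \<omega> + 2 * \<gamma> * norm (err t \<omega>) + \<gamma> * (\<epsilon> * (\<beta> + \<kappa> * gn t \<omega>)) / 2 \<partial>M)"
      unfolding r_def
    proof (intro integral_mono f_int)
      show "integrable M (\<lambda>\<omega>. f (w t \<omega>) - \<gamma> * gn t \<omega> + 2 * \<gamma> * norm (err t \<omega>) + \<gamma> * (\<epsilon> * (\<beta> + \<kappa> * gn t \<omega>)) / 2)"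
        using f_int gn_int mean_err_le(1)[OF init] by simp
      show "f (w (Suc t) \<omega>) \<le> f (w t \<omega>) - \<gamma> * gn t \<omega> + 2 * \<gamma> * norm (err t \<omega>) + \<gamma> * (\<epsilon> * (\<beta> + \<kappa> * gn t \<omega>)) / 2" for \<omega>
        using normalized_step_descent[of "w t \<omega>" "v t \<omega>"] unfolding modulus_w w_Suc by (simp add: gn_def err_def)
    qed
    also have "\<dots> = r t - \<gamma> * mean_gn t + \<gamma> * (2 * (\<integral>\<omega>. norm (err t \<omega>) \<partial>M)) + \<gamma> * (\<epsilon> * (\<beta> + \<kappa> * mean_gn t)) / 2"
      using f_int gn_int mean_err_le(1)[OF init] by (simp add: r_def mean_gn_def prob_space)
    also have "\<gamma> * (2 * (\<integral>\<omega>. norm (err t \<omega>) \<partial>M)) \<le> \<gamma> * (3 * mean_err_bound t)"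
      using mean_err_le(2)[OF init] \<gamma>_pos by (intro mult_left_mono) auto
    finally show ?thesis by (simp add: algebra_simps)
  qed
  have "\<gamma> * G = (\<Sum>t<T. \<gamma> * mean_gn t)" by (simp add: G_def sum_distrib_left)
  also have "\<dots> \<le> (\<Sum>t<T. r t - r (Suc t) + \<gamma> * (3 * mean_err_bound t + \<epsilon> * (\<beta> + \<kappa> * mean_gn t) / 2))"
    by (intro sum_mono step)
  also have "\<dots> = r 0 - r T + \<gamma> * (3 * (\<Sum>t<T. mean_err_bound t) + \<epsilon> * (\<beta> * real T + \<kappa> * G) / 2)"
    unfolding G_def by (induction T) (simp_all add: field_simps)
  also have "\<dots> \<le> \<Delta> + \<gamma> * (3 * (\<Sum>t<T. mean_err_bound t) + \<epsilon> * (\<beta> * real T + \<kappa> * G) / 2)"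
    using r_ge[of T] by (simp add: \<Delta>)
  finally have "G \<le> \<Delta> / \<gamma> + (3 * (\<Sum>t<T. mean_err_bound t) + \<epsilon> * (\<beta> * real T + \<kappa> * G) / 2)"
    using \<gamma>_pos by (simp add: field_simps)
  moreover have "(\<Sum>t<T. mean_err_bound t) \<le> (real T * \<epsilon> + G) / 100 + 7 / 6 * (\<beta> * \<epsilon>) * real T + 16 / 25 * \<kappa> * G"
    using sum_mean_err_bound[of K] by (simp add: T_def G_def)
  moreover have G: "0 \<le> G" unfolding G_def by (intro sum_nonneg mean_gn_nonneg)
  moreover have "\<epsilon> * (\<kappa> * G) \<le> 1 * (\<kappa> * G)"
    using \<epsilon> \<kappa> G by (intro mult_right_mono) auto
  ultimately have "G \<le> \<Delta> / \<gamma> + 3 / 100 * (real T * \<epsilon>) + 3 / 100 * G + 4 * (\<beta> * (real T * \<epsilon>)) + 242 / 100 * (\<kappa> * G)"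
    by (simp add: field_simps)
  moreover define c where "c = 97 / 100 - 242 / 100 * \<kappa>"
  moreover have "4 * \<beta> + 3 / 100 \<le> 4 / 5 * c"
  proof -
    have "4 / 5 * c = 97 / 125 - 242 / 125 * \<kappa>" by (simp add: c_def right_diff_distrib)
    then show ?thesis using slope \<beta> \<kappa> by linarith
  qed
  moreover have c: "5 / 16 \<le> c" using slope \<beta> \<kappa> unfolding c_def by linarith
  moreover have "0 \<le> real T * \<epsilon>" using \<epsilon> by simp
  ultimately have "c * G \<le> \<Delta> / \<gamma> + 4 / 5 * c * (real T * \<epsilon>)"
    using mult_right_mono[of "4 * \<beta> + 3 / 100" "4 / 5 * c" "real T * \<epsilon>"]
    by (simp add: c_def algebra_simps)
  moreover have "\<Delta> / \<gamma> \<le> c * (16 / (5 * \<gamma>) * \<Delta>)"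
  proof -
    have "5 / 16 * (16 / (5 * \<gamma>) * \<Delta>) \<le> c * (16 / (5 * \<gamma>) * \<Delta>)"
      using c r_ge[of 0] \<gamma>_pos by (intro mult_right_mono) (auto simp: \<Delta>)
    then show ?thesis by simp
  qed
  ultimately have "c * G \<le> c * (16 / (5 * \<gamma>) * \<Delta> + 4 / 5 * \<epsilon> * real T)"
    by (simp add: algebra_simps)
  then have "G \<le> 16 / (5 * \<gamma>) * \<Delta> + 4 / 5 * \<epsilon> * real T"
    using c by (simp only: mult_le_cancel_left_pos)
  then show ?thesis by (simp add: G_def T_def \<Delta>_def)
qed

end

text \<open>The uniform output index turns the average over the run into an expectation.\<close>

lemma spider_expected_gradient_le:
  fixes P :: "'s measure" and F :: "'s \<Rightarrow> 'a::euclidean_space \<Rightarrow> real" and M :: "'o measure"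
  assumes \<alpha>: "0 < \<alpha>" "\<alpha> \<le> 1"
    and smooth: "EL_sym_star P F \<alpha> L0 L1"
    and unbiased: "unbiased_gradients P F"
    and noise: "\<Gamma> > 0" "\<Lambda> > 0" "gradient_variance_bound P F \<Gamma> \<Lambda>"
    and minimum: "\<And>u. fstar \<le> risk P F u"
    and \<epsilon>: "0 < \<epsilon>" "\<epsilon> < 1" and q: "0 < q" and K: "0 < K" and T: "T = q * K"
    and batches: "large_batch \<Gamma> \<Lambda> \<epsilon> q B" "small_batch \<epsilon> q B'"
    and random: "spider_randomness M P w0 X T \<tau>"
    and init: "integrable M (\<lambda>\<omega>. risk P F (w0 \<omega>))"
  defines "\<gamma> \<equiv> learning_rate \<alpha> L0 L1 \<Gamma> \<Lambda> \<epsilon>"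
  defines "G \<equiv> (\<lambda>\<omega>. norm (grad (risk P F) (spider_iterate F \<gamma> q B B' (w0 \<omega>) (X \<omega>) (\<tau> \<omega>))))"
  shows "integrable M G"
    and "(\<integral>\<omega>. G \<omega> \<partial>M) \<le> 16 / (5 * real T * \<gamma>) * ((\<integral>\<omega>. risk P F (w0 \<omega>) \<partial>M) - fstar) + 4 * \<epsilon> / 5"
proof -
  have L: "L0 > 0" "L1 > 0" and stochastic: "differentiable_stochastic P F"
    using smooth by (auto simp: EL_sym_star_def)
  have \<gamma>: "0 < \<gamma>" unfolding \<gamma>_def by (rule learning_rate_pos[OF L noise(1,2) \<epsilon>(1)])
  obtain \<beta> \<kappa> where \<beta>\<kappa>: "0 \<le> \<beta>" "0 \<le> \<kappa>" "6 * \<beta> + 4 * \<kappa> \<le> 1"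
    and lipschitz: "\<And>u u'. norm (u' - u) \<le> \<gamma> \<Longrightarrow>
      (\<integral>\<xi>. (norm (grad (F \<xi>) u' - grad (F \<xi>) u))\<^sup>2 \<partial>P)
        \<le> (norm (u' - u) / \<gamma> * (\<epsilon> * (\<beta> + \<kappa> * norm (grad (risk P F) u))))\<^sup>2"
    by (rule mean_square_grad_diff_le_affine[OF smooth \<alpha> unbiased noise(3,1,2) \<epsilon>, folded \<gamma>_def])
      (rule that; assumption)
  have T_pos: "0 < T" using q K T by simp
  have joint_eq: "(\<lambda>\<omega> (t, i). X \<omega> t i) = (\<lambda>\<omega> j. (\<lambda>(t, i) \<omega>. X \<omega> t i) j \<omega>)"
    and joint_eq': "(\<lambda>\<omega>. (w0 \<omega>, \<lambda>(t, i). X \<omega> t i)) = (\<lambda>\<omega>. (w0 \<omega>, \<lambda>j. (\<lambda>(t, i) \<omega>. X \<omega> t i) j \<omega>))"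
    by (intro ext; simp add: split_beta)+
  note random' = random[unfolded spider_randomness_def]
  have prob: "prob_space M" by (rule random'[THEN conjunct1])
  have distr: "\<forall>t i. distr M P (\<lambda>\<omega>. X \<omega> t i) = P" by (rule random'[THEN conjunct2, THEN conjunct1])
  have indep: "prob_space.indep_vars M (\<lambda>_. P) (\<lambda>(t, i) \<omega>. X \<omega> t i) UNIV" by (rule random'[THEN conjunct2, THEN conjunct2, THEN conjunct1])
  have uniform: "distr M (count_space UNIV) \<tau> = measure_pmf (pmf_of_set {0..<T})" by (rule random'[THEN conjunct2, THEN conjunct2, THEN conjunct2, THEN conjunct2, THEN conjunct1])
  note indep_init = random'[THEN conjunct2, THEN conjunct2, THEN conjunct2, THEN conjunct1, unfolded joint_eq]
    and indep_\<tau> = random'[THEN conjunct2, THEN conjunct2, THEN conjunct2, THEN conjunct2, THEN conjunct2, unfolded joint_eq']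
  interpret M: prob_space M by (rule prob)
  interpret spider_run P F \<gamma> \<epsilon> \<beta> \<kappa> \<Gamma> \<Lambda> fstar M w0 X q B B'
  proof unfold_locales
    show "w0 \<in> borel_measurable M"
      by (rule indep_init[unfolded indep_rv_def, THEN conjunct1])
    show "M.indep_set {w0 -` A \<inter> space M |A. A \<in> sets borel}
        {(\<lambda>\<omega> j. (\<lambda>(t, i) \<omega>. X \<omega> t i) j \<omega>) -` A \<inter> space M |A. A \<in> sets (Pi\<^sub>M UNIV (\<lambda>_. P))}"
      by (rule indep_init[unfolded indep_rv_def, THEN conjunct2, THEN conjunct2])
    show "distr M P ((\<lambda>(t, i) \<omega>. X \<omega> t i) j) = P" for j
      using distr by (cases j) simp
    show "integrable P (\<lambda>\<xi>. (norm (grad (F \<xi>) u' - grad (F \<xi>) u))\<^sup>2)" for u u'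
      using smooth by (simp add: EL_sym_star_def)
    show "M.indep_vars (\<lambda>_. P) (\<lambda>(t, i) \<omega>. X \<omega> t i) UNIV" by (rule indep)
    show "(\<integral>\<xi>. (norm (grad (F \<xi>) u' - grad (F \<xi>) u))\<^sup>2 \<partial>P)
        \<le> (norm (u' - u) / \<gamma> * (\<epsilon> * (\<beta> + \<kappa> * norm (grad (risk P F) u))))\<^sup>2"
      if "norm (u' - u) \<le> \<gamma>" for u u' using that by (rule lipschitz)
  qed (rule stochastic unbiased noise \<gamma> \<epsilon> \<beta>\<kappa> minimum q batches)+
  have G: "G \<omega> = gn (\<tau> \<omega>) \<omega>" for \<omega> by (simp add: G_def gn_def w_def)
  have \<tau>: "\<tau> \<in> measurable M (count_space UNIV)" using indep_\<tau> by (simp add: indep_rv_def)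
  have gn_meas: "gn t \<in> borel_measurable M" for t by (rule past_measurable[OF gn_measurable])
  have G_meas: "G \<in> borel_measurable M"
    unfolding G[abs_def] by (rule measurable_compose_countable[OF gn_meas \<tau>])
  have hist: "(\<lambda>\<omega>. ennreal (gn t \<omega>)) \<in> borel_measurable (history UNIV)" for t
  proof -
    have "gn t \<in> borel_measurable (history UNIV)"
      using gn_measurable unfolding past_def by (rule measurable_history_mono) simp
    then show ?thesis by simp
  qed
  have "(\<integral>\<^sup>+\<omega>. ennreal (G \<omega>) \<partial>M) = (\<Sum>t<T. \<integral>\<^sup>+\<omega>. ennreal (gn t \<omega>) \<partial>M) / of_nat T"
    unfolding G by (rule nn_integral_uniform_index[OF T_pos uniform indep_\<tau> hist])
  also have "(\<Sum>t<T. \<integral>\<^sup>+\<omega>. ennreal (gn t \<omega>) \<partial>M) = ennreal (\<Sum>t<T. mean_gn t)"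
  proof -
    have "(\<integral>\<^sup>+\<omega>. ennreal (gn t \<omega>) \<partial>M) = ennreal (mean_gn t)" for t
      unfolding mean_gn_def
      by (intro nn_integral_eq_integral AE_I2 integrable_risk_iterate(2)[OF init]) (simp add: gn_def)
    then show ?thesis using mean_gn_nonneg by (simp add: sum_ennreal)
  qed
  also have "ennreal (\<Sum>t<T. mean_gn t) / of_nat T = ennreal ((\<Sum>t<T. mean_gn t) / real T)"
    using T_pos mean_gn_nonneg by (simp add: divide_ennreal sum_nonneg ennreal_of_nat_eq_real_of_nat)
  finally have nn: "(\<integral>\<^sup>+\<omega>. ennreal (G \<omega>) \<partial>M) = ennreal ((\<Sum>t<T. mean_gn t) / real T)" .
  have G_nonneg: "0 \<le> G \<omega>" for \<omega> by (simp add: G_def)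
  show G_int: "integrable M G"
    by (rule integrableI_nonneg[OF G_meas]) (simp_all add: G_nonneg nn)
  have "ennreal (\<integral>\<omega>. G \<omega> \<partial>M) = ennreal ((\<Sum>t<T. mean_gn t) / real T)"
    using nn nn_integral_eq_integral[OF G_int] G_nonneg by simp
  then have "(\<integral>\<omega>. G \<omega> \<partial>M) = (\<Sum>t<T. mean_gn t) / real T"
    using G_nonneg mean_gn_nonneg
    by (subst (asm) ennreal_inj) (simp_all add: integral_nonneg_AE sum_nonneg)
  also have "\<dots> \<le> (16 / (5 * \<gamma>) * ((\<integral>\<omega>. risk P F (w0 \<omega>) \<partial>M) - fstar) + 4 / 5 * \<epsilon> * real T) / real T"
    using sum_mean_gn_le[OF init, of K] by (intro divide_right_mono) (auto simp: T)
  also have "\<dots> = 16 / (5 * real T * \<gamma>) * ((\<integral>\<omega>. risk P F (w0 \<omega>) \<partial>M) - fstar) + 4 * \<epsilon> / 5"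
    using T_pos by (simp add: add_divide_distrib mult.commute mult.left_commute)
  finally show "(\<integral>\<omega>. G \<omega> \<partial>M) \<le> 16 / (5 * real T * \<gamma>) * ((\<integral>\<omega>. risk P F (w0 \<omega>) \<partial>M) - fstar) + 4 * \<epsilon> / 5" .
qed

section \<open>Sample complexity\<close>

lemma sum_batch_size_le:
  assumes "0 < q"
  shows "(\<Sum>t<q * K. real (batch_size q B B' t)) \<le> real K * (real B + real q * real B')"
proof -
  have block: "(\<Sum>t\<in>{j * q..<j * q + q}. real (batch_size q B B' t)) \<le> real B + real q * real B'" for j
  proof -
    have "real (batch_size q B B' t) \<le> (if t = j * q then real B else 0) + real B'"
      if t: "t \<in> {j * q..<j * q + q}" for t
    proof -
      obtain d where "t = j * q + d" using t by (auto simp: le_iff_add)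
      then show ?thesis using t by (auto simp: batch_size_def)
    qed
    then have "(\<Sum>t\<in>{j * q..<j * q + q}. real (batch_size q B B' t))
        \<le> (\<Sum>t\<in>{j * q..<j * q + q}. (if t = j * q then real B else 0) + real B')"
      by (rule sum_mono)
    also have "\<dots> = real B + real q * real B'"
      using assms by (simp add: sum.distrib)
    finally show ?thesis .
  qed
  have "(\<Sum>t<q * K. real (batch_size q B B' t)) = (\<Sum>j<K. \<Sum>t\<in>{j * q..<j * q + q}. real (batch_size q B B' t))"
    by (simp add: sum.nat_group mult.commute)
  also have "\<dots> \<le> (\<Sum>j<K. real B + real q * real B')" by (intro sum_mono block)
  finally show ?thesis by simp
qed

lemma bigo_at_right_0I:
  fixes h g :: "real \<Rightarrow> real"
  assumes "\<And>\<epsilon>. 0 < \<epsilon> \<Longrightarrow> \<epsilon> < 1 \<Longrightarrow> 0 \<le> h \<epsilon> \<and> h \<epsilon> \<le> c * g \<epsilon>" and "0 \<le> c"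
  shows "h \<in> O[at_right 0](g)"
proof (rule bigoI[of _ c])
  show "\<forall>\<^sub>F \<epsilon> in at_right 0. norm (h \<epsilon>) \<le> c * norm (g \<epsilon>)"
  proof (rule eventually_at_rightI[of 0 1])
    fix \<epsilon> :: real assume "\<epsilon> \<in> {0<..<1}"
    then have "0 \<le> h \<epsilon>" "h \<epsilon> \<le> c * g \<epsilon>" using assms(1)[of \<epsilon>] by auto
    moreover have "c * g \<epsilon> \<le> c * \<bar>g \<epsilon>\<bar>" using assms(2) by (intro mult_left_mono) auto
    ultimately show "norm (h \<epsilon>) \<le> c * norm (g \<epsilon>)" by simp
  qed simp
qed

lemma half_le_floor:
  fixes x :: real
  assumes "1 \<le> x"
  shows "x / 2 \<le> real (nat \<lfloor>x\<rfloor>)" and "real (nat \<lfloor>x\<rfloor>) \<le> x"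
proof -
  have "1 \<le> \<lfloor>x\<rfloor>" using assms by simp
  then have "real (nat \<lfloor>x\<rfloor>) = of_int \<lfloor>x\<rfloor>" by simp
  moreover have "x < of_int \<lfloor>x\<rfloor> + 1" by linarith
  moreover have "1 \<le> (of_int \<lfloor>x\<rfloor> :: real)" using \<open>1 \<le> \<lfloor>x\<rfloor>\<close> by simp
  ultimately show "x / 2 \<le> real (nat \<lfloor>x\<rfloor>)" "real (nat \<lfloor>x\<rfloor>) \<le> x" by linarith+
qed

lemma learning_rate_linear:
  "learning_rate \<alpha> L0 L1 \<Gamma> \<Lambda> \<epsilon> = \<epsilon> * learning_rate \<alpha> L0 L1 \<Gamma> \<Lambda> 1"
  by (simp add: learning_rate_def)

theorem theorem4:
  fixes P :: "'s measure" and F :: "'s \<Rightarrow> real ^ 'd \<Rightarrow> real"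
    and \<alpha> L0 L1 \<Gamma> \<Lambda> fstar :: real
  assumes alpha: "0 < \<alpha>" "\<alpha> \<le> 1"
    and smooth: "EL_sym_star P F \<alpha> L0 L1"
    and unbiased: "unbiased_gradients P F"
    and noise: "\<Gamma> > 0" "\<Lambda> > 0" "gradient_variance_bound P F \<Gamma> \<Lambda>"
    and minimum: "\<exists>w. risk P F w = fstar" "\<forall>w. fstar \<le> risk P F w"
  shows
    "(\<forall>\<epsilon> q B B' K T (M :: 'o measure) w\<^sub>0 X \<tau>.
        0 < \<epsilon> \<and> \<epsilon> < 1 \<and> 0 < q \<and> 0 < K \<and> T = q * K \<and>
        large_batch \<Gamma> \<Lambda> \<epsilon> q B \<and> small_batch \<epsilon> q B' \<and>
        spider_randomness M P w\<^sub>0 X T \<tau> \<and> integrable M (\<lambda>\<omega>. risk P F (w\<^sub>0 \<omega>)) \<longrightarrow>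
        (let \<gamma> = learning_rate \<alpha> L0 L1 \<Gamma> \<Lambda> \<epsilon>;
             G = (\<lambda>\<omega>. norm (grad (risk P F)
                    (spider_iterate F \<gamma> q B B' (w\<^sub>0 \<omega>) (X \<omega>) (\<tau> \<omega>))))
         in integrable M G \<and>
            (\<integral>\<omega>. G \<omega> \<partial>M)
              \<le> 16 / (5 * real T * \<gamma>) * ((\<integral>\<omega>. risk P F (w\<^sub>0 \<omega>) \<partial>M) - fstar) + 4 * \<epsilon> / 5))
     \<and>
     (\<forall>\<Delta>. \<exists>(q :: real \<Rightarrow> nat) (B :: real \<Rightarrow> nat) (B' :: real \<Rightarrow> nat)
              (K :: real \<Rightarrow> nat) (T :: real \<Rightarrow> nat).
        (\<lambda>\<epsilon>. real (B \<epsilon>)) \<in> O[at_right 0](\<lambda>\<epsilon>. 1 / \<epsilon>\<^sup>2) \<and>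
        (\<lambda>\<epsilon>. real (q \<epsilon>)) \<in> O[at_right 0](\<lambda>\<epsilon>. 1 / \<epsilon>) \<and>
        (\<lambda>\<epsilon>. learning_rate \<alpha> L0 L1 \<Gamma> \<Lambda> \<epsilon>) \<in> O[at_right 0](\<lambda>\<epsilon>. \<epsilon>) \<and>
        (\<lambda>\<epsilon>. real (T \<epsilon>)) \<in> O[at_right 0](\<lambda>\<epsilon>. 1 / \<epsilon>\<^sup>2) \<and>
        (\<lambda>\<epsilon>. \<Sum>t<T \<epsilon>. real (batch_size (q \<epsilon>) (B \<epsilon>) (B' \<epsilon>) t)) \<in> O[at_right 0](\<lambda>\<epsilon>. 1 / \<epsilon> ^ 3) \<and>
        (\<forall>\<epsilon>. 0 < \<epsilon> \<and> \<epsilon> < 1 \<longrightarrow>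
           0 < q \<epsilon> \<and> 0 < K \<epsilon> \<and> T \<epsilon> = q \<epsilon> * K \<epsilon> \<and> B' \<epsilon> = q \<epsilon> \<and>
           large_batch \<Gamma> \<Lambda> \<epsilon> (q \<epsilon>) (B \<epsilon>) \<and> small_batch \<epsilon> (q \<epsilon>) (B' \<epsilon>) \<and>
           (\<forall>(M :: 'o measure) w\<^sub>0 X \<tau>.
              spider_randomness M P w\<^sub>0 X (T \<epsilon>) \<tau> \<and>
              integrable M (\<lambda>\<omega>. risk P F (w\<^sub>0 \<omega>)) \<and>
              (\<integral>\<omega>. risk P F (w\<^sub>0 \<omega>) \<partial>M) - fstar = \<Delta> \<longrightarrow>
              (let G = (\<lambda>\<omega>. norm (grad (risk P F)
                     (spider_iterate F (learning_rate \<alpha> L0 L1 \<Gamma> \<Lambda> \<epsilon>)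
                        (q \<epsilon>) (B \<epsilon>) (B' \<epsilon>) (w\<^sub>0 \<omega>) (X \<omega>) (\<tau> \<omega>))))
               in integrable M G \<and> (\<integral>\<omega>. G \<omega> \<partial>M) \<le> \<epsilon>))))"
proof (intro conjI allI impI, goal_cases)
  case (1 \<epsilon> q B B' K T M w\<^sub>0 X \<tau>)
  then have run: "0 < \<epsilon>" "\<epsilon> < 1" "0 < q" "0 < K" "T = q * K" "large_batch \<Gamma> \<Lambda> \<epsilon> q B" "small_batch \<epsilon> q B'"
    "spider_randomness M P w\<^sub>0 X T \<tau>" "integrable M (\<lambda>\<omega>. risk P F (w\<^sub>0 \<omega>))"
    by blast+
  note bound = spider_expected_gradient_le[OF alpha smooth unbiased noise minimum(2)[rule_format] run]
  show ?case unfolding Let_def by (rule conjI[OF bound])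
next
  case (2 \<Delta>)
  have L: "L0 > 0" "L1 > 0" using smooth by (auto simp: EL_sym_star_def)
  define \<rho> where "\<rho> = learning_rate \<alpha> L0 L1 \<Gamma> \<Lambda> 1"
  have \<rho>: "0 < \<rho>" unfolding \<rho>_def by (rule learning_rate_pos[OF L noise(1,2)]) simp
  have rate: "learning_rate \<alpha> L0 L1 \<Gamma> \<Lambda> \<epsilon> = \<epsilon> * \<rho>" for \<epsilon>
    unfolding \<rho>_def by (rule learning_rate_linear)
  \<comment> \<open>Rounding \<open>1 / \<epsilon>\<close> down keeps \<open>q * \<epsilon>\<^sup>2 \<le> 1\<close>, as batches of size \<open>q\<close> require.\<close>
  define q where "q \<epsilon> = nat \<lfloor>1 / \<epsilon>\<rfloor>" for \<epsilon> :: real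
  define b where "b \<epsilon> = 10000 * max (\<Lambda>\<^sup>2 / \<epsilon>\<^sup>2) (\<Gamma>\<^sup>2 * (real (q \<epsilon>))\<^sup>2)" for \<epsilon>
  define B where "B \<epsilon> = nat \<lceil>b \<epsilon>\<rceil>" for \<epsilon>
  \<comment> \<open>Since \<open>q \<ge> 1 / (2 * \<epsilon>)\<close>, that many epochs make the first term of the bound at most \<open>\<epsilon> / 5\<close>.\<close>
  define k where "k \<epsilon> = 32 * \<bar>\<Delta>\<bar> / (\<rho> * \<epsilon>)" for \<epsilon>
  define K where "K \<epsilon> = Suc (nat \<lceil>k \<epsilon>\<rceil>)" for \<epsilon>
  define T where "T \<epsilon> = q \<epsilon> * K \<epsilon>" for \<epsilon>
  define cB where "cB = 10000 * (\<Lambda>\<^sup>2 + \<Gamma>\<^sup>2) + 1"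
  define cK where "cK = 32 * \<bar>\<Delta>\<bar> / \<rho> + 2"
  have c: "0 \<le> cB" "0 \<le> cK" using \<rho> by (auto simp: cB_def cK_def)
  have q_bounds: "1 / \<epsilon> / 2 \<le> real (q \<epsilon>)" "real (q \<epsilon>) \<le> 1 / \<epsilon>" "0 < q \<epsilon>" if "0 < \<epsilon>" "\<epsilon> < 1" for \<epsilon>
  proof -
    have "1 \<le> 1 / \<epsilon>" using that by (simp add: pos_le_divide_eq)
    from half_le_floor[OF this] show "1 / \<epsilon> / 2 \<le> real (q \<epsilon>)" "real (q \<epsilon>) \<le> 1 / \<epsilon>"
      by (simp_all add: q_def)
    moreover have "0 < 1 / \<epsilon> / 2" using that by simp
    ultimately have "0 < real (q \<epsilon>)" by linarith
    then show "0 < q \<epsilon>" by simp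
  qed
  have one_le: "1 \<le> 1 / \<epsilon>" "1 \<le> 1 / \<epsilon>\<^sup>2" if "0 < \<epsilon>" "\<epsilon> < 1" for \<epsilon> :: real
    using that power_le_one[of \<epsilon> 2] by (simp_all add: pos_le_divide_eq)
  have B_le: "real (B \<epsilon>) \<le> cB * (1 / \<epsilon>\<^sup>2)" if "0 < \<epsilon>" "\<epsilon> < 1" for \<epsilon>
  proof -
    have "(real (q \<epsilon>))\<^sup>2 \<le> (1 / \<epsilon>)\<^sup>2" using q_bounds[OF that] by (intro power_mono) auto
    then have "\<Gamma>\<^sup>2 * (real (q \<epsilon>))\<^sup>2 \<le> \<Gamma>\<^sup>2 * (1 / \<epsilon>\<^sup>2)"
      by (intro mult_left_mono) (auto simp: power_divide)
    moreover have "0 \<le> \<Lambda>\<^sup>2 / \<epsilon>\<^sup>2" "0 \<le> \<Gamma>\<^sup>2 * (1 / \<epsilon>\<^sup>2)" by simp_all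
    ultimately have "max (\<Lambda>\<^sup>2 / \<epsilon>\<^sup>2) (\<Gamma>\<^sup>2 * (real (q \<epsilon>))\<^sup>2) \<le> \<Lambda>\<^sup>2 / \<epsilon>\<^sup>2 + \<Gamma>\<^sup>2 * (1 / \<epsilon>\<^sup>2)"
      by linarith
    then have "b \<epsilon> \<le> 10000 * (\<Lambda>\<^sup>2 / \<epsilon>\<^sup>2 + \<Gamma>\<^sup>2 * (1 / \<epsilon>\<^sup>2))"
      unfolding b_def by (intro mult_left_mono) auto
    moreover have "cB * (1 / \<epsilon>\<^sup>2) = 10000 * (\<Lambda>\<^sup>2 / \<epsilon>\<^sup>2 + \<Gamma>\<^sup>2 * (1 / \<epsilon>\<^sup>2)) + 1 / \<epsilon>\<^sup>2"
      by (simp add: cB_def add_divide_distrib)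
    ultimately have "b \<epsilon> + 1 \<le> cB * (1 / \<epsilon>\<^sup>2)"
      using one_le[OF that] by linarith
    moreover have "0 \<le> b \<epsilon>" by (simp add: b_def le_max_iff_disj)
    ultimately show ?thesis unfolding B_def by linarith
  qed
  have K_le: "real (K \<epsilon>) \<le> cK * (1 / \<epsilon>)" if "0 < \<epsilon>" "\<epsilon> < 1" for \<epsilon>
  proof -
    have "0 \<le> k \<epsilon>" using \<rho> that by (simp add: k_def)
    then have "real (K \<epsilon>) \<le> k \<epsilon> + 2" unfolding K_def by linarith
    also have "\<dots> \<le> k \<epsilon> + 2 * (1 / \<epsilon>)" using one_le[OF that] by simp
    also have "\<dots> = cK * (1 / \<epsilon>)" by (simp add: k_def cK_def add_divide_distrib)
    finally show ?thesis .
  qed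
  have T_le: "real (T \<epsilon>) \<le> cK * (1 / \<epsilon>\<^sup>2)" if "0 < \<epsilon>" "\<epsilon> < 1" for \<epsilon>
  proof -
    have "real (q \<epsilon>) * real (K \<epsilon>) \<le> 1 / \<epsilon> * (cK * (1 / \<epsilon>))"
      using q_bounds[OF that] K_le[OF that] that by (intro mult_mono) auto
    then show ?thesis by (simp add: T_def power2_eq_square)
  qed
  have cost_le: "(\<Sum>t<T \<epsilon>. real (batch_size (q \<epsilon>) (B \<epsilon>) (q \<epsilon>) t)) \<le> cK * (cB + 1) * (1 / \<epsilon> ^ 3)"
    if "0 < \<epsilon>" "\<epsilon> < 1" for \<epsilon>
  proof -
    have "real (q \<epsilon>) * real (q \<epsilon>) \<le> 1 / \<epsilon> * (1 / \<epsilon>)"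
      using q_bounds[OF that] that by (intro mult_mono) auto
    then have "real (B \<epsilon>) + real (q \<epsilon>) * real (q \<epsilon>) \<le> (cB + 1) * (1 / \<epsilon>\<^sup>2)"
      using B_le[OF that] by (simp add: power2_eq_square add_divide_distrib)
    then have "real (K \<epsilon>) * (real (B \<epsilon>) + real (q \<epsilon>) * real (q \<epsilon>)) \<le> cK * (1 / \<epsilon>) * ((cB + 1) * (1 / \<epsilon>\<^sup>2))"
      using K_le[OF that] c that by (intro mult_mono) auto
    then show ?thesis
      using sum_batch_size_le[OF q_bounds(3)[OF that], of "B \<epsilon>" "q \<epsilon>" "K \<epsilon>"]
      unfolding T_def by (simp add: power2_eq_square power3_eq_cube)
  qed
  have large: "large_batch \<Gamma> \<Lambda> \<epsilon> (q \<epsilon>) (B \<epsilon>)" for \<epsilon>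
    unfolding large_batch_def B_def b_def[symmetric] by (rule of_nat_ceiling)
  have small: "small_batch \<epsilon> (q \<epsilon>) (q \<epsilon>)" if "0 < \<epsilon>" "\<epsilon> < 1" for \<epsilon>
  proof -
    have "real (q \<epsilon>) * \<epsilon> \<le> 1" using q_bounds(2)[OF that] that by (simp add: pos_le_divide_eq)
    then have "real (q \<epsilon>) * \<epsilon> * \<epsilon> \<le> 1 * 1" using that by (intro mult_mono) auto
    then have "real (q \<epsilon>) * (real (q \<epsilon>) * \<epsilon> * \<epsilon>) \<le> real (q \<epsilon>) * (1 * 1)" by (intro mult_left_mono) auto
    then show ?thesis by (simp add: small_batch_def power2_eq_square mult.assoc mult.left_commute)
  qed
  have long: "16 / (5 * real (T \<epsilon>) * (\<epsilon> * \<rho>)) * \<Delta> \<le> \<epsilon> / 5" if "0 < \<epsilon>" "\<epsilon> < 1" for \<epsilon>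
  proof -
    have "k \<epsilon> \<le> real (K \<epsilon>)" unfolding K_def by linarith
    then have "1 / \<epsilon> / 2 * k \<epsilon> \<le> real (q \<epsilon>) * real (K \<epsilon>)"
      using q_bounds(1)[OF that] \<rho> that by (intro mult_mono) (auto simp: k_def)
    then have "1 / \<epsilon> / 2 * k \<epsilon> * (\<epsilon> * \<epsilon> * \<rho>) \<le> real (T \<epsilon>) * (\<epsilon> * \<epsilon> * \<rho>)"
      using that \<rho> unfolding T_def of_nat_mult by (intro mult_right_mono) auto
    moreover have "1 / \<epsilon> / 2 * k \<epsilon> * (\<epsilon> * \<epsilon> * \<rho>) = 16 * \<bar>\<Delta>\<bar>" using that \<rho> by (simp add: k_def)
    ultimately have "16 * \<Delta> \<le> real (T \<epsilon>) * (\<epsilon> * \<epsilon> * \<rho>)" by linarith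
    moreover have "0 < q \<epsilon> * K \<epsilon>" using q_bounds(3)[OF that] by (simp add: K_def)
    then have "0 < real (T \<epsilon>)" unfolding T_def by (simp only: of_nat_0_less_iff)
    ultimately show ?thesis using that \<rho> by (simp add: divide_le_eq algebra_simps)
  qed
  show ?case
  proof (intro exI conjI allI impI)
    show "(\<lambda>\<epsilon>. real (B \<epsilon>)) \<in> O[at_right 0](\<lambda>\<epsilon>. 1 / \<epsilon>\<^sup>2)"
      by (rule bigo_at_right_0I[OF _ c(1)]) (use B_le in simp)
    show "(\<lambda>\<epsilon>. real (q \<epsilon>)) \<in> O[at_right 0](\<lambda>\<epsilon>. 1 / \<epsilon>)"
      by (rule bigo_at_right_0I[of _ 1]) (use q_bounds in simp_all)
    show "(\<lambda>\<epsilon>. learning_rate \<alpha> L0 L1 \<Gamma> \<Lambda> \<epsilon>) \<in> O[at_right 0](\<lambda>\<epsilon>. \<epsilon>)"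
      by (rule bigo_at_right_0I[of _ \<rho>]) (use \<rho> in \<open>simp_all add: rate mult.commute\<close>)
    show "(\<lambda>\<epsilon>. real (T \<epsilon>)) \<in> O[at_right 0](\<lambda>\<epsilon>. 1 / \<epsilon>\<^sup>2)"
      by (rule bigo_at_right_0I[OF _ c(2)]) (use T_le in simp)
    show "(\<lambda>\<epsilon>. \<Sum>t<T \<epsilon>. real (batch_size (q \<epsilon>) (B \<epsilon>) (q \<epsilon>) t)) \<in> O[at_right 0](\<lambda>\<epsilon>. 1 / \<epsilon> ^ 3)"
      by (rule bigo_at_right_0I[of _ "cK * (cB + 1)"])
        (use cost_le c in \<open>auto intro!: sum_nonneg mult_nonneg_nonneg\<close>)
  next
    fix \<epsilon> :: real assume \<epsilon>: "0 < \<epsilon> \<and> \<epsilon> < 1"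
    then have \<epsilon>': "0 < \<epsilon>" "\<epsilon> < 1" by auto
    show "0 < q \<epsilon>" by (rule q_bounds(3)[OF \<epsilon>'])
    show K_pos: "0 < K \<epsilon>" by (simp add: K_def)
    show T_eq: "T \<epsilon> = q \<epsilon> * K \<epsilon>" by (simp add: T_def)
    show "q \<epsilon> = q \<epsilon>" ..
    show "large_batch \<Gamma> \<Lambda> \<epsilon> (q \<epsilon>) (B \<epsilon>)" by (rule large)
    show "small_batch \<epsilon> (q \<epsilon>) (q \<epsilon>)" by (rule small[OF \<epsilon>'])
    fix M :: "'o measure" and w\<^sub>0 X \<tau>
    assume run: "spider_randomness M P w\<^sub>0 X (T \<epsilon>) \<tau> \<and> integrable M (\<lambda>\<omega>. risk P F (w\<^sub>0 \<omega>))
      \<and> (\<integral>\<omega>. risk P F (w\<^sub>0 \<omega>) \<partial>M) - fstar = \<Delta>"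
    note bound = spider_expected_gradient_le[OF alpha smooth unbiased noise minimum(2)[rule_format] \<epsilon>'
      q_bounds(3)[OF \<epsilon>'] K_pos T_eq large small[OF \<epsilon>'] run[THEN conjunct1] run[THEN conjunct2, THEN conjunct1]]
    show "let G = (\<lambda>\<omega>. norm (grad (risk P F) (spider_iterate F (learning_rate \<alpha> L0 L1 \<Gamma> \<Lambda> \<epsilon>)
        (q \<epsilon>) (B \<epsilon>) (q \<epsilon>) (w\<^sub>0 \<omega>) (X \<omega>) (\<tau> \<omega>))))
      in integrable M G \<and> (\<integral>\<omega>. G \<omega> \<partial>M) \<le> \<epsilon>"
      unfolding Let_def
    proof (rule conjI[OF bound(1) order_trans[OF bound(2)]])
      have "16 / (5 * real (T \<epsilon>) * learning_rate \<alpha> L0 L1 \<Gamma> \<Lambda> \<epsilon>) * ((\<integral>\<omega>. risk P F (w\<^sub>0 \<omega>) \<partial>M) - fstar)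
          + 4 * \<epsilon> / 5 = 16 / (5 * real (T \<epsilon>) * (\<epsilon> * \<rho>)) * \<Delta> + 4 * \<epsilon> / 5"
        unfolding rate run[THEN conjunct2, THEN conjunct2] ..
      also have "\<dots> \<le> \<epsilon> / 5 + 4 * \<epsilon> / 5" using long[OF \<epsilon>'] by (intro add_right_mono)
      also have "\<dots> = \<epsilon>" by simp
      finally show "16 / (5 * real (T \<epsilon>) * learning_rate \<alpha> L0 L1 \<Gamma> \<Lambda> \<epsilon>)
          * ((\<integral>\<omega>. risk P F (w\<^sub>0 \<omega>) \<partial>M) - fstar) + 4 * \<epsilon> / 5 \<le> \<epsilon>" .
    qed
  qed
qed

end
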